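(* Let $F$ be a field and let $G$ be a graph. Then the exterior algebraic shift $\operatorname{Shift}_F I(G)$ of the independence complex of $G$ is (isomorphic to) the independence complex $I(G')$ of some graph $G'$ if and only if $G$ is co-chordal.
   Context: Graphs are finite and simple. The independence complex $I(G)$ is the simplicial complex on vertex set $V(G)$ whose faces are the independent sets of $G$. A graph is chordal if every induced subgraph which is a cycle has length 3; a graph is co-chordal if its complement graph is chordal. Exterior algebraic shifting: let $\Delta$ be a simplicial complex with $n$ vertices, identified with $\{1,\dots,n\}$. Let $K=F(\alpha_{ij}:1\le i,j\le n)$ be the field extension of $F$ by $n^2$ algebraically independent elements, and let $E$ be the exterior algebra of $K^n$ with standard basis $e_1,\dots,e_n$. Put $f_i=\sum_{j}\alpha_{ij}e_j$, and for $S=\{i_1<\dots<i_s\}$ put $e_S=e_{i_1}\wedge\dots\wedge e_{i_s}$ and $f_S=f_{i_1}\wedge\dots\wedge f_{i_s}$. Let $J_\Delta$ be the $K$-span of $\{e_S : S\notin\Delta\}$ (an ideal of $E$). For $|R|=|S|$ with $R\ne S$, write $R<_{\mathrm{lex}}S$ if the minimum element of the symmetric difference of $R$ and $S$ lies in $R$. Then $$\operatorname{Shift}_F\Delta=\{S\subseteq\{1,\dots,n\} : f_S\notin J_\Delta+\operatorname{span}_K\{f_R : |R|=|S|,\ R<_{\mathrm{lex}}S\}\},$$ a simplicial complex on an ordered vertex set $v_1,\dots,v_n$ (with $i$ written as $v_i$). *)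

theory Defs
  imports Complex_Main "HOL-Library.Poly_Mapping" "HOL-Library.Function_Algebras"
begin

section \<open>Finite simple graphs and independence complexes\<close>

definition simple_graph :: "'a set \<Rightarrow> 'a set set \<Rightarrow> bool" where
  "simple_graph V E \<longleftrightarrow> finite V \<and> (\<forall>e\<in>E. e \<subseteq> V \<and> card e = 2)"

definition complement_edges :: "'a set \<Rightarrow> 'a set set \<Rightarrow> 'a set set" where
  "complement_edges V E = {e. e \<subseteq> V \<and> card e = 2 \<and> e \<notin> E}"

definition induced_edges :: "'a set set \<Rightarrow> 'a set \<Rightarrow> 'a set set" where
  "induced_edges E W = {e \<in> E. e \<subseteq> W}"

definition is_cycle :: "nat \<Rightarrow> 'a set \<Rightarrow> 'a set set \<Rightarrow> bool" where
  "is_cycle k W E \<longleftrightarrow> k \<ge> 3 \<and>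
     (\<exists>c. bij_betw c {..<k} W \<and> E = {{c i, c (Suc i mod k)} | i. i < k})"

definition chordal :: "'a set \<Rightarrow> 'a set set \<Rightarrow> bool" where
  "chordal V E \<longleftrightarrow> (\<forall>W k. W \<subseteq> V \<and> is_cycle k W (induced_edges E W) \<longrightarrow> k = 3)"

definition co_chordal :: "'a set \<Rightarrow> 'a set set \<Rightarrow> bool" where
  "co_chordal V E \<longleftrightarrow> chordal V (complement_edges V E)"

definition independence_complex :: "'a set \<Rightarrow> 'a set set \<Rightarrow> 'a set set" where
  "independence_complex V E = {S. S \<subseteq> V \<and> (\<forall>e\<in>E. \<not> e \<subseteq> S)}"

text \<open>
  Simplicial complexes are given by their set of faces. Isomorphisms are taken with respect
  to explicitly given vertex sets.
\<close>

definition complex_iso :: "'a set \<Rightarrow> 'a set set \<Rightarrow> 'b set \<Rightarrow> 'b set set \<Rightarrow> bool" where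
  "complex_iso V \<Delta> W \<Gamma> \<longleftrightarrow> (\<exists>\<phi>. bij_betw \<phi> V W \<and> (\<lambda>S. \<phi> ` S) ` \<Delta> = \<Gamma>)"


section \<open>Field extensions by algebraically independent elements\<close>

text \<open>
  A polynomial over \<open>'f\<close> in variables indexed by \<open>'i\<close> is a finitely supported map from
  exponent vectors \<open>'i \<Rightarrow>\<^sub>0 nat\<close> to \<open>'f\<close>.
\<close>

type_synonym ('i, 'f) mpoly = "('i \<Rightarrow>\<^sub>0 nat) \<Rightarrow>\<^sub>0 'f"

definition mpoly_vars :: "('i, 'f::zero) mpoly \<Rightarrow> 'i set" where
  "mpoly_vars p = (\<Union>m \<in> Poly_Mapping.keys p. Poly_Mapping.keys m)"

definition mpoly_eval :: "('f::field \<Rightarrow> 'k::field) \<Rightarrow> ('i \<Rightarrow> 'k) \<Rightarrow> ('i, 'f) mpoly \<Rightarrow> 'k" where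
  "mpoly_eval emb a p = (\<Sum>m \<in> Poly_Mapping.keys p.
     emb (Poly_Mapping.lookup p m) *
       (\<Prod>i \<in> Poly_Mapping.keys m. a i ^ Poly_Mapping.lookup m i))"

definition field_embedding :: "('f::field \<Rightarrow> 'k::field) \<Rightarrow> bool" where
  "field_embedding emb \<longleftrightarrow> emb 1 = 1 \<and>
     (\<forall>x y. emb (x + y) = emb x + emb y) \<and> (\<forall>x y. emb (x * y) = emb x * emb y)"

definition alg_independent :: "('f::field \<Rightarrow> 'k::field) \<Rightarrow> 'i set \<Rightarrow> ('i \<Rightarrow> 'k) \<Rightarrow> bool" where
  "alg_independent emb I a \<longleftrightarrow>
     (\<forall>p. mpoly_vars p \<subseteq> I \<and> mpoly_eval emb a p = 0 \<longrightarrow> p = 0)"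

definition generated_field :: "('f::field \<Rightarrow> 'k::field) \<Rightarrow> 'i set \<Rightarrow> ('i \<Rightarrow> 'k) \<Rightarrow> 'k set" where
  "generated_field emb I a = {mpoly_eval emb a p / mpoly_eval emb a q | p q.
     mpoly_vars p \<subseteq> I \<and> mpoly_vars q \<subseteq> I \<and> mpoly_eval emb a q \<noteq> 0}"

text \<open>
  The field \<open>'k\<close> is, via \<open>emb\<close>, the extension of \<open>'f\<close> by the algebraically independent
  elements \<open>\<alpha> i j\<close> with \<open>1 \<le> i, j \<le> n\<close>.
\<close>

definition generic_extension ::
    "('f::field \<Rightarrow> 'k::field) \<Rightarrow> nat \<Rightarrow> (nat \<Rightarrow> nat \<Rightarrow> 'k) \<Rightarrow> bool" where
  "generic_extension emb n \<alpha> \<longleftrightarrow> field_embedding emb \<and>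
     alg_independent emb ({1..n} \<times> {1..n}) (\<lambda>(i, j). \<alpha> i j) \<and>
     generated_field emb ({1..n} \<times> {1..n}) (\<lambda>(i, j). \<alpha> i j) = UNIV"


section \<open>The exterior algebra\<close>

text \<open>
  An element of the exterior algebra over \<open>'k\<close> on generators indexed by natural numbers is
  represented by its coordinates with respect to the basis of all \<open>e\<^sub>S\<close>, \<open>S\<close> a finite set.
  The exterior algebra of \<open>K\<^sup>n\<close> consists of the elements supported on subsets of \<open>{1..n}\<close>;
  all elements occurring in the definition of the shift are of this kind. Addition is the
  pointwise one.
\<close>

type_synonym 'k ext = "nat set \<Rightarrow> 'k"

definition ext_scale :: "'k::field \<Rightarrow> 'k ext \<Rightarrow> 'k ext" where
  "ext_scale c x = (\<lambda>S. c * x S)"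

global_interpretation ext: vector_space "ext_scale :: 'k::field \<Rightarrow> 'k ext \<Rightarrow> 'k ext"
  by unfold_locales (auto simp: ext_scale_def fun_eq_iff algebra_simps)

text \<open>
  For disjoint \<open>S\<close> and \<open>T\<close> one has \<open>e\<^sub>S \<and> e\<^sub>T = shuffle_sign S T \<cdot> e\<close> with \<open>e\<close> the basis
  element of \<open>S \<union> T\<close>: the exponent counts the transpositions that sort the factors.
\<close>

definition shuffle_sign :: "nat set \<Rightarrow> nat set \<Rightarrow> 'k::field" where
  "shuffle_sign S T = (- 1) ^ card {(i, j). i \<in> S \<and> j \<in> T \<and> j < i}"

definition wedge :: "'k::field ext \<Rightarrow> 'k ext \<Rightarrow> 'k ext" where
  "wedge x y = (\<lambda>U. \<Sum>S \<in> Pow U. shuffle_sign S (U - S) * x S * y (U - S))"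

definition ext_one :: "'k::field ext" where
  "ext_one = (\<lambda>S. if S = {} then 1 else 0)"

definition ext_gen :: "nat \<Rightarrow> 'k::field ext" where
  "ext_gen i = (\<lambda>S. if S = {i} then 1 else 0)"

text \<open>The product of the \<open>g i\<close>, \<open>i \<in> S\<close>, taken in increasing order of the indices.\<close>

definition wedge_over :: "(nat \<Rightarrow> 'k::field ext) \<Rightarrow> nat set \<Rightarrow> 'k ext" where
  "wedge_over g S = foldr (\<lambda>i x. wedge (g i) x) (sorted_list_of_set S) ext_one"

definition ext_basis :: "nat set \<Rightarrow> 'k::field ext" where
  "ext_basis S = wedge_over ext_gen S"


section \<open>Exterior algebraic shifting\<close>

definition generic_gen :: "(nat \<Rightarrow> nat \<Rightarrow> 'k::field) \<Rightarrow> nat \<Rightarrow> nat \<Rightarrow> 'k ext" where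
  "generic_gen \<alpha> n i = (\<Sum>j = 1..n. ext_scale (\<alpha> i j) (ext_gen j))"

definition generic_basis :: "(nat \<Rightarrow> nat \<Rightarrow> 'k::field) \<Rightarrow> nat \<Rightarrow> nat set \<Rightarrow> 'k ext" where
  "generic_basis \<alpha> n S = wedge_over (generic_gen \<alpha> n) S"

definition face_ideal :: "nat \<Rightarrow> nat set set \<Rightarrow> 'k::field ext set" where
  "face_ideal n \<Delta> = ext.span {ext_basis S | S. S \<subseteq> {1..n} \<and> S \<notin> \<Delta>}"

definition lex_less :: "nat set \<Rightarrow> nat set \<Rightarrow> bool" where
  "lex_less R S \<longleftrightarrow> R \<noteq> S \<and> Min ((R - S) \<union> (S - R)) \<in> R"

definition exterior_shift ::
    "(nat \<Rightarrow> nat \<Rightarrow> 'k::field) \<Rightarrow> nat \<Rightarrow> nat set set \<Rightarrow> nat set set" where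
  "exterior_shift \<alpha> n \<Delta> = {S. S \<subseteq> {1..n} \<and>
     generic_basis \<alpha> n S \<notin>
       {x + y | x y. x \<in> face_ideal n \<Delta> \<and>
          y \<in> ext.span {generic_basis \<alpha> n R | R.
                 R \<subseteq> {1..n} \<and> card R = card S \<and> lex_less R S}}}"

end

theory Submission
  imports Defs
begin

text \<open>
  Let \<open>D\<close> be the complement graph, so that the independence complex is the clique complex of \<open>D\<close>.
  A stress of order \<open>k\<close> is an alternating matrix supported on the edges of \<open>D\<close> that is killed by the
  first \<open>k\<close> rows of the generic matrix. By duality the space of these stresses has dimension
  \<open>z\<^sub>k(D)\<close>, the number of edges of the shift whose smaller end point exceeds \<open>k\<close>. The shift
  \<open>\<Gamma>\<close> is closed under subsets and shifted, and it has as many faces of each size as the clique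
  complex. Hence it is flag if and only if \<open>D\<close> has as many cliques of each size as the graph of
  \<open>\<Gamma>\<close>, and the cliques of the latter with \<open>t + 3\<close> vertices are counted by
  \<open>\<Sum>\<^sub>k (k - 1 choose t) z\<^sub>k(D)\<close>.

  Deleting a vertex of degree \<open>d\<close> lowers \<open>z\<^sub>k\<close> by at most \<open>d - k\<close> (truncated at \<open>0\<close>); removing
  simplicial vertices one after the other gives the required equality for chordal \<open>D\<close>. In general
  it lowers \<open>\<Sum>\<^sub>k z\<^sub>k\<close> by at least the number of triangles at the vertex, because the stresses of order
  \<open>k - 1\<close> on the neighbourhood extend to stresses of order \<open>k\<close> on the cone. Deleting all vertices off
  an induced cycle of length at least 4, which carries a stress of order 1 but no triangle, one
  obtains strictly fewer triangles in \<open>D\<close> than in the graph of \<open>\<Gamma>\<close>.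

  Genericity enters only through specialization: the dimension of the solution space of a linear
  system whose coefficients are polynomials in the generic matrix can only grow when other values
  are substituted for the matrix entries.
\<close>

section \<open>Dimensions of solution spaces\<close>

text \<open>Every face of \<open>\<Gamma>\<close> is a clique of the graph of
  \<open>\<Gamma>\<close>, and the face numbers are preserved, so flagness can be decided by
  inequalities between clique numbers. The weights come from the hockey-stick identity: a clique
  with t + 3 vertices is an edge p < q together with t + 1 of the p - 1 smaller vertices, and (p - 1
  choose t + 1) is the sum of (k - 1 choose t) over k < p. Applied twice, the identity turns the
  defects d - k at a simplicial vertex into (d choose t + 2), the number of cliques through that
  vertex. In the lower bound the cone contributes at least z_{k-1} - z_k of the neighbourhood in
  order k, and this telescopes to the number of edges there, i.e. of triangles at the vertex. The
  obstacle is that F may be finite and of any characteristic, so generic points cannot be chosen in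
  F. A specialization therefore maps F[\<alpha>] into K itself, and its values may again depend on
  \<alpha>; being defined on a ring only, it forces elimination without division. Characteristic 2
  forces alternating and antisymmetric to be kept apart.\<close>

text \<open>\<open>dim\<close> is 0 on sets that span an infinite-dimensional space, and
  \<open>'k ext\<close> is infinite-dimensional. Monotonicity is therefore stated for sets inside
  the span of a finite set.\<close>

lemma (in vector_space) dim_mono_finite_span:
  assumes "S \<subseteq> T" "T \<subseteq> span W" "finite W"
  shows "dim S \<le> dim T"
proof -
  obtain B where B: "B \<subseteq> S" "independent B" "S \<subseteq> span B" "card B = dim S"
    by (rule basis_exists[of S])
  obtain C where C: "C \<subseteq> T" "independent C" "T \<subseteq> span C" "card C = dim T"
    by (rule basis_exists[of T])
  have "finite C"
    using C(1) assms(2) by (intro independent_span_bound[OF assms(3) C(2), THEN conjunct1]) auto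
  then show ?thesis
    using independent_span_bound[OF _ B(2), of C] B C assms(1) by auto
qed

lemma (in vector_space) subspace_eq_if_dim_eq:
  assumes "S \<subseteq> T" "T \<subseteq> span W" "finite W" "subspace S" "dim S = dim T"
  shows "S = T"
proof (rule ccontr)
  assume "S \<noteq> T"
  then obtain t where t: "t \<in> T" "t \<notin> S" using assms(1) by (meson subsetI subset_antisym)
  obtain B where B: "B \<subseteq> S" "independent B" "S \<subseteq> span B" "card B = dim S"
    by (rule basis_exists[of S])
  have "span B \<subseteq> S" using B(1) assms(4) by (rule span_minimal)
  then have "t \<notin> span B" using t(2) by blast
  then have ind: "independent (insert t B)"
    using B(2) by (rule independent_insertI)
  have tB: "t \<notin> B" using t(2) B(1) by blast
  have fin: "finite (insert t B)"
  proof -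
    have "insert t B \<subseteq> span W" using t(1) B(1) assms(1,2) by blast
    then show ?thesis by (rule independent_span_bound[OF assms(3) ind, THEN conjunct1])
  qed
  have "card (insert t B) = dim (insert t B)"
    by (rule dim_eq_card_independent[OF ind, symmetric])
  also have "\<dots> \<le> dim T"
  proof (rule dim_mono_finite_span)
    show "insert t B \<subseteq> T" using t(1) B(1) assms(1) by blast
  qed (rule assms(2), rule assms(3))
  finally have "card (insert t B) \<le> card B" using B(4) assms(5) by simp
  moreover have "card (insert t B) = Suc (card B)" using fin tB by simp
  ultimately show False by simp
qed

text \<open>A basis A of the kernel is extended to a basis B of Z, and f maps B - A to a basis of
  the image. The domain is a finite-dimensional subspace Z because the ambient space is
  infinite-dimensional.\<close>

lemma (in vector_space_pair) rank_nullity: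
  assumes f: "Vector_Spaces.linear s1 s2 f" and Z: "vs1.subspace Z" "Z \<subseteq> vs1.span W" "finite W"
  shows "vs1.dim Z = vs1.dim {z \<in> Z. f z = 0} + vs2.dim (f ` Z)"
proof -
  interpret f: Vector_Spaces.linear s1 s2 f by (rule f)
  let ?K = "{z \<in> Z. f z = 0}"
  obtain A where A: "A \<subseteq> ?K" "vs1.independent A" "?K \<subseteq> vs1.span A" "card A = vs1.dim ?K"
    by (rule vs1.basis_exists[of ?K])
  obtain B where B: "A \<subseteq> B" "B \<subseteq> Z" "vs1.independent B" "Z \<subseteq> vs1.span B"
    using A(1,2) by (blast intro: vs1.maximal_independent_subset_extend[of A Z])
  have finB: "finite B"
    using B(2) Z(2) by (intro vs1.independent_span_bound[OF Z(3) B(3), THEN conjunct1]) auto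
  let ?C = "B - A"
  have CZ: "vs1.span ?C \<subseteq> Z"
    using B(2) Z(1) by (intro vs1.span_minimal) auto
  have indC: "vs1.independent ?C"
    using B(3) vs1.independent_mono by blast
  \<comment> \<open>Such an x is in the kernel, hence in the span of A as well as in that of B - A;
    its coordinates with respect to B vanish outside both sets.\<close>
  have "x = 0" if x: "x \<in> vs1.span ?C" "f x = 0" for x
  proof -
    have "x \<in> vs1.span A" using x CZ A(3) by blast
    then have "vs1.representation B x = vs1.representation A x"
      by (rule vs1.representation_extend[OF B(3) _ B(1)])
    moreover have "vs1.representation B x = vs1.representation ?C x"
      by (rule vs1.representation_extend[OF B(3) x(1)]) auto
    ultimately have "vs1.representation ?C x b = 0" for b
      using vs1.representation_ne_zero[of A x b] vs1.representation_ne_zero[of ?C x b] by auto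
    then show "x = 0"
      using vs1.sum_nonzero_representation_eq[OF indC x(1)] by simp
  qed
  then have inj: "inj_on f (vs1.span ?C)"
    using f.inj_on_iff_eq_0[OF vs1.subspace_span] by blast
  have "f ` Z \<subseteq> vs2.span (f ` B)"
    using B(4) by (rule f.spans_image)
  also have "f ` B \<subseteq> insert 0 (f ` ?C)" using A(1) by auto
  then have "vs2.span (f ` B) \<subseteq> vs2.span (f ` ?C)"
    using vs2.span_mono vs2.span_insert_0 by metis
  finally have "vs2.dim (f ` Z) = card (f ` ?C)"
    using f.independent_injective_image[OF indC inj] B(2)
    by (intro vs2.dim_unique[of "f ` ?C"]) auto
  also have "\<dots> = card ?C"
    using inj vs1.span_superset by (intro card_image) (rule inj_on_subset)
  also have "\<dots> = card B - card A"
    using A(1) B(1) finB by (simp add: card_Diff_subset finite_subset)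
  finally show ?thesis
    using A(4) vs1.basis_card_eq_dim[OF B(2,4,3)] card_mono[OF finB B(1)] by simp
qed

section \<open>Coordinate subspaces and homogeneous linear systems\<close>

global_interpretation ext_pair: vector_space_pair
  "ext_scale :: 'k::field \<Rightarrow> 'k ext \<Rightarrow> 'k ext" "ext_scale :: 'k \<Rightarrow> 'k ext \<Rightarrow> 'k ext"
  by unfold_locales

abbreviation ext_linear :: "('k::field ext \<Rightarrow> 'k ext) \<Rightarrow> bool" where
  "ext_linear \<equiv> Vector_Spaces.linear ext_scale ext_scale"

lemma ext_linearI:
  assumes "\<And>x y. f (x + y) = f x + f y" "\<And>c x. f (ext_scale c x) = ext_scale c (f x)"
  shows "ext_linear f"
  using assms by (simp add: Vector_Spaces.linear_iff ext.vector_space_axioms)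

definition coord_space :: "nat set set \<Rightarrow> 'k::field ext set" where
  "coord_space X = {w. \<forall>S. S \<notin> X \<longrightarrow> w S = 0}"

definition unit_ext :: "nat set \<Rightarrow> 'k::field ext" where
  "unit_ext S = (\<lambda>T. if T = S then 1 else 0)"

definition pairing :: "nat set set \<Rightarrow> 'k::field ext \<Rightarrow> 'k ext \<Rightarrow> 'k" where
  "pairing X w u = (\<Sum>S\<in>X. w S * u S)"

text \<open>A homogeneous linear system with unknowns indexed by X, equations by Q and coefficients
  \<open>A q S\<close>. Vectors and functionals share the type \<open>'k ext\<close>, with
  \<open>pairing X\<close> as evaluation, so one vector space interpretation covers both.\<close>

definition solutions :: "nat set set \<Rightarrow> 'q set \<Rightarrow> ('q \<Rightarrow> 'k::field ext) \<Rightarrow> 'k ext set" where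
  "solutions X Q A = {w \<in> coord_space X. \<forall>q\<in>Q. pairing X w (A q) = 0}"

lemma sum_fun_apply: "(\<Sum>i\<in>I. f i) x = (\<Sum>i\<in>I. f i x)"
  by (induction I rule: infinite_finite_induct) auto

lemma coord_space_expand:
  assumes "finite X" "w \<in> coord_space X"
  shows "w = (\<Sum>S\<in>X. ext_scale (w S) (unit_ext S))"
proof
  fix T
  have "(\<Sum>S\<in>X. ext_scale (w S) (unit_ext S)) T = (\<Sum>S\<in>X. if S = T then w S else 0)"
    unfolding sum_fun_apply by (intro sum.cong) (auto simp: ext_scale_def unit_ext_def)
  then show "w T = (\<Sum>S\<in>X. ext_scale (w S) (unit_ext S)) T"
    using assms by (simp add: coord_space_def)
qed

lemma coord_space_subset_span:
  assumes "finite X"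
  shows "coord_space X \<subseteq> ext.span (unit_ext ` X)"
proof
  fix w :: "'a ext"
  assume "w \<in> coord_space X"
  then have "w = (\<Sum>S\<in>X. ext_scale (w S) (unit_ext S))"
    by (rule coord_space_expand[OF assms])
  also have "\<dots> \<in> ext.span (unit_ext ` X)"
    by (intro ext.span_sum ext.span_scale ext.span_base) auto
  finally show "w \<in> ext.span (unit_ext ` X)" .
qed

lemma subspace_coord_space: "ext.subspace (coord_space X)"
  by (intro ext.subspaceI) (auto simp: coord_space_def ext_scale_def)

lemma pairing_add: "pairing X (v + w) u = pairing X v u + pairing X w u"
  by (simp add: pairing_def sum.distrib algebra_simps)

lemma pairing_scale: "pairing X (ext_scale c w) u = c * pairing X w u"
  by (simp add: pairing_def ext_scale_def sum_distrib_left algebra_simps)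

lemma subspace_solutions: "ext.subspace (solutions X Q A)"
  using subspace_coord_space[of X]
  by (auto simp: solutions_def ext.subspace_def pairing_add pairing_scale) (simp add: pairing_def)

lemma dim_mono_coord_space:
  assumes "Y \<subseteq> Z" "Z \<subseteq> coord_space X" "finite X"
  shows "ext.dim Y \<le> ext.dim Z"
  using assms coord_space_subset_span[OF assms(3)]
  by (intro ext.dim_mono_finite_span[of _ _ "unit_ext ` X"]) auto

lemma rank_nullity_coord_space:
  assumes "ext_linear f" "ext.subspace Z" "Z \<subseteq> coord_space X" "finite X"
  shows "ext.dim Z = ext.dim {z \<in> Z. f z = 0} + ext.dim (f ` Z)"
  using assms coord_space_subset_span[OF assms(4)]
  by (intro ext_pair.rank_nullity[of _ _ "unit_ext ` X"]) auto

lemma dim_le_if_linear_injection: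
  assumes f: "ext_linear f" and Z: "ext.subspace Z" "Z \<subseteq> coord_space X" "finite X"
    and im: "f ` Z \<subseteq> Y" "Y \<subseteq> coord_space X'" "finite X'"
    and ker: "\<And>z. z \<in> Z \<Longrightarrow> f z = 0 \<Longrightarrow> z = 0"
  shows "ext.dim Z \<le> ext.dim Y"
proof -
  have "ext.dim {z \<in> Z. f z = 0} \<le> card ({} :: 'a ext set)"
    using ker by (intro ext.dim_le_card) auto
  then show ?thesis
    using rank_nullity_coord_space[OF f Z] dim_mono_coord_space[OF im] by simp
qed

lemma dim_coord_space:
  assumes "finite X"
  shows "ext.dim (coord_space X :: 'k::field ext set) = card X"
proof -
  have inj: "inj_on (unit_ext :: _ \<Rightarrow> 'k ext) X"
    by (rule inj_onI) (metis unit_ext_def zero_neq_one)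
  have "ext.independent ((unit_ext :: _ \<Rightarrow> 'k ext) ` X)"
  proof (rule ext.independent_if_scalars_zero)
    show "finite ((unit_ext :: _ \<Rightarrow> 'k ext) ` X)" using assms by simp
    fix f :: "'k ext \<Rightarrow> 'k" and x :: "'k ext"
    assume s: "(\<Sum>x\<in>unit_ext ` X. ext_scale (f x) x) = 0" and "x \<in> unit_ext ` X"
    then obtain T where T: "T \<in> X" "x = unit_ext T" by auto
    have "(\<Sum>S\<in>X. ext_scale (f (unit_ext S)) (unit_ext S)) = 0"
      using s sum.reindex[OF inj, of "\<lambda>x. ext_scale (f x) x"] by (simp add: o_def)
    then have "0 = (\<Sum>S\<in>X. ext_scale (f (unit_ext S)) (unit_ext S)) T" by simp
    also have "\<dots> = (\<Sum>S\<in>X. if S = T then f (unit_ext S) else 0)"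
      unfolding sum_fun_apply by (intro sum.cong) (auto simp: ext_scale_def unit_ext_def)
    also have "\<dots> = f x" using T assms by simp
    finally show "f x = 0" by simp
  qed
  then have "ext.dim (coord_space X :: 'k ext set) = card ((unit_ext :: _ \<Rightarrow> 'k ext) ` X)"
    using coord_space_subset_span[OF assms, where ?'a = 'k]
    by (intro ext.dim_unique[of "(unit_ext :: _ \<Rightarrow> 'k ext) ` X"])
      (auto simp: coord_space_def unit_ext_def[abs_def])
  then show ?thesis using card_image[OF inj] by simp
qed

text \<open>
  A relation \<open>R\<close> of this kind is the graph of a ring homomorphism from a subring of the field
  into the field; \<open>(a, b) \<in> R\<close> says that \<open>a\<close> specializes to \<open>b\<close>.
\<close>

definition specialization :: "('k::field \<times> 'k) set \<Rightarrow> bool" where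
  "specialization R \<longleftrightarrow> (1, 1) \<in> R \<and>
     (\<forall>a b c d. (a, b) \<in> R \<longrightarrow> (c, d) \<in> R \<longrightarrow> (a - c, b - d) \<in> R \<and> (a * c, b * d) \<in> R) \<and>
     (\<forall>b. (0, b) \<in> R \<longrightarrow> b = 0)"

text \<open>Fraction-free elimination with a pivot that does not vanish after specialization.\<close>

lemma dim_solutions_specialization:
  assumes R: "specialization R" and "finite X"
    and "\<And>q S. q \<in> Q \<Longrightarrow> S \<in> X \<Longrightarrow> (A q S, B q S) \<in> R"
  shows "ext.dim (solutions X Q A) \<le> ext.dim (solutions X Q B)"
  using assms(2,3)
proof (induction X arbitrary: A B rule: finite_psubset_induct)
  case (psubset X)
  show ?case
  proof (cases "\<forall>q\<in>Q. \<forall>S\<in>X. B q S = 0")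
    case True
    then have "solutions X Q A \<subseteq> solutions X Q B"
      by (auto simp: solutions_def pairing_def)
    then show ?thesis
      by (rule dim_mono_coord_space[where X = X]) (auto simp: solutions_def psubset.hyps)
  next
    case False
    then obtain r T where r: "r \<in> Q" "T \<in> X" "B r T \<noteq> 0" by blast
    \<comment> \<open>0 specializes only to 0, so the pivot was nonzero before the specialization as
      well.\<close>
    then have A0: "A r T \<noteq> 0"
      using psubset.prems R unfolding specialization_def by metis
    let ?X = "X - {T}"
    \<comment> \<open>Cross-multiplication replaces division by the pivot, since R is closed under
      ring operations only.\<close>
    define A' where "A' q S = A r T * A q S - A q T * A r S" for q S
    define B' where "B' q S = B r T * B q S - B q T * B r S" for q S
    have finX: "finite X" "finite ?X" using psubset.hyps by auto
    have split: "pairing X w u = w T * u T + pairing ?X w u" for w u :: "'a ext"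
      unfolding pairing_def using r(2) finX(1) by (simp add: sum.remove)
    have elim: "pairing ?X w (\<lambda>S. a * u S - b * v S) = a * pairing ?X w u - b * pairing ?X w v"
      for a b w and u v :: "'a ext"
      by (simp add: pairing_def sum_distrib_left sum_subtractf algebra_simps)
    have upd: "pairing ?X (w(T := c)) u = pairing ?X w u" for w c and u :: "'a ext"
      by (auto simp: pairing_def intro!: sum.cong)
    \<comment> \<open>The pivot equation determines the unknown T from the others, so dropping it is
      injective on solutions.\<close>
    have "ext.dim (solutions X Q A) \<le> ext.dim (solutions ?X Q A')"
    proof (rule dim_le_if_linear_injection[OF _ subspace_solutions _ finX(1) _ _ finX(2)])
      show "ext_linear (\<lambda>w. w(T := 0))"
        by (rule ext_linearI) (auto simp: ext_scale_def)
      show "(\<lambda>w. w(T := 0)) ` solutions X Q A \<subseteq> solutions ?X Q A'"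
      proof safe
        fix w assume w: "w \<in> solutions X Q A"
        have "pairing ?X w (A' q) = 0" if "q \<in> Q" for q
        proof -
          have "pairing ?X w (A q) = - (w T * A q T)" "pairing ?X w (A r) = - (w T * A r T)"
            using w that r(1) unfolding solutions_def split by (auto simp: eq_neg_iff_add_eq_0 add.commute)
          then show ?thesis unfolding A'_def elim by simp
        qed
        then show "w(T := 0) \<in> solutions ?X Q A'"
          using w by (auto simp: solutions_def upd coord_space_def)
      qed
      show "w = 0" if w: "w \<in> solutions X Q A" "w(T := 0) = 0" for w
      proof -
        have z: "w S = 0" if "S \<noteq> T" for S using fun_cong[OF w(2), of S] that by simp
        then have "pairing ?X w (A r) = 0" by (simp add: pairing_def)
        then have "w T * A r T = 0"
          using w(1) r(1) unfolding solutions_def split by auto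
        then have "w T = 0" using A0 by simp
        then show ?thesis using z by (metis ext zero_fun_apply)
      qed
    qed (auto simp: solutions_def)
    also have "\<dots> \<le> ext.dim (solutions ?X Q B')"
    proof (rule psubset.IH)
      show "?X \<subset> X" using r(2) by blast
      fix q S assume "q \<in> Q" "S \<in> ?X"
      then show "(A' q S, B' q S) \<in> R"
        using psubset.prems r R unfolding specialization_def A'_def B'_def by simp
    qed
    also have "\<dots> \<le> ext.dim (solutions X Q B)"
    proof (rule dim_le_if_linear_injection[OF _ subspace_solutions _ finX(2) _ _ finX(1)])
      \<comment> \<open>Back substitution: the specialized pivot equation is solved for the unknown
        T.\<close>
      let ?f = "\<lambda>w. w(T := - (pairing ?X w (B r) / B r T))"
      show "ext_linear ?f"
      proof (rule ext_linearI)
        show "?f (x + y) = ?f x + ?f y" for x y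
          by (simp add: pairing_add add_divide_distrib fun_eq_iff)
        show "?f (ext_scale c x) = ext_scale c (?f x)" for c x
          unfolding pairing_scale by (simp add: ext_scale_def fun_eq_iff)
      qed
      show "?f ` solutions ?X Q B' \<subseteq> solutions X Q B"
      proof safe
        fix w assume w: "w \<in> solutions ?X Q B'"
        have "pairing X (?f w) (B q) = 0" if "q \<in> Q" for q
        proof -
          have "B r T * pairing ?X w (B q) = B q T * pairing ?X w (B r)"
            using w that unfolding solutions_def B'_def elim by simp
          then show ?thesis
            unfolding split upd using r(3) by (simp add: field_simps)
        qed
        then show "?f w \<in> solutions X Q B"
          using w r(2) by (auto simp: solutions_def coord_space_def)
      qed
      show "w = 0" if w: "w \<in> solutions ?X Q B'" "?f w = 0" for w
      proof
        fix S
        show "w S = 0 S"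
          using w(1) fun_cong[OF w(2), of S]
          by (cases "S = T") (auto simp: solutions_def coord_space_def)
      qed
    qed (auto simp: solutions_def)
    finally show ?thesis .
  qed
qed

text \<open>Echelon form without a matrix. Induction removes the least position m: the functional at
  m has rank 1 or 0 on Z, according to whether m is a leading position, and its kernel has exactly
  the remaining leading positions.\<close>

lemma dim_eq_card_leading:
  fixes u :: "'i \<Rightarrow> 'k::field ext" and prec :: "'i \<Rightarrow> 'i \<Rightarrow> bool"
  assumes X: "finite X" and "finite P" and "ext.subspace Z" "Z \<subseteq> coord_space X"
    and irr: "\<And>i. \<not> prec i i" and tr: "\<And>i j k. prec i j \<Longrightarrow> prec j k \<Longrightarrow> prec i k"
    and "\<And>i j. i \<in> P \<Longrightarrow> j \<in> P \<Longrightarrow> i \<noteq> j \<Longrightarrow> prec i j \<or> prec j i"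
    and "\<And>w. w \<in> Z \<Longrightarrow> (\<And>i. i \<in> P \<Longrightarrow> pairing X w (u i) = 0) \<Longrightarrow> w = 0"
  shows "ext.dim Z = card {i \<in> P. \<exists>w\<in>Z. pairing X w (u i) \<noteq> 0 \<and>
            (\<forall>j\<in>P. prec j i \<longrightarrow> pairing X w (u j) = 0)}"
  using assms(2-4,7,8)
proof (induction P arbitrary: Z rule: finite_psubset_induct)
  case (psubset P)
  show ?case
  proof (cases "P = {}")
    case True
    then have "Z \<subseteq> ext.span {}" using psubset.prems(4) by (simp only: ext.span_empty) blast
    then have "ext.dim Z \<le> card ({} :: 'k ext set)" by (rule ext.dim_le_card) simp
    then show ?thesis using True by simp
  next
    case False
    obtain m where m: "m \<in> P" "\<And>j. j \<in> P \<Longrightarrow> \<not> prec j m"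
    proof -
      have "asymp_on P prec" "transp_on P prec"
        using irr tr by (blast intro!: asymp_onI transp_onI)+
      then have "\<exists>m\<in>P. \<forall>j\<in>P. j \<noteq> m \<longrightarrow> \<not> prec j m"
        using Finite_Set.bex_min_element[OF psubset.hyps(1)] False by blast
      then obtain m where "m \<in> P" "\<And>j. j \<in> P \<Longrightarrow> \<not> prec j m" using irr by metis
      then show ?thesis by (rule that)
    qed
    define Y where "Y = {w \<in> Z. pairing X w (u m) = 0}"
    let ?L = "\<lambda>P Z. {i \<in> P. \<exists>w\<in>Z. pairing X w (u i) \<noteq> 0 \<and>
            (\<forall>j\<in>P. prec j i \<longrightarrow> pairing X w (u j) = 0)}"
    \<comment> \<open>A scalar functional, read as a map into the line of \<open>unit_ext {}\<close>
      so that rank-nullity applies to it.\<close>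
    define f where "f w = ext_scale (pairing X w (u m)) (unit_ext {} :: 'k ext)" for w
    have f0: "f w = 0 \<longleftrightarrow> pairing X w (u m) = 0" for w
    proof
      assume "f w = 0"
      then have "f w {} = 0" by simp
      then show "pairing X w (u m) = 0" by (simp add: f_def ext_scale_def unit_ext_def)
    qed (simp add: f_def)
    have linf: "ext_linear f"
      by (rule ext_linearI) (simp_all add: f_def pairing_add pairing_scale ext.scale_left_distrib)
    have "ext.dim Z = ext.dim {z \<in> Z. f z = 0} + ext.dim (f ` Z)"
      by (rule rank_nullity_coord_space[OF linf psubset.prems(1,2) X])
    also have "{z \<in> Z. f z = 0} = Y" by (simp add: Y_def f0)
    also have "ext.dim Y = card (?L (P - {m}) Y)"
    proof (rule psubset.IH)
      show "ext.subspace Y"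
        using psubset.prems(1) unfolding Y_def ext.subspace_def
        by (auto simp: pairing_add pairing_scale) (simp add: pairing_def)
      show "w = 0" if w: "w \<in> Y" "\<And>i. i \<in> P - {m} \<Longrightarrow> pairing X w (u i) = 0" for w
      proof (rule psubset.prems(4))
        show "w \<in> Z" using w(1) by (simp add: Y_def)
        show "pairing X w (u i) = 0" if "i \<in> P" for i
          using w that by (cases "i = m") (auto simp: Y_def)
      qed
    qed (use m psubset.prems(2,3) in \<open>auto simp: Y_def\<close>)
    \<comment> \<open>m precedes every other position, so a witness for another position vanishes at
      m and lies in Y.\<close>
    also have "?L (P - {m}) Y = ?L P Z - {m}"
    proof -
      have "prec m i" if "i \<in> P" "i \<noteq> m" for i
        using that m psubset.prems(3) by blast
      then have "i \<in> ?L (P - {m}) Y \<longleftrightarrow> i \<in> ?L P Z - {m}" for i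
        using m(1) unfolding Y_def by blast
      then show ?thesis by (rule set_eqI)
    qed
    also have "ext.dim (f ` Z) = card (?L P Z \<inter> {m})"
    proof (cases "\<exists>w\<in>Z. pairing X w (u m) \<noteq> 0")
      case True
      then obtain w where w: "w \<in> Z" "pairing X w (u m) \<noteq> 0" by blast
      have "f ` Z = ext.span {unit_ext {}}"
      proof
        show "f ` Z \<subseteq> ext.span {unit_ext {}}"
          unfolding f_def ext.span_singleton by blast
        have "ext_scale c (unit_ext {}) \<in> f ` Z" for c
        proof
          show "ext_scale (c / pairing X w (u m)) w \<in> Z"
            using w(1) psubset.prems(1) by (simp add: ext.subspace_scale)
          show "ext_scale c (unit_ext {}) = f (ext_scale (c / pairing X w (u m)) w)"
            using w(2) by (simp add: f_def pairing_scale)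
        qed
        then show "ext.span {unit_ext {}} \<subseteq> f ` Z"
          by (auto simp: ext.span_singleton)
      qed
      moreover have "ext.independent {unit_ext {} :: 'k ext}"
        by (metis ext.dependent_single one_neq_zero unit_ext_def zero_fun_apply)
      ultimately have "ext.dim (f ` Z) = 1"
        using ext.dim_span_eq_card_independent[of "{unit_ext {} :: 'k ext}"] by simp
      moreover have "?L P Z \<inter> {m} = {m}" using m w by blast
      ultimately show ?thesis by simp
    next
      case False
      then have "f ` Z \<subseteq> ext.span {}" by (auto simp: f_def)
      then have "ext.dim (f ` Z) \<le> card ({} :: 'k ext set)" by (rule ext.dim_le_card) simp
      moreover have "?L P Z \<inter> {m} = {}" using False by blast
      ultimately show ?thesis by simp
    qed
    also have "card (?L P Z - {m}) + card (?L P Z \<inter> {m}) = card (?L P Z)"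
      using psubset.hyps(1) card_Int_Diff[of "?L P Z" "{m}"] by simp
    finally show ?thesis .
  qed
qed

section \<open>Specializing the generic matrix\<close>

definition mon_eval :: "('i \<Rightarrow> 'k::field) \<Rightarrow> ('i \<Rightarrow>\<^sub>0 nat) \<Rightarrow> 'k" where
  "mon_eval a m = (\<Prod>i\<in>Poly_Mapping.keys m. a i ^ Poly_Mapping.lookup m i)"

lemma mon_eval_superset:
  assumes "finite I" "Poly_Mapping.keys m \<subseteq> I"
  shows "mon_eval a m = (\<Prod>i\<in>I. a i ^ Poly_Mapping.lookup m i)"
  unfolding mon_eval_def using assms by (intro prod.mono_neutral_left) (auto simp: in_keys_iff)

lemma mon_eval_add: "mon_eval a (l + m) = mon_eval a l * mon_eval a m"
proof -
  let ?I = "Poly_Mapping.keys l \<union> Poly_Mapping.keys m"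
  have "Poly_Mapping.keys (l + m) \<subseteq> ?I" by (rule keys_add)
  then show ?thesis
    by (simp add: mon_eval_superset[of ?I] lookup_add power_add prod.distrib)
qed

lemma mpoly_eval_superset:
  assumes "field_embedding emb" "finite M" "Poly_Mapping.keys p \<subseteq> M"
  shows "mpoly_eval emb a p = (\<Sum>m\<in>M. emb (Poly_Mapping.lookup p m) * mon_eval a m)"
proof -
  have "emb 0 + emb 0 = emb 0 + 0"
    using assms(1) unfolding field_embedding_def by (metis add_0_right)
  then have "emb 0 = 0" by (rule add_left_imp_eq)
  then show ?thesis
    unfolding mpoly_eval_def mon_eval_def[symmetric] using assms(2,3)
    by (intro sum.mono_neutral_left) (auto simp: in_keys_iff)
qed

lemma mpoly_eval_add:
  assumes "field_embedding emb"
  shows "mpoly_eval emb a (p + q) = mpoly_eval emb a p + mpoly_eval emb a q"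
proof -
  let ?M = "Poly_Mapping.keys p \<union> Poly_Mapping.keys q"
  have "Poly_Mapping.keys (p + q) \<subseteq> ?M" by (rule keys_add)
  then show ?thesis
    using assms unfolding field_embedding_def
    by (simp add: mpoly_eval_superset[OF assms, of ?M] lookup_add algebra_simps sum.distrib)
qed

lemma mpoly_eval_single:
  assumes "field_embedding emb"
  shows "mpoly_eval emb a (Poly_Mapping.single m c) = emb c * mon_eval a m"
  by (subst mpoly_eval_superset[OF assms, of "{m}"]) (auto split: if_splits)

lemma mpoly_eval_0: "mpoly_eval emb a 0 = 0"
  by (simp add: mpoly_eval_def)

lemma poly_mapping_add_induct [case_names zero add]:
  fixes p :: "'a \<Rightarrow>\<^sub>0 'b::comm_monoid_add"
  assumes "P 0" and "\<And>p k c. P p \<Longrightarrow> P (Poly_Mapping.single k c + p)"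
  shows "P p"
proof (induction p rule: Poly_Mapping.update_induct)
  case const
  then show ?case using assms(1) .
next
  case (update p k c)
  have "Poly_Mapping.update k c p = Poly_Mapping.single k c + p"
    using update by (intro poly_mapping_eqI)
      (auto simp: lookup_update lookup_add lookup_single when_def in_keys_iff)
  then show ?case using assms(2) update by simp
qed

lemma mpoly_eval_mult:
  assumes "field_embedding emb"
  shows "mpoly_eval emb a (p * q) = mpoly_eval emb a p * mpoly_eval emb a q"
proof (induction p rule: poly_mapping_add_induct)
  case (add p k c)
  have "mpoly_eval emb a (Poly_Mapping.single k c * q) =
    mpoly_eval emb a (Poly_Mapping.single k c) * mpoly_eval emb a q"
  proof (induction q rule: poly_mapping_add_induct)
    case (add q l d)
    then show ?case
      using assms unfolding field_embedding_def
      by (simp add: distrib_left mpoly_eval_add[OF assms] mult_single mpoly_eval_single[OF assms]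
          mon_eval_add)
  qed (simp add: mpoly_eval_0)
  then show ?case
    using add by (simp add: distrib_right mpoly_eval_add[OF assms])
qed (simp add: mpoly_eval_0)

lemma mpoly_eval_minus:
  assumes "field_embedding emb"
  shows "mpoly_eval emb a (p - q) = mpoly_eval emb a p - mpoly_eval emb a q"
  using mpoly_eval_add[OF assms, of a "p - q" q] by simp

lemma mpoly_vars_minus:
  fixes p q :: "('i, 'f::field) mpoly"
  shows "mpoly_vars (p - q) \<subseteq> mpoly_vars p \<union> mpoly_vars q"
proof -
  have "Poly_Mapping.keys (p - q) \<subseteq> Poly_Mapping.keys p \<union> Poly_Mapping.keys q"
    by (auto simp: in_keys_iff lookup_minus)
  then show ?thesis
    unfolding mpoly_vars_def UN_Un[symmetric] by (rule UN_mono) simp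
qed

lemma mpoly_vars_mult:
  fixes p q :: "('i, 'f::field) mpoly"
  shows "mpoly_vars (p * q) \<subseteq> mpoly_vars p \<union> mpoly_vars q"
proof
  fix x assume "x \<in> mpoly_vars (p * q)"
  then obtain m where m: "m \<in> Poly_Mapping.keys (p * q)" "x \<in> Poly_Mapping.keys m"
    unfolding mpoly_vars_def by (rule UN_E)
  obtain k l where kl: "m = k + l" "k \<in> Poly_Mapping.keys p" "l \<in> Poly_Mapping.keys q"
    using subsetD[OF keys_mult m(1)] by blast
  have "x \<in> Poly_Mapping.keys k \<union> Poly_Mapping.keys l"
    using subsetD[OF keys_add] m(2) kl(1) by metis
  then show "x \<in> mpoly_vars p \<union> mpoly_vars q"
    unfolding mpoly_vars_def using kl(2,3) by (elim UnE) (rule UnI1 UnI2, rule UN_I, assumption, assumption)+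
qed

text \<open>The graph of the F-algebra homomorphism from F[\<alpha>] to K that sends
  \<open>\<alpha> i j\<close> to \<open>\<beta> i j\<close>. The entries of \<beta> are arbitrary
  elements of K and may be built from \<alpha>; the row-permuted and the projected matrix below are
  of this kind.\<close>

definition spec_graph ::
    "('f::field \<Rightarrow> 'k::field) \<Rightarrow> nat \<Rightarrow> (nat \<Rightarrow> nat \<Rightarrow> 'k) \<Rightarrow> (nat \<Rightarrow> nat \<Rightarrow> 'k) \<Rightarrow> ('k \<times> 'k) set" where
  "spec_graph emb n \<alpha> \<beta> =
     {(mpoly_eval emb (\<lambda>(i, j). \<alpha> i j) p, mpoly_eval emb (\<lambda>(i, j). \<beta> i j) p) | p.
        mpoly_vars p \<subseteq> {1..n} \<times> {1..n}}"

lemma spec_graph_iff: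
  "(a, b) \<in> spec_graph emb n \<alpha> \<beta> \<longleftrightarrow>
     (\<exists>p. mpoly_vars p \<subseteq> {1..n} \<times> {1..n} \<and> a = mpoly_eval emb (\<lambda>(i, j). \<alpha> i j) p \<and>
        b = mpoly_eval emb (\<lambda>(i, j). \<beta> i j) p)"
  unfolding spec_graph_def by blast

lemma specialization_spec_graph:
  assumes "generic_extension emb n \<alpha>"
  shows "specialization (spec_graph emb n \<alpha> \<beta>)"
proof -
  let ?I = "{1..n} \<times> {1..n}"
  have emb: "field_embedding emb" and ind: "alg_independent emb ?I (\<lambda>(i, j). \<alpha> i j)"
    using assms unfolding generic_extension_def by auto
  have "emb 1 = 1" using emb unfolding field_embedding_def by simp
  then have "mpoly_eval emb a (Poly_Mapping.single 0 1) = 1" for a :: "nat \<times> nat \<Rightarrow> _"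
    using mpoly_eval_single[OF emb, of a 0 1] by (simp add: mon_eval_def)
  moreover have "mpoly_vars (Poly_Mapping.single 0 1 :: (nat \<times> nat, 'a) mpoly) \<subseteq> ?I"
    by (simp add: mpoly_vars_def)
  ultimately have "(1, 1) \<in> spec_graph emb n \<alpha> \<beta>"
    unfolding spec_graph_iff by (intro exI[of _ "Poly_Mapping.single 0 1"]) simp
  moreover have "(a - c, b - d) \<in> spec_graph emb n \<alpha> \<beta> \<and> (a * c, b * d) \<in> spec_graph emb n \<alpha> \<beta>"
    if ab: "(a, b) \<in> spec_graph emb n \<alpha> \<beta>" and cd: "(c, d) \<in> spec_graph emb n \<alpha> \<beta>" for a b c d
  proof -
    obtain p where p: "mpoly_vars p \<subseteq> ?I"
      "a = mpoly_eval emb (\<lambda>(i, j). \<alpha> i j) p" "b = mpoly_eval emb (\<lambda>(i, j). \<beta> i j) p"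
      using ab unfolding spec_graph_iff by blast
    obtain q where q: "mpoly_vars q \<subseteq> ?I"
      "c = mpoly_eval emb (\<lambda>(i, j). \<alpha> i j) q" "d = mpoly_eval emb (\<lambda>(i, j). \<beta> i j) q"
      using cd unfolding spec_graph_iff by blast
    have "mpoly_vars (p - q) \<subseteq> ?I" "mpoly_vars (p * q) \<subseteq> ?I"
      using p(1) q(1) mpoly_vars_minus[of p q] mpoly_vars_mult[of p q] by blast+
    then show ?thesis
      unfolding spec_graph_iff p q mpoly_eval_minus[OF emb, symmetric] mpoly_eval_mult[OF emb, symmetric]
      by (intro conjI exI[of _ "p - q"] exI[of _ "p * q"]) auto
  qed
  \<comment> \<open>Algebraic independence enters here: only the zero polynomial vanishes at
    \<alpha>. Together with closure under subtraction this makes the relation single-valued.\<close>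
  moreover have "b = 0" if zb: "(0, b) \<in> spec_graph emb n \<alpha> \<beta>" for b
  proof -
    obtain p where p: "mpoly_vars p \<subseteq> ?I" "0 = mpoly_eval emb (\<lambda>(i, j). \<alpha> i j) p"
      "b = mpoly_eval emb (\<lambda>(i, j). \<beta> i j) p"
      using zb unfolding spec_graph_iff by blast
    then have "p = 0" using ind unfolding alg_independent_def by simp
    then show ?thesis using p by (simp add: mpoly_eval_0)
  qed
  ultimately show ?thesis unfolding specialization_def by blast
qed

lemma spec_graph_entry:
  assumes "generic_extension emb n \<alpha>" "i \<in> {1..n}" "j \<in> {1..n}"
  shows "(\<alpha> i j, \<beta> i j) \<in> spec_graph emb n \<alpha> \<beta>"
proof -
  have emb: "field_embedding emb" and "emb 1 = 1"
    using assms(1) unfolding generic_extension_def field_embedding_def by auto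
  let ?p = "Poly_Mapping.single (Poly_Mapping.single (i, j) 1) 1 :: (nat \<times> nat, 'a) mpoly"
  have "mpoly_eval emb a ?p = a (i, j)" for a :: "nat \<times> nat \<Rightarrow> _"
    using mpoly_eval_single[OF emb, of a] \<open>emb 1 = 1\<close> by (simp add: mon_eval_def)
  moreover have "mpoly_vars ?p \<subseteq> {1..n} \<times> {1..n}"
    using assms(2,3) by (simp add: mpoly_vars_def)
  ultimately show ?thesis
    unfolding spec_graph_iff by (intro exI[of _ ?p]) simp
qed

lemma
  assumes "specialization R"
  shows specialization_0: "(0, 0) \<in> R"
    and specialization_1: "(1, 1) \<in> R"
    and specialization_mult: "(a, b) \<in> R \<Longrightarrow> (c, d) \<in> R \<Longrightarrow> (a * c, b * d) \<in> R"
    and specialization_uminus: "(a, b) \<in> R \<Longrightarrow> (- a, - b) \<in> R"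
    and specialization_add: "(a, b) \<in> R \<Longrightarrow> (c, d) \<in> R \<Longrightarrow> (a + c, b + d) \<in> R"
proof -
  have *: "(a - c, b - d) \<in> R" if "(a, b) \<in> R" "(c, d) \<in> R" for a b c d
    using that assms unfolding specialization_def by blast
  show 1: "(1, 1) \<in> R" using assms unfolding specialization_def by blast
  show 0: "(0, 0) \<in> R" using *[OF 1 1] by simp
  show "(a, b) \<in> R \<Longrightarrow> (c, d) \<in> R \<Longrightarrow> (a * c, b * d) \<in> R"
    using assms unfolding specialization_def by blast
  have u: "(- a, - b) \<in> R" if "(a, b) \<in> R" for a b using *[OF 0 that] by simp
  show "(a, b) \<in> R \<Longrightarrow> (- a, - b) \<in> R" by (rule u)
  show "(a, b) \<in> R \<Longrightarrow> (c, d) \<in> R \<Longrightarrow> (a + c, b + d) \<in> R" using *[OF _ u, of a b c d] by simp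
qed

lemma specialization_sum:
  assumes "specialization R" "\<And>i. i \<in> I \<Longrightarrow> (f i, g i) \<in> R"
  shows "(sum f I, sum g I) \<in> R"
  using assms(2)
proof (induction I rule: infinite_finite_induct)
  case (insert i I)
  then show ?case using specialization_add[OF assms(1), of "f i" "g i"] by simp
qed (simp_all add: specialization_0[OF assms(1)])

section \<open>Exterior products of the generic vectors\<close>

text \<open>For u in U, the sign s with e_u wedge e_{U - u} = s e_U: sorting moves e_u past the
  smaller elements of U.\<close>

definition pos_sign :: "nat set \<Rightarrow> nat \<Rightarrow> 'k::field" where
  "pos_sign U u = (- 1) ^ card {j \<in> U. j < u}"

lemma shuffle_sign_singleton: "shuffle_sign {u} (U - {u}) = pos_sign U u"
proof -
  have "{(i, j). i \<in> {u} \<and> j \<in> U - {u} \<and> j < i} = {u} \<times> {j \<in> U. j < u}" by auto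
  then show ?thesis
    by (simp add: shuffle_sign_def pos_sign_def card_cartesian_product_singleton)
qed

text \<open>Removing the smaller of the two elements lowers the position of the larger one by 1,
  whereas removing the larger one leaves the smaller in place.\<close>

lemma pos_sign_anticommute:
  assumes "finite U" "u \<in> U" "w \<in> U" "u \<noteq> w"
  shows "pos_sign U u * pos_sign (U - {u}) w = - (pos_sign U w * pos_sign (U - {w}) u :: 'k::field)"
proof -
  have less: "pos_sign U u * pos_sign (U - {u}) w = - (pos_sign U w * pos_sign (U - {w}) u :: 'k)"
    if "u \<in> U" "w \<in> U" "u < w" for u w
  proof -
    have "{j \<in> U. j < w} = insert u {j \<in> U - {u}. j < w}" using that by auto
    moreover have "finite {j \<in> U - {u}. j < w}" "u \<notin> {j \<in> U - {u}. j < w}"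
      using assms(1) by auto
    ultimately have "card {j \<in> U. j < w} = Suc (card {j \<in> U - {u}. j < w})"
      by (metis card_insert_disjoint)
    moreover have "{j \<in> U - {w}. j < u} = {j \<in> U. j < u}" using that by auto
    ultimately show ?thesis by (simp add: pos_sign_def)
  qed
  show ?thesis
    using less[of u w] less[of w u] assms by (cases "u < w") auto
qed

lemma generic_gen_apply:
  "generic_gen \<beta> n i S = (\<Sum>j = 1..n. if S = {j} then \<beta> i j else 0)"
  unfolding generic_gen_def sum_fun_apply
  by (intro sum.cong) (auto simp: ext_scale_def ext_gen_def)

lemma generic_gen_singleton:
  "generic_gen \<beta> n i {j} = (if j \<in> {1..n} then \<beta> i j else 0)"
proof -
  have "generic_gen \<beta> n i {j} = (\<Sum>k = 1..n. if k = j then \<beta> i k else 0)"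
    unfolding generic_gen_apply by (intro sum.cong) auto
  then show ?thesis by simp
qed

lemma wedge_generic_gen:
  assumes "finite U"
  shows "wedge (generic_gen \<beta> n i) x U =
           (\<Sum>u\<in>U \<inter> {1..n}. pos_sign U u * \<beta> i u * x (U - {u}))"
proof -
  let ?t = "\<lambda>S. shuffle_sign S (U - S) * generic_gen \<beta> n i S * x (U - S)"
  have "wedge (generic_gen \<beta> n i) x U = sum ?t (Pow U)" by (simp add: wedge_def)
  also have "\<dots> = sum ?t ((\<lambda>u. {u}) ` (U \<inter> {1..n}))"
  proof (rule sum.mono_neutral_right)
    have "generic_gen \<beta> n i S = 0" if "S \<in> Pow U - (\<lambda>u. {u}) ` (U \<inter> {1..n})" for S
      unfolding generic_gen_apply using that by (intro sum.neutral) auto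
    then show "\<forall>S\<in>Pow U - (\<lambda>u. {u}) ` (U \<inter> {1..n}). ?t S = 0" by simp
  qed (use assms in auto)
  also have "\<dots> = (\<Sum>u\<in>U \<inter> {1..n}. ?t {u})"
    by (subst sum.reindex) (auto simp: inj_on_def)
  also have "\<dots> = (\<Sum>u\<in>U \<inter> {1..n}. pos_sign U u * \<beta> i u * x (U - {u}))"
    by (intro sum.cong) (auto simp: shuffle_sign_singleton generic_gen_singleton)
  finally show ?thesis .
qed

lemma wedge_infinite: "infinite U \<Longrightarrow> wedge x y U = 0"
  by (simp add: wedge_def)

lemma wedge_add_right: "wedge x (y + z) = wedge x y + wedge x z"
  by (simp add: wedge_def fun_eq_iff algebra_simps sum.distrib)

lemma wedge_scale_right: "wedge x (ext_scale c y) = ext_scale c (wedge x y)"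
  by (simp add: wedge_def fun_eq_iff ext_scale_def sum_distrib_left algebra_simps)

lemma wedge_zero_right: "wedge x 0 = 0"
  by (simp add: wedge_def fun_eq_iff)

text \<open>The ordered pairs cancel in twos. Exchanging u and w in the whole sum would only show
  that twice the sum is 0, which says nothing in characteristic 2; hence the induction on A.\<close>

lemma sum_antisymmetric:
  fixes h :: "'a \<Rightarrow> 'a \<Rightarrow> 'k::ab_group_add"
  assumes "finite A" "\<And>u w. u \<in> A \<Longrightarrow> w \<in> A \<Longrightarrow> u \<noteq> w \<Longrightarrow> h u w = - h w u"
  shows "(\<Sum>u\<in>A. \<Sum>w\<in>A - {u}. h u w) = 0"
  using assms
proof (induction A rule: finite_induct)
  case (insert a A)
  have split: "(\<Sum>w\<in>insert a A - {u}. h u w) = h u a + (\<Sum>w\<in>A - {u}. h u w)" if "u \<in> A" for u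
  proof -
    have "insert a A - {u} = insert a (A - {u})" using that insert.hyps by auto
    then show ?thesis using insert.hyps by simp
  qed
  have "(\<Sum>u\<in>insert a A. \<Sum>w\<in>insert a A - {u}. h u w) =
      (\<Sum>w\<in>A. h a w) + (\<Sum>u\<in>A. h u a + (\<Sum>w\<in>A - {u}. h u w))"
  proof -
    have "insert a A - {a} = A" using insert.hyps by auto
    then show ?thesis
      unfolding sum.insert[OF insert.hyps] using sum.cong[OF refl split, of A] by simp
  qed
  also have "(\<Sum>u\<in>A. h u a + (\<Sum>w\<in>A - {u}. h u w)) = (\<Sum>u\<in>A. h u a)"
  proof -
    have "(\<Sum>u\<in>A. \<Sum>w\<in>A - {u}. h u w) = 0"
      by (rule insert.IH) (rule insert.prems; simp)
    then show ?thesis by (simp add: sum.distrib)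
  qed
  also have "(\<Sum>w\<in>A. h a w) + (\<Sum>w\<in>A. h w a) = (\<Sum>w\<in>A. h a w + h w a)"
    by (rule sum.distrib[symmetric])
  also have "\<dots> = 0"
  proof (intro sum.neutral ballI)
    fix w assume "w \<in> A"
    then have "h a w = - h w a" using insert.hyps(2) by (intro insert.prems) auto
    then show "h a w + h w a = 0" by simp
  qed
  finally show ?case .
qed simp

lemma wedge_generic_gen_twice:
  assumes "finite U"
  shows "wedge (generic_gen \<beta> n i) (wedge (generic_gen \<gamma> n j) x) U =
    (\<Sum>u\<in>U \<inter> {1..n}. \<Sum>w\<in>U \<inter> {1..n} - {u}.
       pos_sign U u * pos_sign (U - {u}) w * \<beta> i u * \<gamma> j w * x (U - {u} - {w}))"
proof -
  have "(U - {u}) \<inter> {1..n} = U \<inter> {1..n} - {u}" for u by auto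
  then show ?thesis
    using assms by (simp add: wedge_generic_gen sum_distrib_left algebra_simps)
qed

lemma Diff_singleton_commute: "U - {u} - {w} = U - {w} - {u}"
  by auto

text \<open>Both products are sums over ordered pairs of removed elements, and adding them makes the
  summand antisymmetric.\<close>

lemma wedge_generic_gen_anticommute:
  "wedge (generic_gen \<beta> n i) (wedge (generic_gen \<beta> n j) x) =
     ext_scale (- 1) (wedge (generic_gen \<beta> n j) (wedge (generic_gen \<beta> n i) x))"
proof
  fix U
  show "wedge (generic_gen \<beta> n i) (wedge (generic_gen \<beta> n j) x) U =
     ext_scale (- 1) (wedge (generic_gen \<beta> n j) (wedge (generic_gen \<beta> n i) x)) U"
  proof (cases "finite U")
    case True
    let ?A = "U \<inter> {1..n}"
    let ?h = "\<lambda>u w. pos_sign U u * pos_sign (U - {u}) w * (\<beta> i u * \<beta> j w + \<beta> j u * \<beta> i w) *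
      x (U - {u} - {w})"
    have "(\<Sum>u\<in>?A. \<Sum>w\<in>?A - {u}. ?h u w) = 0"
    proof (rule sum_antisymmetric)
      fix u w assume uw: "u \<in> ?A" "w \<in> ?A" "u \<noteq> w"
      have "pos_sign U u * pos_sign (U - {u}) w = - (pos_sign U w * pos_sign (U - {w}) u :: 'a)"
        using uw True by (intro pos_sign_anticommute) auto
      then show "?h u w = - ?h w u"
        by (simp add: Diff_singleton_commute[of U u w] algebra_simps)
    qed (use True in simp)
    then have "wedge (generic_gen \<beta> n i) (wedge (generic_gen \<beta> n j) x) U +
        wedge (generic_gen \<beta> n j) (wedge (generic_gen \<beta> n i) x) U = 0"
      unfolding wedge_generic_gen_twice[OF True] sum.distrib[symmetric]
      by (simp add: algebra_simps)
    then show ?thesis by (simp add: ext_scale_def eq_neg_iff_add_eq_0)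
  qed (simp add: wedge_infinite ext_scale_def)
qed

text \<open>Anticommutativity does not give this in characteristic 2; it is a separate cancellation
  of pairs.\<close>

lemma wedge_generic_gen_self: "wedge (generic_gen \<beta> n i) (wedge (generic_gen \<beta> n i) x) = 0"
proof
  fix U
  show "wedge (generic_gen \<beta> n i) (wedge (generic_gen \<beta> n i) x) U = 0 U"
  proof (cases "finite U")
    case True
    have "(\<Sum>u\<in>U \<inter> {1..n}. \<Sum>w\<in>U \<inter> {1..n} - {u}. pos_sign U u * pos_sign (U - {u}) w *
        \<beta> i u * \<beta> i w * x (U - {u} - {w})) = 0"
    proof (rule sum_antisymmetric)
      fix u w assume uw: "u \<in> U \<inter> {1..n}" "w \<in> U \<inter> {1..n}" "u \<noteq> w"
      have "pos_sign U u * pos_sign (U - {u}) w = - (pos_sign U w * pos_sign (U - {w}) u :: 'a)"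
        using uw True by (intro pos_sign_anticommute) auto
      then show "pos_sign U u * pos_sign (U - {u}) w * \<beta> i u * \<beta> i w * x (U - {u} - {w}) =
          - (pos_sign U w * pos_sign (U - {w}) u * \<beta> i w * \<beta> i u * x (U - {w} - {u}))"
        by (simp add: Diff_singleton_commute[of U u w] algebra_simps)
    qed (use True in simp)
    then show ?thesis by (simp add: wedge_generic_gen_twice[OF True])
  qed (simp add: wedge_infinite)
qed

section \<open>Products of several generic vectors\<close>

lemma wedge_over_empty: "wedge_over g {} = ext_one"
  by (simp add: wedge_over_def)

lemma wedge_over_insert_less:
  assumes "finite A" "\<And>a. a \<in> A \<Longrightarrow> b < a"
  shows "wedge_over g (insert b A) = wedge (g b) (wedge_over g A)"
proof -
  have "sorted_list_of_set (insert b A) = b # sorted_list_of_set A"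
  proof -
    have "Min (insert b A) = b"
      using assms by (intro Min_eqI) (auto intro: less_imp_le)
    moreover have "insert b A - {b} = A" using assms(2) by auto
    ultimately show ?thesis
      using sorted_list_of_set_nonempty[of "insert b A"] assms(1) by simp
  qed
  then show ?thesis by (simp add: wedge_over_def)
qed

lemma generic_basis_empty: "generic_basis \<beta> n {} = ext_one"
  by (simp add: generic_basis_def wedge_over_empty)

lemma generic_basis_insert_less:
  assumes "finite A" "\<And>a. a \<in> A \<Longrightarrow> b < a"
  shows "generic_basis \<beta> n (insert b A) = wedge (generic_gen \<beta> n b) (generic_basis \<beta> n A)"
  unfolding generic_basis_def by (rule wedge_over_insert_less[OF assms])

lemma generic_basis_support:
  assumes "finite S" "generic_basis \<beta> n S U \<noteq> 0"
  shows "U \<subseteq> {1..n} \<and> card U = card S"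
  using assms
proof (induction S arbitrary: U rule: finite_linorder_min_induct)
  case empty
  then show ?case by (auto simp: generic_basis_empty ext_one_def split: if_splits)
next
  case (insert b A)
  have *: "wedge (generic_gen \<beta> n b) (generic_basis \<beta> n A) U \<noteq> 0"
    using insert.prems generic_basis_insert_less[of A b \<beta> n] insert.hyps by simp
  then have fin: "finite U" using wedge_infinite by blast
  then obtain u where u: "u \<in> U \<inter> {1..n}" "generic_basis \<beta> n A (U - {u}) \<noteq> 0"
    using * unfolding wedge_generic_gen[OF fin] by (metis (no_types, lifting) mult_zero_right sum.neutral)
  then have "U - {u} \<subseteq> {1..n}" "card (U - {u}) = card A" using insert.IH by auto
  moreover have "b \<notin> A" using insert.hyps(2) by blast
  ultimately show ?case
    using u(1) fin insert.hyps(1) by (auto simp: card_Suc_Diff1 dest: card_Suc_Diff1)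
qed

lemma wedge_generic_gen_generic_basis_mem:
  assumes "finite S" "i \<in> S"
  shows "wedge (generic_gen \<beta> n i) (generic_basis \<beta> n S) = 0"
  using assms
proof (induction S rule: finite_linorder_min_induct)
  case (insert b A)
  have *: "generic_basis \<beta> n (insert b A) = wedge (generic_gen \<beta> n b) (generic_basis \<beta> n A)"
    using insert.hyps by (intro generic_basis_insert_less) auto
  show ?case
  proof (cases "i = b")
    case False
    then have "wedge (generic_gen \<beta> n i) (generic_basis \<beta> n A) = 0"
      using insert.prems by (intro insert.IH) simp
    then show ?thesis
      unfolding * wedge_generic_gen_anticommute[of \<beta> n i b]
      by (simp only: wedge_zero_right ext.scale_zero_right)
  qed (simp add: * wedge_generic_gen_self)
qed simp

text \<open>Moving f_i past the smaller factors changes only the sign. The constant is recorded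
  merely as nonzero, because it is applied where a pairing is tested for being 0.\<close>

lemma wedge_generic_gen_generic_basis:
  assumes "finite S" "i \<notin> S"
  obtains c where "c \<noteq> 0"
    "wedge (generic_gen \<beta> n i) (generic_basis \<beta> n S) = ext_scale c (generic_basis \<beta> n (insert i S))"
proof -
  have "\<exists>c. c \<noteq> 0 \<and> wedge (generic_gen \<beta> n i) (generic_basis \<beta> n S) =
      ext_scale c (generic_basis \<beta> n (insert i S))"
    using assms
  proof (induction S rule: finite_linorder_min_induct)
    case empty
    show ?case
      using generic_basis_insert_less[of "{}" i \<beta> n] by (intro exI[of _ 1]) simp
  next
    case (insert b A)
    show ?case
    proof (cases "i < b")
      case True
      then have "generic_basis \<beta> n (insert i (insert b A)) =
          wedge (generic_gen \<beta> n i) (generic_basis \<beta> n (insert b A))"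
        using insert.hyps by (intro generic_basis_insert_less) (auto intro: less_trans)
      then show ?thesis by (intro exI[of _ 1]) simp
    next
      case False
      then have "b < i" using insert.prems by auto
      obtain c where c: "c \<noteq> 0" "wedge (generic_gen \<beta> n i) (generic_basis \<beta> n A) =
          ext_scale c (generic_basis \<beta> n (insert i A))"
        using insert by auto
      have "generic_basis \<beta> n (insert b A) = wedge (generic_gen \<beta> n b) (generic_basis \<beta> n A)"
        using insert.hyps by (intro generic_basis_insert_less) auto
      moreover have "generic_basis \<beta> n (insert b (insert i A)) =
          wedge (generic_gen \<beta> n b) (generic_basis \<beta> n (insert i A))"
        using insert.hyps \<open>b < i\<close> by (intro generic_basis_insert_less) auto
      ultimately show ?thesis
        using c by (intro exI[of _ "- c"])
          (simp add: wedge_generic_gen_anticommute[of \<beta> n i b] wedge_scale_right insert_commute)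
    qed
  qed
  then show ?thesis using that by blast
qed

lemma generic_basis_permute:
  assumes "finite S" "inj_on \<tau> S"
  obtains c where "c \<noteq> 0"
    "generic_basis (\<lambda>i. \<beta> (\<tau> i)) n S = ext_scale c (generic_basis \<beta> n (\<tau> ` S))"
proof -
  have "\<exists>c. c \<noteq> 0 \<and> generic_basis (\<lambda>i. \<beta> (\<tau> i)) n S = ext_scale c (generic_basis \<beta> n (\<tau> ` S))"
    using assms
  proof (induction S rule: finite_linorder_min_induct)
    case empty
    then show ?case by (intro exI[of _ 1]) (simp add: generic_basis_empty)
  next
    case (insert b A)
    have "b \<notin> A" using insert.hyps(2) by blast
    then have "\<tau> b \<notin> \<tau> ` A" using insert.prems by (auto simp: inj_on_def)
    then obtain d where d: "d \<noteq> 0" "wedge (generic_gen \<beta> n (\<tau> b)) (generic_basis \<beta> n (\<tau> ` A)) =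
        ext_scale d (generic_basis \<beta> n (insert (\<tau> b) (\<tau> ` A)))"
      using wedge_generic_gen_generic_basis[of "\<tau> ` A" "\<tau> b" \<beta> n] insert.hyps(1) by auto
    obtain c where c: "c \<noteq> 0"
      "generic_basis (\<lambda>i. \<beta> (\<tau> i)) n A = ext_scale c (generic_basis \<beta> n (\<tau> ` A))"
      using insert by (auto simp: inj_on_def)
    have "generic_basis (\<lambda>i. \<beta> (\<tau> i)) n (insert b A) =
        wedge (generic_gen (\<lambda>i. \<beta> (\<tau> i)) n b) (generic_basis (\<lambda>i. \<beta> (\<tau> i)) n A)"
      using insert.hyps by (intro generic_basis_insert_less) auto
    also have "generic_gen (\<lambda>i. \<beta> (\<tau> i)) n b = generic_gen \<beta> n (\<tau> b)"
      by (simp add: generic_gen_def)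
    finally show ?case
      using c d by (intro exI[of _ "c * d"]) (simp add: wedge_scale_right)
  qed
  then show ?thesis using that by blast
qed

lemma generic_basis_pair:
  assumes "i < j" "a < b" "a \<in> {1..n}" "b \<in> {1..n}"
  shows "generic_basis \<beta> n {i, j} {a, b} = \<beta> i a * \<beta> j b - \<beta> i b * \<beta> j a"
proof -
  have "generic_basis \<beta> n {i, j} = wedge (generic_gen \<beta> n i) (wedge (generic_gen \<beta> n j) ext_one)"
    using generic_basis_insert_less[of "{j}" i \<beta> n] generic_basis_insert_less[of "{}" j \<beta> n] assms(1)
    by (simp add: generic_basis_empty)
  moreover have "{a, b} \<inter> {1..n} = {a, b}" "{a, b} - {a} = {b}" "{a, b} - {b} = {a}"
    using assms(2-4) by auto
  moreover have "pos_sign {a, b} a = (1 :: 'a)" "pos_sign {a, b} b = (- 1 :: 'a)"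
    "pos_sign {b} b = (1 :: 'a)" "pos_sign {a} a = (1 :: 'a)"
  proof -
    have *: "{k \<in> {a, b}. k < a} = {}" "{k \<in> {a, b}. k < b} = {a}"
      "{k \<in> {b}. k < b} = {}" "{k \<in> {a}. k < a} = {}"
      using assms(2) by auto
    show "pos_sign {a, b} a = (1 :: 'a)" "pos_sign {a, b} b = (- 1 :: 'a)"
      "pos_sign {b} b = (1 :: 'a)" "pos_sign {a} a = (1 :: 'a)"
      unfolding pos_sign_def * by simp_all
  qed
  ultimately show ?thesis
    using assms(2) by (simp add: wedge_generic_gen_twice ext_one_def)
qed

lemma specialization_pos_sign:
  assumes "specialization R"
  shows "(pos_sign U u, pos_sign U u) \<in> R"
  using specialization_1[OF assms] specialization_uminus[OF assms]
  by (simp add: pos_sign_def minus_one_power_iff)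

text \<open>The coordinates of f_S are minors of the matrix, hence integer polynomials in its
  entries, and specialize along with them.\<close>

lemma specialization_generic_basis:
  assumes R: "specialization R" and "S \<subseteq> {1..n}"
    and entries: "\<And>i j. i \<in> {1..n} \<Longrightarrow> j \<in> {1..n} \<Longrightarrow> (\<alpha> i j, \<beta> i j) \<in> R"
  shows "(generic_basis \<alpha> n S U, generic_basis \<beta> n S U) \<in> R"
proof -
  have "finite S" using assms(2) finite_subset by blast
  then show ?thesis
    using assms(2)
  proof (induction S arbitrary: U rule: finite_linorder_min_induct)
    case empty
    show ?case
      by (simp add: generic_basis_empty ext_one_def specialization_0[OF R] specialization_1[OF R])
  next
    case (insert b A)
    have *: "generic_basis \<gamma> n (insert b A) = wedge (generic_gen \<gamma> n b) (generic_basis \<gamma> n A)"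
      for \<gamma> :: "nat \<Rightarrow> nat \<Rightarrow> 'a"
      using insert.hyps by (intro generic_basis_insert_less) auto
    show ?case
    proof (cases "finite U")
      case True
      then show ?thesis
        unfolding * wedge_generic_gen[OF True] using insert
        by (intro specialization_sum[OF R] specialization_mult[OF R]
            specialization_pos_sign[OF R] entries) auto
    qed (simp add: * wedge_infinite specialization_0[OF R])
  qed
qed

text \<open>The specialization at which every f_S becomes e_S. It witnesses the linear independence
  of the generic f_S.\<close>

definition id_matrix :: "nat \<Rightarrow> nat \<Rightarrow> 'k::field" where
  "id_matrix i j = (if i = j then 1 else 0)"

lemma generic_basis_id_matrix:
  assumes "S \<subseteq> {1..n}"
  shows "generic_basis id_matrix n S = (unit_ext S :: 'k::field ext)"
proof -
  have "finite S" using assms finite_subset by blast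
  then show ?thesis
    using assms
  proof (induction S rule: finite_linorder_min_induct)
    case empty
    show ?case by (simp add: generic_basis_empty ext_one_def unit_ext_def)
  next
    case (insert b A)
    have "generic_basis id_matrix n (insert b A) =
        (wedge (generic_gen id_matrix n b) (generic_basis id_matrix n A) :: 'k ext)"
      using insert.hyps by (intro generic_basis_insert_less) auto
    also have "\<dots> = wedge (generic_gen id_matrix n b) (unit_ext A)"
      using insert by simp
    also have "\<dots> = unit_ext (insert b A)"
    proof
      fix U
      show "wedge (generic_gen id_matrix n b) (unit_ext A) U = (unit_ext (insert b A) U :: 'k)"
      proof (cases "finite U")
        case True
        have "wedge (generic_gen id_matrix n b) (unit_ext A) U =
            (\<Sum>u\<in>U \<inter> {1..n}. if u = b then pos_sign U b * unit_ext A (U - {b}) else (0 :: 'k))"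
          unfolding wedge_generic_gen[OF True] by (intro sum.cong) (auto simp: id_matrix_def)
        also have "\<dots> = (if b \<in> U then pos_sign U b * unit_ext A (U - {b}) else 0)"
          using True insert.prems by simp
        also have "\<dots> = unit_ext (insert b A) U"
        proof (cases "U = insert b A")
          case True
          have "{j \<in> U. j < b} = {}" and UA: "U - {b} = A" using True insert.hyps(2) by auto
          then have "pos_sign U b = (1 :: 'k)" unfolding pos_sign_def by (simp only: card.empty power_0)
          then show ?thesis using True UA by (simp add: unit_ext_def)
        next
          case False
          then have "b \<in> U \<Longrightarrow> U - {b} \<noteq> A" by blast
          then show ?thesis using False by (simp add: unit_ext_def)
        qed
        finally show ?thesis .
      next
        case False
        then have "U \<noteq> insert b A" using insert.hyps(1) by auto
        then show ?thesis using False by (simp add: wedge_infinite unit_ext_def)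
      qed
    qed
    finally show ?case .
  qed
qed

lemma ext_basis_eq_unit:
  assumes "S \<subseteq> {1..n}"
  shows "ext_basis S = (unit_ext S :: 'a::field ext)"
proof -
  have "finite S" using assms finite_subset by blast
  have "generic_gen id_matrix n i = (ext_gen i :: 'a ext)" if "i \<in> {1..n}" for i
  proof
    fix T
    have "generic_gen id_matrix n i T = (\<Sum>j = 1..n. if j = i then ext_gen i T else (0 :: 'a))"
      unfolding generic_gen_apply by (intro sum.cong) (auto simp: id_matrix_def ext_gen_def)
    then show "generic_gen id_matrix n i T = (ext_gen i T :: 'a)" using that by simp
  qed
  then have "generic_basis id_matrix n S = (ext_basis S :: 'a ext)"
    using \<open>finite S\<close> assms
    unfolding generic_basis_def ext_basis_def wedge_over_def by (intro foldr_cong) auto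
  then show ?thesis using generic_basis_id_matrix[OF assms, where ?'k = 'a] by simp
qed

section \<open>The shifted complex\<close>

text \<open>The least element of the symmetric difference appears as a witness m. This makes sense
  for arbitrary sets and turns transitivity into a comparison of two witnesses.\<close>

definition lex_before :: "nat set \<Rightarrow> nat set \<Rightarrow> bool" where
  "lex_before R S \<longleftrightarrow> (\<exists>m. m \<in> R \<and> m \<notin> S \<and> (\<forall>j<m. j \<in> R \<longleftrightarrow> j \<in> S))"

lemma lex_before_irrefl: "\<not> lex_before R R"
  by (simp add: lex_before_def)

lemma lex_before_trans:
  assumes "lex_before R S" "lex_before S T"
  shows "lex_before R T"
proof -
  obtain k where k: "k \<in> R" "k \<notin> S" "\<And>j. j < k \<Longrightarrow> j \<in> R \<longleftrightarrow> j \<in> S"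
    using assms(1) unfolding lex_before_def by blast
  obtain m where m: "m \<in> S" "m \<notin> T" "\<And>j. j < m \<Longrightarrow> j \<in> S \<longleftrightarrow> j \<in> T"
    using assms(2) unfolding lex_before_def by blast
  have "k \<noteq> m" using k(2) m(1) by blast
  show ?thesis
  proof (cases "k < m")
    case True
    then show ?thesis
      unfolding lex_before_def using k m by (intro exI[of _ k]) auto
  next
    case False
    then have "m < k" using \<open>k \<noteq> m\<close> by simp
    then show ?thesis
      unfolding lex_before_def using k m by (intro exI[of _ m]) auto
  qed
qed

lemma lex_before_total:
  assumes "R \<noteq> S"
  shows "lex_before R S \<or> lex_before S R"
proof -
  define m where "m = (LEAST m. (m \<in> R) \<noteq> (m \<in> S))"
  have "\<exists>m. (m \<in> R) \<noteq> (m \<in> S)" using assms by blast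
  then have "(m \<in> R) \<noteq> (m \<in> S)" unfolding m_def by (rule LeastI_ex)
  moreover have "\<And>j. j < m \<Longrightarrow> j \<in> R \<longleftrightarrow> j \<in> S"
    unfolding m_def using not_less_Least by blast
  ultimately show ?thesis unfolding lex_before_def by blast
qed

lemma lex_less_iff_before:
  assumes "finite R" "finite S"
  shows "lex_less R S \<longleftrightarrow> lex_before R S"
proof -
  have less: "lex_less R S" if lex: "lex_before R S" and fin: "finite R" "finite S" for R S
  proof -
    obtain m where m: "m \<in> R" "m \<notin> S" "\<And>j. j < m \<Longrightarrow> j \<in> R \<longleftrightarrow> j \<in> S"
      using lex unfolding lex_before_def by blast
    have "Min ((R - S) \<union> (S - R)) = m"
    proof (rule Min_eqI)
      show "m \<le> j" if "j \<in> (R - S) \<union> (S - R)" for j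
        using that m(3)[of j] by (cases "j < m") auto
    qed (use fin m in auto)
    then show ?thesis using m by (auto simp: lex_less_def)
  qed
  show ?thesis
  proof
    assume *: "lex_less R S"
    show "lex_before R S"
    proof (rule ccontr)
      assume "\<not> lex_before R S"
      moreover have "R \<noteq> S" using * by (simp add: lex_less_def)
      ultimately have "lex_less S R" using lex_before_total less assms by blast
      moreover have "(S - R) \<union> (R - S) = (R - S) \<union> (S - R)" by blast
      ultimately have "Min ((R - S) \<union> (S - R)) \<in> R \<inter> S"
        using * by (simp add: lex_less_def)
      moreover have "Min ((R - S) \<union> (S - R)) \<in> (R - S) \<union> (S - R)"
        using assms \<open>R \<noteq> S\<close> by (intro Min_in) auto
      ultimately show False by blast
    qed
  qed (rule less[OF _ assms])
qed

definition subsets_of_size :: "nat \<Rightarrow> nat \<Rightarrow> nat set set" where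
  "subsets_of_size n s = {S. S \<subseteq> {1..n} \<and> card S = s}"

definition faces :: "nat \<Rightarrow> nat set set \<Rightarrow> nat \<Rightarrow> nat set set" where
  "faces n \<Delta> s = {S \<in> \<Delta>. S \<subseteq> {1..n} \<and> card S = s}"

lemma finite_subsets_of_size: "finite (subsets_of_size n s)"
  unfolding subsets_of_size_def by (rule finite_subset[of _ "Pow {1..n}"]) auto

lemma finite_faces: "finite (faces n \<Delta> s)"
  unfolding faces_def by (rule finite_subset[of _ "Pow {1..n}"]) auto

lemma finite_if_subset_atLeastAtMost: "S \<subseteq> {1..n} \<Longrightarrow> finite (S :: nat set)"
  using finite_subset by blast

lemma generic_basis_in_coord_space:
  assumes "S \<in> subsets_of_size n s"
  shows "generic_basis \<beta> n S \<in> coord_space (subsets_of_size n s)"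
  using assms generic_basis_support[of S \<beta> n] finite_if_subset_atLeastAtMost[of S n]
  unfolding coord_space_def subsets_of_size_def by force

lemma ext_scale_apply: "ext_scale c x S = c * x S"
  by (simp add: ext_scale_def)

lemma pairing_add_right: "pairing X w (u + v) = pairing X w u + pairing X w v"
  by (simp add: pairing_def sum.distrib algebra_simps)

lemma pairing_scale_right: "pairing X w (ext_scale c u) = c * pairing X w u"
  by (simp add: pairing_def ext_scale_def sum_distrib_left algebra_simps)

lemma pairing_zero_right: "pairing X w 0 = 0"
  by (simp add: pairing_def)

lemma pairing_unit_ext:
  assumes "finite X"
  shows "pairing X w (unit_ext T) = (if T \<in> X then w T else 0)"
proof -
  have "pairing X w (unit_ext T) = (\<Sum>S\<in>X. if S = T then w S else 0)"
    unfolding pairing_def by (intro sum.cong) (auto simp: unit_ext_def)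
  then show ?thesis using assms by simp
qed

lemma functional_expand:
  fixes \<phi> :: "'k::field ext \<Rightarrow> 'k"
  assumes "\<And>x y. \<phi> (x + y) = \<phi> x + \<phi> y" and scale: "\<And>c x. \<phi> (ext_scale c x) = c * \<phi> x"
    and "finite P" "y \<in> coord_space P"
  shows "\<phi> y = (\<Sum>T\<in>P. y T * \<phi> (unit_ext T))"
proof -
  have \<phi>0: "\<phi> 0 = 0" using scale[of 0 0] by simp
  have sum: "\<phi> (sum f P) = (\<Sum>T\<in>P. \<phi> (f T))" for f :: "nat set \<Rightarrow> 'k ext"
    using assms(3)
  proof (induction P rule: finite_induct)
    case empty
    show ?case by (simp only: sum.empty \<phi>0)
  next
    case (insert T P)
    then show ?case by (simp only: sum.insert[OF insert.hyps(1,2)] assms(1))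
  qed
  have "\<phi> y = \<phi> (\<Sum>T\<in>P. ext_scale (y T) (unit_ext T))"
    by (rule arg_cong[OF coord_space_expand[OF assms(3,4)]])
  then show ?thesis by (simp only: sum scale)
qed

text \<open>Separation of a vector from a span. The functional takes its values in the line of
  \<open>unit_ext {}\<close>, which keeps it a linear map on \<open>'k ext\<close>.\<close>

lemma ext_functional_exists:
  assumes "x \<notin> ext.span B"
  obtains g where "ext_linear g" "\<And>b. b \<in> B \<Longrightarrow> g b = 0" "g x = unit_ext {}"
proof -
  obtain C where C: "C \<subseteq> B" "ext.independent C" "B \<subseteq> ext.span C"
    by (rule ext.maximal_independent_subset)
  have "ext.span C \<subseteq> ext.span B" using C(1) by (rule ext.span_mono)
  then have x: "x \<notin> ext.span C" using assms by auto
  then have ind: "ext.independent (insert x C)" using C(2) by (rule ext.independent_insertI)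
  obtain g where g: "ext_linear g" "\<forall>c\<in>insert x C. g c = (if c = x then unit_ext {} else 0)"
    using ext_pair.linear_independent_extend[OF ind, of "\<lambda>c. if c = x then unit_ext {} else 0"]
    by auto
  interpret g: Vector_Spaces.linear ext_scale ext_scale g by (rule g(1))
  have "x \<notin> C" using x ext.span_base by auto
  then have zero: "g c = 0" if "c \<in> C" for c using g(2) that by auto
  have "g b = 0" if "b \<in> B" for b
    using g.eq_0_on_span[OF zero] C(3) that by auto
  then show thesis using that g by auto
qed

text \<open>
  The weightings \<open>w\<close> are the functionals on the exterior face ring of \<open>\<Delta>\<close>, and the greedy basis
  is read off from the positions of their first nonzero values.
\<close>

lemma mem_exterior_shift_iff:
  assumes S: "S \<in> subsets_of_size n s"
  shows "S \<in> exterior_shift \<alpha> n \<Delta> \<longleftrightarrow>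
    (\<exists>w\<in>coord_space (faces n \<Delta> s). pairing (faces n \<Delta> s) w (generic_basis \<alpha> n S) \<noteq> 0 \<and>
       (\<forall>R\<in>subsets_of_size n s. lex_before R S \<longrightarrow> pairing (faces n \<Delta> s) w (generic_basis \<alpha> n R) = 0))"
    (is "_ \<longleftrightarrow> ?rhs")
proof -
  let ?P = "subsets_of_size n s" and ?X = "faces n \<Delta> s"
  define A where "A = {ext_basis T :: 'a ext | T. T \<subseteq> {1..n} \<and> T \<notin> \<Delta>}"
  define B where "B = {generic_basis \<alpha> n R | R. R \<in> ?P \<and> lex_before R S}"
  have "{generic_basis \<alpha> n R | R. R \<subseteq> {1..n} \<and> card R = card S \<and> lex_less R S} = B"
  proof -
    have "(R \<subseteq> {1..n} \<and> card R = card S \<and> lex_less R S) = (R \<in> ?P \<and> lex_before R S)" for R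
      using S lex_less_iff_before[of R S] finite_if_subset_atLeastAtMost[of R n]
        finite_if_subset_atLeastAtMost[of S n]
      unfolding subsets_of_size_def by auto
    then show ?thesis unfolding B_def by simp
  qed
  then have shift: "S \<in> exterior_shift \<alpha> n \<Delta> \<longleftrightarrow> generic_basis \<alpha> n S \<notin> ext.span (A \<union> B)"
    using S unfolding exterior_shift_def face_ideal_def A_def[symmetric] ext.span_Un
    by (simp add: subsets_of_size_def)
  show ?thesis
  proof
    assume "S \<in> exterior_shift \<alpha> n \<Delta>"
    then obtain g where g: "ext_linear g" "\<And>b. b \<in> A \<union> B \<Longrightarrow> g b = 0"
      "g (generic_basis \<alpha> n S) = unit_ext {}"
      using ext_functional_exists shift by metis
    interpret g: Vector_Spaces.linear ext_scale ext_scale g by (rule g(1))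
    \<comment> \<open>g kills e_T for every non-face T, so only the faces of size s contribute to
      its value on f_R.\<close>
    define w where "w T = (if T \<in> ?X then g (unit_ext T) {} else 0)" for T
    have eval: "g (generic_basis \<alpha> n R) {} = pairing ?X w (generic_basis \<alpha> n R)" if "R \<in> ?P" for R
    proof -
      have "g (generic_basis \<alpha> n R) {} = (\<Sum>T\<in>?P. generic_basis \<alpha> n R T * g (unit_ext T) {})"
        by (rule functional_expand[OF _ _ finite_subsets_of_size generic_basis_in_coord_space[OF that]])
          (unfold g.add g.scale, simp_all only: plus_fun_apply ext_scale_apply)
      also have "\<dots> = (\<Sum>T\<in>?X. generic_basis \<alpha> n R T * g (unit_ext T) {})"
      proof (rule sum.mono_neutral_right[OF finite_subsets_of_size])
        show "\<forall>T\<in>?P - ?X. generic_basis \<alpha> n R T * g (unit_ext T) {} = 0"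
        proof
          fix T assume T: "T \<in> ?P - ?X"
          then have T': "T \<subseteq> {1..n}" "T \<notin> \<Delta>" by (auto simp: faces_def subsets_of_size_def)
          have "unit_ext T \<in> A"
            unfolding A_def ext_basis_eq_unit[OF T'(1), symmetric] using T' by blast
          then show "generic_basis \<alpha> n R T * g (unit_ext T) {} = 0" using g(2) by simp
        qed
      qed (auto simp: faces_def subsets_of_size_def)
      also have "\<dots> = pairing ?X w (generic_basis \<alpha> n R)"
        unfolding pairing_def w_def by (intro sum.cong) auto
      finally show ?thesis .
    qed
    have "g (generic_basis \<alpha> n R) = 0" if "R \<in> ?P" "lex_before R S" for R
      using g(2) that unfolding B_def by auto
    then have "pairing ?X w (generic_basis \<alpha> n R) = 0" if "R \<in> ?P" "lex_before R S" for R
      using eval[OF that(1)] that by simp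
    moreover have "pairing ?X w (generic_basis \<alpha> n S) \<noteq> 0"
      using eval[OF S] g(3) by (simp add: unit_ext_def)
    moreover have "w \<in> coord_space ?X" by (simp add: coord_space_def w_def)
    ultimately show ?rhs by blast
  next
    assume ?rhs
    then obtain w where w: "pairing ?X w (generic_basis \<alpha> n S) \<noteq> 0"
      "\<And>R. R \<in> ?P \<Longrightarrow> lex_before R S \<Longrightarrow> pairing ?X w (generic_basis \<alpha> n R) = 0" by blast
    have "pairing ?X w b = 0" if "b \<in> A \<union> B" for b
      using that
    proof
      assume "b \<in> A"
      then obtain T where T: "T \<subseteq> {1..n}" "T \<notin> \<Delta>" "b = unit_ext T"
        unfolding A_def using ext_basis_eq_unit by auto
      then show ?thesis using pairing_unit_ext[OF finite_faces, of n \<Delta> s w T] by (simp add: faces_def)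
    next
      assume "b \<in> B"
      then show ?thesis using w(2) unfolding B_def by auto
    qed
    moreover have "ext.subspace {x. pairing ?X w x = 0}"
      by (intro ext.subspaceI)
        (simp_all only: mem_Collect_eq pairing_add_right pairing_scale_right pairing_zero_right
          mult_zero_right add_0)
    ultimately have "ext.span (A \<union> B) \<subseteq> {x. pairing ?X w x = 0}"
      by (intro ext.span_minimal) auto
    then show "S \<in> exterior_shift \<alpha> n \<Delta>" using w(1) shift by auto
  qed
qed

text \<open>A functional w with leading position S is contracted with f_i to y \<mapsto> w(f_i wedge
  y). The contraction vanishes on non-faces because \<Delta> is closed under subsets, and it is
  nonzero at S - {i}. If R precedes S - {i}, then either i is in R and f_i wedge f_R = 0, or R with
  i added precedes S; in both cases the contraction vanishes on f_R.\<close>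

lemma exterior_shift_Diff:
  assumes sub: "\<And>S T. T \<in> \<Delta> \<Longrightarrow> S \<subseteq> T \<Longrightarrow> S \<in> \<Delta>"
    and S: "S \<in> exterior_shift \<alpha> n \<Delta>" and i: "i \<in> S"
  shows "S - {i} \<in> exterior_shift \<alpha> n \<Delta>"
proof -
  define s where "s = card (S - {i})"
  have Sn: "S \<subseteq> {1..n}" using S by (simp add: exterior_shift_def)
  then have fin: "finite S" by (rule finite_if_subset_atLeastAtMost)
  have cS: "card S = Suc s" using card_Suc_Diff1[OF fin i] by (simp add: s_def)
  then have S1: "S \<in> subsets_of_size n (Suc s)" and S0: "S - {i} \<in> subsets_of_size n s"
    using Sn by (auto simp: subsets_of_size_def s_def)
  let ?X = "faces n \<Delta> (Suc s)" and ?Y = "faces n \<Delta> s" and ?f = "generic_basis \<alpha> n"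
  obtain w where w: "w \<in> coord_space ?X" "pairing ?X w (?f S) \<noteq> 0"
    "\<And>R. R \<in> subsets_of_size n (Suc s) \<Longrightarrow> lex_before R S \<Longrightarrow> pairing ?X w (?f R) = 0"
    using S unfolding mem_exterior_shift_iff[OF S1] by blast
  define \<phi> where "\<phi> y = pairing ?X w (wedge (generic_gen \<alpha> n i) y)" for y
  have \<phi>_unit: "\<phi> (unit_ext T) = 0" if "T \<notin> \<Delta>" for T
  proof -
    have "wedge (generic_gen \<alpha> n i) (unit_ext T) U = 0" if "U \<in> ?X" for U
    proof -
      have "unit_ext T (U - {u}) = (0 :: 'a)" for u
        using that \<open>T \<notin> \<Delta>\<close> sub[of U T] by (auto simp: unit_ext_def faces_def)
      moreover have "finite U"
        using that finite_if_subset_atLeastAtMost by (auto simp: faces_def)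
      ultimately show ?thesis by (simp add: wedge_generic_gen)
    qed
    then show ?thesis by (simp add: \<phi>_def pairing_def)
  qed
  define v where "v T = (if T \<in> ?Y then \<phi> (unit_ext T) else 0)" for T
  have eval: "pairing ?Y v (?f R) = \<phi> (?f R)" if "R \<in> subsets_of_size n s" for R
  proof -
    have "\<phi> (?f R) = (\<Sum>T\<in>subsets_of_size n s. ?f R T * \<phi> (unit_ext T))"
      by (rule functional_expand[OF _ _ finite_subsets_of_size generic_basis_in_coord_space[OF that]])
        (simp_all only: \<phi>_def wedge_add_right wedge_scale_right pairing_add_right pairing_scale_right)
    also have "\<dots> = (\<Sum>T\<in>?Y. ?f R T * \<phi> (unit_ext T))"
      using \<phi>_unit by (intro sum.mono_neutral_right finite_subsets_of_size)
        (auto simp: faces_def subsets_of_size_def)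
    also have "\<dots> = pairing ?Y v (?f R)"
      unfolding pairing_def v_def by (intro sum.cong) auto
    finally show ?thesis by simp
  qed
  have "pairing ?Y v (?f (S - {i})) \<noteq> 0"
  proof -
    obtain c where c: "c \<noteq> 0" "wedge (generic_gen \<alpha> n i) (?f (S - {i})) =
        ext_scale c (?f (insert i (S - {i})))"
      using fin by (auto intro: wedge_generic_gen_generic_basis[of "S - {i}" i \<alpha> n])
    then have "\<phi> (?f (S - {i})) = c * pairing ?X w (?f S)"
      using i by (simp add: \<phi>_def pairing_scale_right insert_absorb)
    then show ?thesis using eval[OF S0] c(1) w(2) by simp
  qed
  moreover have "pairing ?Y v (?f R) = 0"
    if R: "R \<in> subsets_of_size n s" and lex: "lex_before R (S - {i})" for R
  proof (cases "i \<in> R")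
    case True
    then have "wedge (generic_gen \<alpha> n i) (?f R) = 0"
      using R finite_if_subset_atLeastAtMost
      by (intro wedge_generic_gen_generic_basis_mem) (auto simp: subsets_of_size_def)
    then show ?thesis unfolding eval[OF R] \<phi>_def by (simp only: pairing_zero_right)
  next
    case False
    have finR: "finite R" using R finite_if_subset_atLeastAtMost by (auto simp: subsets_of_size_def)
    obtain c where c: "wedge (generic_gen \<alpha> n i) (?f R) = ext_scale c (?f (insert i R))"
      using wedge_generic_gen_generic_basis[OF finR False] by metis
    have "insert i R \<in> subsets_of_size n (Suc s)"
      using R False finR i Sn by (auto simp: subsets_of_size_def)
    moreover have "lex_before (insert i R) S"
    proof -
      obtain m where m: "m \<in> R" "m \<notin> S - {i}" "\<And>j. j < m \<Longrightarrow> j \<in> R \<longleftrightarrow> j \<in> S - {i}"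
        using lex unfolding lex_before_def by blast
      have "m \<noteq> i" using m(1) False by auto
      moreover have "j \<in> insert i R \<longleftrightarrow> j \<in> S" if "j < m" for j
        using m(3)[OF that] i by auto
      ultimately show ?thesis
        unfolding lex_before_def using m by (intro exI[of _ m]) simp
    qed
    ultimately show ?thesis
      using w(3) unfolding eval[OF R] \<phi>_def c by (simp add: pairing_scale_right)
  qed
  moreover have "v \<in> coord_space ?Y" by (simp add: v_def coord_space_def)
  ultimately show ?thesis unfolding mem_exterior_shift_iff[OF S0] by blast
qed

lemma exterior_shift_subset_closed:
  assumes sub: "\<And>S T. T \<in> \<Delta> \<Longrightarrow> S \<subseteq> T \<Longrightarrow> S \<in> \<Delta>"
    and "S \<in> exterior_shift \<alpha> n \<Delta>" "R \<subseteq> S"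
  shows "R \<in> exterior_shift \<alpha> n \<Delta>"
proof -
  have "finite (S - R)"
    using assms(2) finite_if_subset_atLeastAtMost[of S n] by (simp add: exterior_shift_def)
  then have "S - (S - R) \<in> exterior_shift \<alpha> n \<Delta>"
  proof (induction "S - R" arbitrary: R rule: finite_induct)
    case empty
    then show ?case using assms(2) by (metis Diff_empty)
  next
    case (insert x F)
    have "x \<in> S" "x \<notin> R" using insert.hyps(4) by auto
    have "F = S - insert x R" using insert.hyps(2,4) by auto
    then have "S - (S - insert x R) \<in> exterior_shift \<alpha> n \<Delta>" by (rule insert.hyps(3))
    moreover have "S - (S - R) = S - (S - insert x R) - {x}" using \<open>x \<notin> R\<close> by auto
    moreover have "x \<in> S - (S - insert x R)" using \<open>x \<in> S\<close> by auto
    ultimately show ?case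
      using exterior_shift_Diff[of \<Delta> "S - (S - insert x R)" \<alpha> n x, OF sub] by simp
  qed
  then show ?thesis using assms(3) by (simp add: double_diff)
qed

section \<open>Face numbers of the shift, and shiftedness\<close>

text \<open>For the identity matrix the equations say that every coordinate of w is 0, and the
  generic solution space is no larger than the specialized one.\<close>

lemma generic_basis_solutions_trivial:
  assumes gen: "generic_extension emb n \<alpha>"
    and w: "w \<in> solutions (faces n \<Delta> s) (subsets_of_size n s) (generic_basis \<alpha> n)"
  shows "w = 0"
proof -
  let ?X = "faces n \<Delta> s" and ?P = "subsets_of_size n s"
  have "ext.dim (solutions ?X ?P (generic_basis \<alpha> n)) \<le>
      ext.dim (solutions ?X ?P (generic_basis id_matrix n) :: 'b ext set)"
  proof (rule dim_solutions_specialization[OF specialization_spec_graph[OF gen] finite_faces])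
    show "(generic_basis \<alpha> n S T, generic_basis id_matrix n S T) \<in> spec_graph emb n \<alpha> id_matrix"
      if "S \<in> ?P" for S T
      using that
      by (intro specialization_generic_basis[OF specialization_spec_graph[OF gen]]
          spec_graph_entry[OF gen]) (auto simp: subsets_of_size_def)
  qed
  also have "(solutions ?X ?P (generic_basis id_matrix n) :: 'b ext set) \<subseteq> {0}"
  proof
    fix v :: "'b ext"
    assume v: "v \<in> solutions ?X ?P (generic_basis id_matrix n)"
    have "v T = 0" for T
    proof (cases "T \<in> ?X")
      case True
      then have T: "T \<in> ?P" by (auto simp: faces_def subsets_of_size_def)
      then have "pairing ?X v (unit_ext T) = 0"
        using v generic_basis_id_matrix[of T n, where ?'k = 'b]
        unfolding solutions_def subsets_of_size_def by auto
      then show ?thesis using True by (simp add: pairing_unit_ext[OF finite_faces])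
    qed (use v in \<open>auto simp: solutions_def coord_space_def\<close>)
    then show "v \<in> {0}" by (auto simp: fun_eq_iff)
  qed
  then have "ext.dim (solutions ?X ?P (generic_basis id_matrix n) :: 'b ext set) \<le> card ({} :: 'b ext set)"
    by (intro ext.dim_le_card) auto
  finally have "ext.dim (solutions ?X ?P (generic_basis \<alpha> n)) = ext.dim {0 :: 'b ext}"
    using ext.dim_le_card[of "{0 :: 'b ext}" "{}"] by simp
  moreover have "(0 :: 'b ext) \<in> solutions ?X ?P (generic_basis \<alpha> n)"
    by (rule ext.subspace_0[OF subspace_solutions])
  ultimately have "{0} = solutions ?X ?P (generic_basis \<alpha> n)"
    using coord_space_subset_span[OF finite_faces, of n \<Delta> s, where ?'a = 'b]
    by (intro ext.subspace_eq_if_dim_eq[of _ _ "unit_ext ` ?X"])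
      (auto simp: solutions_def finite_faces)
  then show ?thesis using w by blast
qed

text \<open>A functional vanishing on an initial segment Q has its leading position outside Q;
  conversely the functional that certifies a face outside Q vanishes on all of Q. The empty Q gives
  the face numbers, the pairs with small minimum give the stresses.\<close>

lemma dim_solutions_lex_initial:
  assumes gen: "generic_extension emb n \<alpha>"
    and Q: "Q \<subseteq> subsets_of_size n s"
    and down: "\<And>R S. S \<in> Q \<Longrightarrow> R \<in> subsets_of_size n s \<Longrightarrow> lex_before R S \<Longrightarrow> R \<in> Q"
  shows "ext.dim (solutions (faces n \<Delta> s) Q (generic_basis \<alpha> n)) =
           card {S \<in> exterior_shift \<alpha> n \<Delta>. card S = s \<and> S \<notin> Q}"
proof -
  let ?X = "faces n \<Delta> s" and ?P = "subsets_of_size n s" and ?f = "generic_basis \<alpha> n"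
  let ?Z = "solutions ?X Q ?f"
  have "ext.dim ?Z = card {S \<in> ?P. \<exists>w\<in>?Z. pairing ?X w (?f S) \<noteq> 0 \<and>
            (\<forall>R\<in>?P. lex_before R S \<longrightarrow> pairing ?X w (?f R) = 0)}"
  proof (rule dim_eq_card_leading[OF finite_faces finite_subsets_of_size subspace_solutions])
    show "w = 0" if "w \<in> ?Z" "\<And>S. S \<in> ?P \<Longrightarrow> pairing ?X w (?f S) = 0" for w
      using that by (intro generic_basis_solutions_trivial[OF gen, of _ \<Delta> s]) (simp add: solutions_def)
  qed (use lex_before_irrefl lex_before_trans lex_before_total in \<open>auto simp: solutions_def\<close>)
  also have "{S \<in> ?P. \<exists>w\<in>?Z. pairing ?X w (?f S) \<noteq> 0 \<and>
            (\<forall>R\<in>?P. lex_before R S \<longrightarrow> pairing ?X w (?f R) = 0)} =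
      {S \<in> exterior_shift \<alpha> n \<Delta>. card S = s \<and> S \<notin> Q}" (is "?L = ?R")
  proof (intro equalityI subsetI)
    fix S assume "S \<in> ?L"
    then obtain w where S: "S \<in> ?P" and w: "w \<in> ?Z" "pairing ?X w (?f S) \<noteq> 0"
      "\<forall>R\<in>?P. lex_before R S \<longrightarrow> pairing ?X w (?f R) = 0" by blast
    then have "S \<in> exterior_shift \<alpha> n \<Delta>"
      unfolding mem_exterior_shift_iff[OF S] solutions_def by blast
    moreover have "S \<notin> Q" using w(1,2) by (auto simp: solutions_def)
    ultimately show "S \<in> ?R" using S by (simp add: subsets_of_size_def)
  next
    fix S assume R: "S \<in> ?R"
    then have S: "S \<in> ?P" by (auto simp: exterior_shift_def subsets_of_size_def)
    then obtain w where w: "w \<in> coord_space ?X" "pairing ?X w (?f S) \<noteq> 0"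
      "\<And>R. R \<in> ?P \<Longrightarrow> lex_before R S \<Longrightarrow> pairing ?X w (?f R) = 0"
      using R mem_exterior_shift_iff[OF S, of \<alpha> \<Delta>] by blast
    have "pairing ?X w (?f T) = 0" if "T \<in> Q" for T
    proof (rule w(3))
      show "T \<in> ?P" using that Q by blast
      have "T \<noteq> S" "\<not> lex_before S T" using that R S down by auto
      then show "lex_before T S" using lex_before_total by blast
    qed
    then have "w \<in> ?Z" using w(1) by (simp add: solutions_def)
    then show "S \<in> ?L" using S w by blast
  qed
  finally show ?thesis .
qed

lemma card_exterior_shift_size:
  assumes "generic_extension emb n \<alpha>"
  shows "card {S \<in> exterior_shift \<alpha> n \<Delta>. card S = s} = card (faces n \<Delta> s)"
proof -
  have "solutions (faces n \<Delta> s) {} (generic_basis \<alpha> n) = coord_space (faces n \<Delta> s)"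
    by (simp add: solutions_def)
  then show ?thesis
    using dim_solutions_lex_initial[OF assms, of "{}" s \<Delta>] dim_coord_space[OF finite_faces, where ?'k = 'b]
    by simp
qed

text \<open>Let m be the first difference of R and S. The exchange of i and j keeps it, unless i < m
  and j is in R: then i lies in the image of R but not in that of S, and the first difference moves
  down to i.\<close>

lemma lex_before_swap:
  assumes "i < j" "i \<in> S" "j \<notin> S" "lex_before R S"
    and \<tau>: "\<And>k. \<tau> k = (if k = i then j else if k = j then i else k)"
  shows "lex_before (\<tau> ` R) (\<tau> ` S)"
proof -
  have mem: "x \<in> \<tau> ` A \<longleftrightarrow> \<tau> x \<in> A" for x A
  proof
    assume "\<tau> x \<in> A"
    moreover have "x = \<tau> (\<tau> x)" using \<tau> by auto
    ultimately show "x \<in> \<tau> ` A" by blast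
  qed (use \<tau> in auto)
  obtain m where m: "m \<in> R" "m \<notin> S" "\<And>k. k < m \<Longrightarrow> k \<in> R \<longleftrightarrow> k \<in> S"
    using assms(4) unfolding lex_before_def by blast
  have "m \<noteq> i" using assms(2) m(2) by blast
  show ?thesis
  proof (cases "i < m \<and> j \<in> R")
    case True
    then have "m \<le> j" using m(3)[of j] assms(3) by (meson not_le)
    have "k \<in> \<tau> ` R \<longleftrightarrow> k \<in> \<tau> ` S" if "k < i" for k
      unfolding mem using that True m(3)[of k] assms(1) by (simp add: \<tau>)
    moreover have "i \<in> \<tau> ` R" "i \<notin> \<tau> ` S" unfolding mem using True assms(3) by (simp_all add: \<tau>)
    ultimately show ?thesis unfolding lex_before_def by blast
  next
    case False
    have "m \<noteq> j"
      using False m(1) assms(1) by auto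
    have "k \<in> \<tau> ` R \<longleftrightarrow> k \<in> \<tau> ` S" if "k < m" for k
      unfolding mem using that m(3)[of k] m(3)[of i] m(3)[of j] False assms(1-3) by (auto simp: \<tau>)
    moreover have "m \<in> \<tau> ` R" "m \<notin> \<tau> ` S"
      unfolding mem using m(1,2) \<open>m \<noteq> i\<close> \<open>m \<noteq> j\<close> by (simp_all add: \<tau>)
    ultimately show ?thesis unfolding lex_before_def by blast
  qed
qed

text \<open>
  Permuting the rows of the generic matrix is a specialization, so genericity makes the dimension of
  a solution space invariant under permutations of the index sets.
\<close>

lemma dim_solutions_permute_le:
  assumes gen: "generic_extension emb n \<alpha>" and Q: "Q \<subseteq> Pow {1..n}" and "finite X"
    and \<tau>: "inj \<tau>" "\<tau> ` {1..n} \<subseteq> {1..n}"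
  shows "ext.dim (solutions X Q (generic_basis \<alpha> n)) \<le> ext.dim (solutions X ((`) \<tau> ` Q) (generic_basis \<alpha> n))"
proof -
  let ?\<beta> = "\<lambda>i. \<alpha> (\<tau> i)"
  have "ext.dim (solutions X Q (generic_basis \<alpha> n)) \<le> ext.dim (solutions X Q (generic_basis ?\<beta> n))"
  proof (rule dim_solutions_specialization[OF specialization_spec_graph[OF gen] assms(3)])
    show "(generic_basis \<alpha> n S T, generic_basis ?\<beta> n S T) \<in> spec_graph emb n \<alpha> ?\<beta>"
      if "S \<in> Q" for S T
      using that Q
      by (intro specialization_generic_basis[OF specialization_spec_graph[OF gen]]
          spec_graph_entry[OF gen]) auto
  qed
  also have "solutions X Q (generic_basis ?\<beta> n) = solutions X ((`) \<tau> ` Q) (generic_basis \<alpha> n)"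
  proof -
    have "pairing X w (generic_basis ?\<beta> n S) = 0 \<longleftrightarrow> pairing X w (generic_basis \<alpha> n (\<tau> ` S)) = 0"
      if "S \<in> Q" for S w
    proof -
      have "finite S" using that Q finite_if_subset_atLeastAtMost by auto
      moreover have "inj_on \<tau> S" using \<tau>(1) subset_UNIV by (rule inj_on_subset)
      ultimately obtain c where "c \<noteq> 0"
        "generic_basis ?\<beta> n S = ext_scale c (generic_basis \<alpha> n (\<tau> ` S))"
        by (rule generic_basis_permute)
      then show ?thesis by (simp add: pairing_scale_right)
    qed
    then show ?thesis by (simp add: solutions_def)
  qed
  finally show ?thesis .
qed

text \<open>If S is not in the shift, the equation of f_S follows from those of the sets Q before S.
  By invariance of dimensions under the transposition \<tau> of i and j, the equation of \<tau>(S)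
  follows from those of \<tau>(Q). All members of \<tau>(Q) precede \<tau>(S), which is S with i
  replaced by the larger j, so \<tau>(S) would not be in the shift either.\<close>

lemma exterior_shift_shifted:
  assumes gen: "generic_extension emb n \<alpha>"
    and T: "insert j (S - {i}) \<in> exterior_shift \<alpha> n \<Delta>"
    and ij: "i \<in> S" "j \<notin> S" "i < j" and S: "S \<subseteq> {1..n}"
  shows "S \<in> exterior_shift \<alpha> n \<Delta>"
proof (rule ccontr)
  assume notin: "S \<notin> exterior_shift \<alpha> n \<Delta>"
  define \<tau> where "\<tau> k = (if k = i then j else if k = j then i else k)" for k
  have \<tau>\<tau>: "\<tau> (\<tau> k) = k" for k by (simp add: \<tau>_def)
  then have inj: "inj \<tau>" by (metis injI)
  have j: "j \<in> {1..n}" using T by (simp add: exterior_shift_def)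
  then have im: "\<tau> ` {1..n} \<subseteq> {1..n}" using ij S by (auto simp: \<tau>_def)
  have \<tau>S: "\<tau> ` S = insert j (S - {i})"
  proof -
    have "\<tau> ` (S - {i}) = (\<lambda>k. k) ` (S - {i})" using ij(2) by (intro image_cong) (auto simp: \<tau>_def)
    then show ?thesis using ij(1) by (metis image_ident image_insert insert_Diff \<tau>_def)
  qed
  define s where "s = card S"
  let ?X = "faces n \<Delta> s" and ?P = "subsets_of_size n s" and ?f = "generic_basis \<alpha> n"
  let ?sol = "\<lambda>Q. solutions ?X Q ?f"
  have SP: "S \<in> ?P" using S by (simp add: s_def subsets_of_size_def)
  have card_im: "card (\<tau> ` A) = card A" for A
    by (rule card_image[OF inj_on_subset[OF inj subset_UNIV]])
  have \<tau>P: "\<tau> ` A \<in> ?P" if "A \<in> ?P" for A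
    using that im card_im[of A] by (auto simp: subsets_of_size_def)
  have dim: "ext.dim (?sol Q) = ext.dim (?sol ((`) \<tau> ` Q))" if "Q \<subseteq> ?P" for Q
  proof (rule antisym)
    have Q: "Q \<subseteq> Pow {1..n}" using that by (auto simp: subsets_of_size_def)
    then show "ext.dim (?sol Q) \<le> ext.dim (?sol ((`) \<tau> ` Q))"
      by (rule dim_solutions_permute_le[OF gen _ finite_faces inj im])
    have "(`) \<tau> ` Q \<subseteq> Pow {1..n}" using Q im by auto
    then have "ext.dim (?sol ((`) \<tau> ` Q)) \<le> ext.dim (?sol ((`) \<tau> ` (`) \<tau> ` Q))"
      by (rule dim_solutions_permute_le[OF gen _ finite_faces inj im])
    also have "(`) \<tau> ` (`) \<tau> ` Q = Q" by (simp add: image_image \<tau>\<tau>)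
    finally show "ext.dim (?sol ((`) \<tau> ` Q)) \<le> ext.dim (?sol Q)" .
  qed
  define Q where "Q = {R \<in> ?P. lex_before R S}"
  have "?sol (insert S Q) = ?sol Q"
  proof -
    have "pairing ?X w (?f S) = 0" if "w \<in> ?sol Q" for w
      using notin that unfolding mem_exterior_shift_iff[OF SP] Q_def solutions_def by blast
    then show ?thesis by (auto simp: solutions_def)
  qed
  then have "ext.dim (?sol ((`) \<tau> ` insert S Q)) = ext.dim (?sol ((`) \<tau> ` Q))"
    using dim[of Q] dim[of "insert S Q"] SP unfolding Q_def by auto
  \<comment> \<open>The left system has one more equation, so equality of dimensions forces equality
    of the solution spaces.\<close>
  then have eq: "?sol ((`) \<tau> ` insert S Q) = ?sol ((`) \<tau> ` Q)"
    using coord_space_subset_span[OF finite_faces, of n \<Delta> s, where ?'a = 'b]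
    by (intro ext.subspace_eq_if_dim_eq[of _ _ "unit_ext ` ?X"] subspace_solutions)
      (auto simp: solutions_def finite_faces)
  have TP: "\<tau> ` S \<in> ?P" by (rule \<tau>P[OF SP])
  obtain w where w: "w \<in> coord_space ?X" "pairing ?X w (?f (\<tau> ` S)) \<noteq> 0"
    "\<And>R. R \<in> ?P \<Longrightarrow> lex_before R (\<tau> ` S) \<Longrightarrow> pairing ?X w (?f R) = 0"
    using T unfolding \<tau>S[symmetric] mem_exterior_shift_iff[OF TP] by blast
  have "lex_before (\<tau> ` R) (\<tau> ` S)" if "R \<in> Q" for R
    using that ij by (intro lex_before_swap[of i j]) (auto simp: \<tau>_def Q_def)
  then have "w \<in> ?sol ((`) \<tau> ` Q)"
    using w(1,3) \<tau>P unfolding solutions_def Q_def by auto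
  then have "w \<in> ?sol ((`) \<tau> ` insert S Q)" using eq by simp
  then show False using w(2) by (simp add: solutions_def)
qed

section \<open>Stresses of a graph\<close>

definition orient_sign :: "nat \<Rightarrow> nat \<Rightarrow> 'k::field" where
  "orient_sign a b = (if a < b then 1 else if b < a then - 1 else 0)"

text \<open>An edge weighting is read as an alternating matrix supported on the edges.\<close>

definition skew :: "'k::field ext \<Rightarrow> nat \<Rightarrow> nat \<Rightarrow> 'k" where
  "skew w a b = orient_sign a b * w {a, b}"

text \<open>The first k rows of \<beta> give each vertex b a point in K^k, and row c of the matrix
  weights these points so that their sum is 0. These are the self-stresses of Kalai's
  hyperconnectivity matroid.\<close>

definition stresses :: "nat \<Rightarrow> (nat \<Rightarrow> nat \<Rightarrow> 'k::field) \<Rightarrow> nat set set \<Rightarrow> nat \<Rightarrow> 'k ext set" where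
  "stresses n \<beta> D k =
     {w \<in> coord_space D. \<forall>i\<in>{1..k}. \<forall>c\<in>{1..n}. (\<Sum>b = 1..n. skew w c b * \<beta> i b) = 0}"

text \<open>The coefficients, in the unknown edge weights, of the equation belonging to row i and
  vertex c; they turn stresses into an instance of \<open>solutions\<close>.\<close>

definition stress_row :: "nat \<Rightarrow> (nat \<Rightarrow> nat \<Rightarrow> 'k::field) \<Rightarrow> nat \<Rightarrow> nat \<Rightarrow> 'k ext" where
  "stress_row n \<beta> i c S = (\<Sum>b = 1..n. if S = {c, b} then orient_sign c b * \<beta> i b else 0)"

lemma orient_sign_swap: "orient_sign b a = - (orient_sign a b :: 'k::field)"
  by (simp add: orient_sign_def)

lemma orient_sign_self: "orient_sign a a = 0"
  by (simp add: orient_sign_def)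

lemma orient_sign_square: "a \<noteq> b \<Longrightarrow> orient_sign a b * orient_sign a b = 1"
  by (simp add: orient_sign_def)

lemma skew_swap: "skew w b a = - skew w a b"
  unfolding skew_def orient_sign_swap[of b a] by (simp add: insert_commute)

lemma skew_self: "skew w a a = 0"
  by (simp add: skew_def orient_sign_self)

lemma skew_add: "skew (v + w) a b = skew v a b + skew w a b"
  by (simp add: skew_def algebra_simps)

lemma skew_scale: "skew (ext_scale c w) a b = c * skew w a b"
  by (simp add: skew_def ext_scale_def)

lemma skew_not_edge: "w \<in> coord_space D \<Longrightarrow> {a, b} \<notin> D \<Longrightarrow> skew w a b = 0"
  by (simp add: skew_def coord_space_def)

lemma finite_edge_set: "D \<subseteq> subsets_of_size n 2 \<Longrightarrow> finite D"
  using finite_subset finite_subsets_of_size by blast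

lemma pairing_stress_row:
  assumes "finite D" "w \<in> coord_space D"
  shows "pairing D w (stress_row n \<beta> i c) = (\<Sum>b = 1..n. skew w c b * \<beta> i b)"
proof -
  have "pairing D w (stress_row n \<beta> i c) =
      (\<Sum>S\<in>D. \<Sum>b = 1..n. if S = {c, b} then w S * orient_sign c b * \<beta> i b else 0)"
    unfolding pairing_def stress_row_def sum_distrib_left by (intro sum.cong) auto
  also have "\<dots> = (\<Sum>b = 1..n. \<Sum>S\<in>D. if S = {c, b} then w S * orient_sign c b * \<beta> i b else 0)"
    by (rule sum.swap)
  also have "\<dots> = (\<Sum>b = 1..n. skew w c b * \<beta> i b)"
  proof (rule sum.cong[OF refl])
    fix b
    have "(\<Sum>S\<in>D. if S = {c, b} then w S * orient_sign c b * \<beta> i b else 0) =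
        (if {c, b} \<in> D then w {c, b} * orient_sign c b * \<beta> i b else 0)"
      using assms(1) by simp
    then show "(\<Sum>S\<in>D. if S = {c, b} then w S * orient_sign c b * \<beta> i b else 0) = skew w c b * \<beta> i b"
      using assms(2) by (simp add: skew_def coord_space_def mult.commute)
  qed
  finally show ?thesis .
qed

lemma stresses_eq_solutions:
  assumes "finite D"
  shows "stresses n \<beta> D k = solutions D ({1..k} \<times> {1..n}) (\<lambda>(i, c). stress_row n \<beta> i c)"
  unfolding stresses_def solutions_def using pairing_stress_row[OF assms, of _ n \<beta>] by auto

lemma subspace_stresses:
  assumes "finite D"
  shows "ext.subspace (stresses n \<beta> D k)"
  unfolding stresses_eq_solutions[OF assms] by (rule subspace_solutions)

lemma stresses_subset_coord_space: "stresses n \<beta> D k \<subseteq> coord_space D"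
  by (auto simp: stresses_def)

lemma specialization_stress_row:
  assumes R: "specialization R" and "\<And>b. b \<in> {1..n} \<Longrightarrow> (\<alpha> i b, \<beta> i b) \<in> R"
  shows "(stress_row n \<alpha> i c S, stress_row n \<beta> i c S) \<in> R"
proof -
  have "(orient_sign a b, orient_sign a b) \<in> R" for a b
    using specialization_0[OF R] specialization_1[OF R] specialization_uminus[OF R]
    by (simp add: orient_sign_def)
  then show ?thesis
    unfolding stress_row_def using assms(2)
    by (intro specialization_sum[OF R])
      (simp add: specialization_0[OF R] specialization_mult[OF R])
qed

text \<open>The comparison matrix \<beta> is arbitrary. The bound k \<le> n keeps the rows among the
  algebraically independent entries.\<close>

lemma dim_stresses_generic_le:
  fixes \<alpha> \<beta> :: "nat \<Rightarrow> nat \<Rightarrow> 'k::field"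
  assumes gen: "generic_extension emb n \<alpha>" and "finite D" "k \<le> n"
  shows "ext.dim (stresses n \<alpha> D k) \<le> ext.dim (stresses n \<beta> D k)"
  unfolding stresses_eq_solutions[OF assms(2)]
proof (rule dim_solutions_specialization[OF specialization_spec_graph[OF gen] assms(2)])
  fix q S assume "q \<in> {1..k} \<times> {1..n}" "S \<in> D"
  then obtain i c where "q = (i, c)" "i \<in> {1..n}" using assms(3) by auto
  moreover have "(stress_row n \<alpha> i c S, stress_row n \<beta> i c S) \<in> spec_graph emb n \<alpha> \<beta>"
    using specialization_spec_graph[OF gen]
    by (rule specialization_stress_row) (rule spec_graph_entry[OF gen \<open>i \<in> {1..n}\<close>])
  ultimately show "((case q of (i, c) \<Rightarrow> stress_row n \<alpha> i c) S, (case q of (i, c) \<Rightarrow> stress_row n \<beta> i c) S)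
      \<in> spec_graph emb n \<alpha> \<beta>"
    by simp
qed

section \<open>The alternating form of a stress and the 2 by 2 minors\<close>

definition skew_form :: "nat \<Rightarrow> 'k::field ext \<Rightarrow> (nat \<Rightarrow> 'k) \<Rightarrow> (nat \<Rightarrow> 'k) \<Rightarrow> 'k" where
  "skew_form n w x y = (\<Sum>c = 1..n. \<Sum>b = 1..n. skew w c b * x c * y b)"

lemma skew_form_left: "skew_form n w x y = (\<Sum>c = 1..n. x c * (\<Sum>b = 1..n. skew w c b * y b))"
  by (simp add: skew_form_def sum_distrib_left algebra_simps)

lemma skew_form_swap: "skew_form n w y x = - skew_form n w x y"
proof -
  have "skew_form n w y x = (\<Sum>b = 1..n. \<Sum>c = 1..n. skew w c b * y c * x b)"
    unfolding skew_form_def by (rule sum.swap)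
  also have "\<dots> = (\<Sum>b = 1..n. \<Sum>c = 1..n. - (skew w b c * x b * y c))"
  proof (intro sum.cong[OF refl])
    show "skew w c b * y c * x b = - (skew w b c * x b * y c)" for b c
      by (subst skew_swap) (simp add: algebra_simps)
  qed
  finally show ?thesis by (simp add: skew_form_def sum_negf)
qed

text \<open>Antisymmetry alone gives only that twice the value is 0. The diagonal entries vanish and
  opposite entries cancel, in every characteristic.\<close>

lemma skew_form_self: "skew_form n w x x = 0"
proof -
  let ?h = "\<lambda>c b. skew w c b * x c * x b"
  have "(\<Sum>c = 1..n. \<Sum>b\<in>{1..n} - {c}. ?h c b) = 0"
  proof (rule sum_antisymmetric)
    show "?h c b = - ?h b c" for c b by (subst skew_swap) (simp add: algebra_simps)
  qed simp
  moreover have "(\<Sum>b\<in>{1..n} - {c}. ?h c b) = (\<Sum>b = 1..n. ?h c b)" for c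
    by (rule sum.mono_neutral_left) (auto simp: skew_self)
  ultimately show ?thesis unfolding skew_form_def by simp
qed

text \<open>An edge {p, q} enters the form with the minor of rows i, j and columns p, q, which is a
  coordinate of f_i wedge f_j. This links stresses to the exterior algebra.\<close>

lemma skew_form_edges:
  assumes D: "D \<subseteq> subsets_of_size n 2" and w: "w \<in> coord_space D" and "i < j"
  shows "skew_form n w (\<beta> i) (\<beta> j) = pairing D w (generic_basis \<beta> n {i, j})"
proof -
  let ?t = "\<lambda>S c b. if S = {c, b} then orient_sign c b * \<beta> i c * \<beta> j b else 0"
  have fin: "finite D" by (rule finite_edge_set[OF D])
  have "skew_form n w (\<beta> i) (\<beta> j) = (\<Sum>c = 1..n. \<Sum>b = 1..n. \<Sum>S\<in>D. w S * ?t S c b)"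
    unfolding skew_form_def
  proof (intro sum.cong[OF refl])
    fix c b
    have "(\<Sum>S\<in>D. w S * ?t S c b) =
        (\<Sum>S\<in>D. if S = {c, b} then w {c, b} * (orient_sign c b * \<beta> i c * \<beta> j b) else 0)"
      by (intro sum.cong) auto
    also have "\<dots> = (if {c, b} \<in> D then w {c, b} * (orient_sign c b * \<beta> i c * \<beta> j b) else 0)"
      using fin by simp
    finally show "skew w c b * \<beta> i c * \<beta> j b = (\<Sum>S\<in>D. w S * ?t S c b)"
      using w by (simp add: skew_def coord_space_def mult.commute mult.left_commute)
  qed
  also have "\<dots> = (\<Sum>c = 1..n. \<Sum>S\<in>D. \<Sum>b = 1..n. w S * ?t S c b)"
    by (intro sum.cong[OF refl] sum.swap)
  also have "\<dots> = (\<Sum>S\<in>D. \<Sum>c = 1..n. \<Sum>b = 1..n. w S * ?t S c b)"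
    by (rule sum.swap)
  also have "\<dots> = (\<Sum>S\<in>D. w S * generic_basis \<beta> n {i, j} S)"
  proof (rule sum.cong[OF refl])
    fix S assume "S \<in> D"
    then have "S \<subseteq> {1..n}" "card S = 2" using D by (auto simp: subsets_of_size_def)
    then obtain p q where pq: "S = {p, q}" "p < q" "p \<in> {1..n}" "q \<in> {1..n}"
      unfolding card_2_iff by (metis doubleton_eq_iff insert_subset linorder_neqE_nat)
    have t: "?t S c b = (if c = p then (if b = q then \<beta> i p * \<beta> j q else 0) else 0) -
        (if c = q then (if b = p then \<beta> i q * \<beta> j p else 0) else 0)" for c b
      using pq(2) unfolding pq(1) by (auto simp: doubleton_eq_iff orient_sign_def)
    have "(\<Sum>b = 1..n. ?t S c b) = (if c = p then \<beta> i p * \<beta> j q else 0) -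
        (if c = q then \<beta> i q * \<beta> j p else 0)" for c
      unfolding t sum_subtractf using pq(3,4) by simp
    then have "(\<Sum>c = 1..n. \<Sum>b = 1..n. ?t S c b) = \<beta> i p * \<beta> j q - \<beta> i q * \<beta> j p"
      using pq(3,4) by (simp add: sum_subtractf)
    then have "(\<Sum>c = 1..n. \<Sum>b = 1..n. ?t S c b) = generic_basis \<beta> n {i, j} S"
      using generic_basis_pair[OF assms(3) pq(2-4), of \<beta>] pq(1) by simp
    then show "(\<Sum>c = 1..n. \<Sum>b = 1..n. w S * ?t S c b) = w S * generic_basis \<beta> n {i, j} S"
      by (simp only: sum_distrib_left[symmetric])
  qed
  finally show ?thesis by (simp add: pairing_def)
qed

text \<open>Nonsingularity of the generic matrix, obtained as the size 1 case of
  \<open>generic_basis_solutions_trivial\<close> for the full simplex.\<close>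

lemma generic_matrix_injective:
  assumes gen: "generic_extension emb n \<alpha>"
    and "\<And>j. j \<in> {1..n} \<Longrightarrow> (\<Sum>c = 1..n. \<alpha> j c * y c) = 0" and "c \<in> {1..n}"
  shows "y c = 0"
proof -
  let ?X = "faces n UNIV 1"
  have X: "?X = (\<lambda>c. {c}) ` {1..n}"
    unfolding faces_def by (auto simp: card_Suc_eq)
  define w where "w T = (if T \<in> ?X then y (the_elem T) else 0)" for T
  have gb: "generic_basis \<alpha> n {j} {c} = \<alpha> j c" if "c \<in> {1..n}" for j c
  proof -
    have "generic_basis \<alpha> n {j} = wedge (generic_gen \<alpha> n j) ext_one"
      using generic_basis_insert_less[of "{}" j \<alpha> n] by (simp add: generic_basis_empty)
    moreover have "{c} \<inter> {1..n} = {c}" using that by auto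
    moreover have "pos_sign {c} c = (1 :: 'b)"
    proof -
      have "{k \<in> {c}. k < c} = {}" by auto
      then show ?thesis unfolding pos_sign_def by (simp only: card.empty power_0)
    qed
    ultimately show ?thesis by (simp add: wedge_generic_gen ext_one_def)
  qed
  have "pairing ?X w (generic_basis \<alpha> n S) = 0" if S: "S \<in> subsets_of_size n 1" for S
  proof -
    obtain j where j: "S = {j}" "j \<in> {1..n}"
      using S by (auto simp: subsets_of_size_def card_Suc_eq)
    have "pairing ?X w (generic_basis \<alpha> n S) = (\<Sum>c = 1..n. w {c} * generic_basis \<alpha> n S {c})"
      unfolding pairing_def X by (subst sum.reindex) (auto simp: inj_on_def)
    also have "\<dots> = (\<Sum>c = 1..n. \<alpha> j c * y c)"
    proof (rule sum.cong[OF refl])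
      fix c assume c: "c \<in> {1..n}"
      then have "{c} \<in> ?X" unfolding X by blast
      then show "w {c} * generic_basis \<alpha> n S {c} = \<alpha> j c * y c"
        using gb[OF c] by (simp add: w_def j(1))
    qed
    finally show ?thesis using assms(2)[OF j(2)] by simp
  qed
  then have "w \<in> solutions ?X (subsets_of_size n 1) (generic_basis \<alpha> n)"
    by (simp add: solutions_def coord_space_def w_def)
  then have "w = 0" by (rule generic_basis_solutions_trivial[OF gen])
  then have "w {c} = 0" by simp
  moreover have "{c} \<in> ?X" unfolding X using assms(3) by blast
  ultimately show ?thesis by (simp add: w_def)
qed

text \<open>Since the generic matrix is nonsingular, the alternating matrix kills the row
  \<open>\<alpha> i\<close> if and only if its form vanishes on \<open>\<alpha> j\<close> and
  \<open>\<alpha> i\<close> for all j. As the form is alternating, the rows i \<le> k leave one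
  condition for each pair {i, j} with minimum at most k.\<close>

lemma stresses_eq_solutions_generic_basis:
  assumes gen: "generic_extension emb n \<alpha>" and D: "D \<subseteq> subsets_of_size n 2" and k: "k \<le> n"
  shows "stresses n \<alpha> D k = solutions D {S \<in> subsets_of_size n 2. Min S \<le> k} (generic_basis \<alpha> n)"
    (is "_ = solutions D ?Q _")
proof (intro equalityI subsetI)
  fix w assume w: "w \<in> stresses n \<alpha> D k"
  then have wD: "w \<in> coord_space D" by (simp add: stresses_def)
  have "pairing D w (generic_basis \<alpha> n S) = 0" if S: "S \<in> ?Q" for S
  proof -
    have "S \<subseteq> {1..n}" "card S = 2" "Min S \<le> k" using S by (auto simp: subsets_of_size_def)
    then obtain i j where ij: "S = {i, j}" "i < j" "i \<in> {1..n}"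
      unfolding card_2_iff by (metis doubleton_eq_iff insert_subset linorder_neqE_nat)
    then have "i \<in> {1..k}" using \<open>Min S \<le> k\<close> by (simp add: min_def)
    then have "skew_form n w (\<alpha> j) (\<alpha> i) = 0"
      using w unfolding skew_form_left stresses_def by simp
    then show ?thesis
      using skew_form_edges[OF D wD ij(2), of \<alpha>] skew_form_swap[of n w "\<alpha> i" "\<alpha> j"] ij(1) by simp
  qed
  then show "w \<in> solutions D ?Q (generic_basis \<alpha> n)" using wD by (simp add: solutions_def)
next
  fix w assume w: "w \<in> solutions D ?Q (generic_basis \<alpha> n)"
  then have wD: "w \<in> coord_space D" by (simp add: solutions_def)
  have edge: "pairing D w (generic_basis \<alpha> n {a, b}) = 0"
    if "a < b" "a \<in> {1..n}" "b \<in> {1..n}" "a \<le> k" for a b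
  proof -
    have "{a, b} \<in> ?Q" using that by (simp add: subsets_of_size_def)
    then show ?thesis using w unfolding solutions_def by blast
  qed
  have "(\<Sum>b = 1..n. skew w c b * \<alpha> i b) = 0" if i: "i \<in> {1..k}" and c: "c \<in> {1..n}" for i c
  proof (rule generic_matrix_injective[OF gen _ c])
    fix j assume j: "j \<in> {1..n}"
    have i': "i \<in> {1..n}" using i k by auto
    have "skew_form n w (\<alpha> j) (\<alpha> i) = 0"
    proof (cases i j rule: linorder_cases)
      case less
      then show ?thesis
        using edge[OF less i' j] skew_form_edges[OF D wD less, of \<alpha>]
          skew_form_swap[of n w "\<alpha> i" "\<alpha> j"] i by simp
    next
      case equal
      then show ?thesis by (simp add: skew_form_self)
    next
      case greater
      then show ?thesis
        using edge[OF greater j i'] skew_form_edges[OF D wD greater, of \<alpha>] i by simp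
    qed
    then show "(\<Sum>c = 1..n. \<alpha> j c * (\<Sum>b = 1..n. skew w c b * \<alpha> i b)) = 0"
      by (simp add: skew_form_left)
  qed
  then show "w \<in> stresses n \<alpha> D k" using wD by (simp add: stresses_def)
qed

section \<open>Deleting a vertex\<close>

definition delete_vertex :: "'a set set \<Rightarrow> 'a \<Rightarrow> 'a set set" where
  "delete_vertex D v = {e \<in> D. v \<notin> e}"

definition neighbours :: "'a set set \<Rightarrow> 'a \<Rightarrow> 'a set" where
  "neighbours D v = {b. {v, b} \<in> D}"

text \<open>Row v of the alternating matrix, kept as an edge weighting. On the stresses its kernel
  consists of the stresses of the graph without v, so rank-nullity measures the effect of deleting
  v.\<close>

definition row_at :: "nat \<Rightarrow> 'k::field ext \<Rightarrow> 'k ext" where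
  "row_at v w = (\<lambda>S. if v \<in> S then w S else 0)"

lemma row_at_linear: "ext_linear (row_at v)"
  by (rule ext_linearI) (auto simp: row_at_def ext_scale_def fun_eq_iff)

lemma not_mem_neighbours_self:
  assumes "D \<subseteq> subsets_of_size n 2"
  shows "v \<notin> neighbours D v"
  using assms by (auto simp: neighbours_def subsets_of_size_def)

lemma neighbours_subset:
  assumes "D \<subseteq> subsets_of_size n 2"
  shows "neighbours D v \<subseteq> {1..n}"
  using assms by (auto simp: neighbours_def subsets_of_size_def)

lemma edges_at_eq:
  assumes "D \<subseteq> subsets_of_size n 2"
  shows "{S \<in> D. v \<in> S} = (\<lambda>b. {v, b}) ` neighbours D v"
proof (intro equalityI subsetI)
  fix S assume S: "S \<in> {S \<in> D. v \<in> S}"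
  then have "card S = 2" using assms by (auto simp: subsets_of_size_def)
  then obtain b where "S = {v, b}" using S unfolding card_2_iff by auto
  then show "S \<in> (\<lambda>b. {v, b}) ` neighbours D v" using S by (auto simp: neighbours_def)
qed (auto simp: neighbours_def)

lemma inj_on_pair: "inj_on (\<lambda>b. {v, b}) A"
  by (auto simp: inj_on_def doubleton_eq_iff)

lemma dim_stresses_delete:
  assumes D: "D \<subseteq> subsets_of_size n 2"
  shows "ext.dim (stresses n \<beta> D k) =
    ext.dim (stresses n \<beta> (delete_vertex D v) k) + ext.dim (row_at v ` stresses n \<beta> D k)"
proof -
  have "{w \<in> stresses n \<beta> D k. row_at v w = 0} = stresses n \<beta> (delete_vertex D v) k"
  proof -
    have "w \<in> coord_space D \<and> row_at v w = 0 \<longleftrightarrow> w \<in> coord_space (delete_vertex D v)" for w :: "'a ext"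
      unfolding coord_space_def delete_vertex_def row_at_def fun_eq_iff by auto
    then show ?thesis unfolding stresses_def by blast
  qed
  then show ?thesis
    using rank_nullity_coord_space[OF row_at_linear[of v]
        subspace_stresses[OF finite_edge_set[OF D], of n \<beta> k]
        stresses_subset_coord_space finite_edge_set[OF D]] by simp
qed

text \<open>Row v of a stress lives on the d neighbours of v and is annihilated by k generic vectors
  of length d, which impose min d k independent conditions.\<close>

lemma dim_row_at_le:
  assumes gen: "generic_extension emb n \<alpha>" and D: "D \<subseteq> subsets_of_size n 2"
    and v: "v \<in> {1..n}" and k: "k \<le> n"
  shows "ext.dim (row_at v ` stresses n \<alpha> D k) \<le> card (neighbours D v) - k"
proof -
  let ?N = "neighbours D v" and ?X = "{S \<in> D. v \<in> S}"
  define d where "d = card ?N"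
  have finX: "finite ?X" using finite_edge_set[OF D] by simp
  have finN: "finite ?N" using neighbours_subset[OF D] finite_if_subset_atLeastAtMost by blast
  obtain h where h: "bij_betw h {1..d} ?N"
    using ex_bij_betw_nat_finite_1[OF finN] d_def by blast
  \<comment> \<open>For i \<le> d, row i picks out the i-th neighbour, so the specialized equations
    erase the entries at the first min d k neighbours.\<close>
  define \<beta> :: "nat \<Rightarrow> nat \<Rightarrow> 'b" where "\<beta> i b = (if i \<le> d \<and> b = h i then 1 else 0)" for i b
  let ?Y = "{S \<in> ?X. S \<notin> (\<lambda>i. {v, h i}) ` {1..min d k}}"
  have "row_at v ` stresses n \<alpha> D k \<subseteq> solutions ?X {1..k} (\<lambda>i. stress_row n \<alpha> i v)"
  proof
    fix y assume "y \<in> row_at v ` stresses n \<alpha> D k"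
    then obtain w where w: "w \<in> stresses n \<alpha> D k" "y = row_at v w" by blast
    have y: "y \<in> coord_space ?X"
      using w by (auto simp: coord_space_def row_at_def stresses_def)
    moreover have "skew y v b = skew w v b" for b by (simp add: w(2) skew_def row_at_def)
    ultimately show "y \<in> solutions ?X {1..k} (\<lambda>i. stress_row n \<alpha> i v)"
      using w(1) v unfolding solutions_def stresses_def by (simp add: pairing_stress_row[OF finX y])
  qed
  then have "ext.dim (row_at v ` stresses n \<alpha> D k) \<le> ext.dim (solutions ?X {1..k} (\<lambda>i. stress_row n \<alpha> i v))"
    using finX by (intro dim_mono_coord_space[of _ _ ?X]) (auto simp: solutions_def)
  also have "\<dots> \<le> ext.dim (solutions ?X {1..k} (\<lambda>i. stress_row n \<beta> i v))"
  proof (rule dim_solutions_specialization[OF specialization_spec_graph[OF gen] finX])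
    fix i S assume "i \<in> {1..k}"
    then have "i \<in> {1..n}" using k by simp
    show "(stress_row n \<alpha> i v S, stress_row n \<beta> i v S) \<in> spec_graph emb n \<alpha> \<beta>"
      using specialization_spec_graph[OF gen]
      by (rule specialization_stress_row) (rule spec_graph_entry[OF gen \<open>i \<in> {1..n}\<close>])
  qed
  also have "\<dots> \<le> ext.dim (coord_space ?Y :: 'b ext set)"
  proof (rule dim_mono_coord_space[OF _ subset_refl])
    show "solutions ?X {1..k} (\<lambda>i. stress_row n \<beta> i v) \<subseteq> coord_space ?Y"
    proof
      fix y assume y: "y \<in> solutions ?X {1..k} (\<lambda>i. stress_row n \<beta> i v)"
      have "y {v, h i} = 0" if i: "i \<in> {1..min d k}" for i
      proof -
        have hi: "h i \<in> ?N" using h i by (auto simp: bij_betw_def)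
        then have hi': "h i \<in> {1..n}" "h i \<noteq> v"
          using subsetD[OF neighbours_subset[OF D] hi] not_mem_neighbours_self[OF D, of v] by auto
        have "0 = (\<Sum>b = 1..n. skew y v b * \<beta> i b)"
          using y i pairing_stress_row[OF finX, of y n \<beta> i v] by (simp add: solutions_def)
        also have "\<dots> = (\<Sum>b = 1..n. if b = h i then skew y v b else 0)"
          using i by (intro sum.cong) (auto simp: \<beta>_def)
        also have "\<dots> = skew y v (h i)" using hi' by simp
        finally have "orient_sign v (h i) * (orient_sign v (h i) * y {v, h i}) = 0"
          unfolding skew_def by simp
        then show ?thesis
          using orient_sign_square[of v "h i", where ?'a = 'b] hi'(2) by (simp add: mult.assoc[symmetric])
      qed
      then show "y \<in> coord_space ?Y" using y unfolding solutions_def coord_space_def by auto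
    qed
    show finY: "finite ?Y" by (rule finite_subset[OF _ finX]) blast
  qed
  also have "\<dots> = card ?Y"
    by (rule dim_coord_space, rule finite_subset[OF _ finX]) blast
  also have "\<dots> = card ?N - k"
  proof -
    have "inj_on ((\<lambda>b. {v, b}) \<circ> h) {1..d}"
      by (rule comp_inj_on[OF bij_betw_imp_inj_on[OF h] inj_on_pair])
    then have "inj_on ((\<lambda>b. {v, b}) \<circ> h) {1..min d k}" by (rule inj_on_subset) auto
    then have "inj_on (\<lambda>i. {v, h i}) {1..min d k}" by (simp only: comp_def)
    then have "card ((\<lambda>i. {v, h i}) ` {1..min d k}) = min d k" by (simp add: card_image)
    moreover have "(\<lambda>i. {v, h i}) ` {1..min d k} \<subseteq> ?X"
      using h by (auto simp: bij_betw_def neighbours_def)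
    moreover have "card ?X = d"
      unfolding edges_at_eq[OF D] d_def by (rule card_image[OF inj_on_pair])
    moreover have "?Y = ?X - (\<lambda>i. {v, h i}) ` {1..min d k}" by auto
    ultimately have "card ?Y = d - min d k" by (simp add: card_Diff_subset)
    then show ?thesis by (simp add: d_def)
  qed
  finally show ?thesis .
qed

lemma generic_entry_nonzero:
  assumes gen: "generic_extension emb n \<alpha>" and "i \<in> {1..n}" "j \<in> {1..n}"
  shows "\<alpha> i j \<noteq> 0"
proof
  assume "\<alpha> i j = 0"
  then have "(0, 1) \<in> spec_graph emb n \<alpha> (\<lambda>i j. 1)"
    using spec_graph_entry[OF assms, of "\<lambda>i j. 1"] by simp
  then show False using specialization_spec_graph[OF gen] unfolding specialization_def by fastforce
qed

text \<open>
  Projecting from the vertex \<open>v\<close> turns the first \<open>k\<close> rows of the matrix into \<open>k - 1\<close> rows \<open>\<beta>\<close>. A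
  stress with respect to \<open>\<beta>\<close> on the neighbours of \<open>v\<close> extends uniquely to a stress on the cone.
\<close>

lemma dim_stresses_cone:
  assumes gen: "generic_extension emb n \<alpha>" and D: "D \<subseteq> subsets_of_size n 2"
    and v: "v \<in> {1..n}" and k: "k \<in> {1..n}"
  shows "ext.dim (stresses n \<alpha> {S \<in> D. S \<subseteq> neighbours D v} (k - 1)) \<le>
    ext.dim (stresses n \<alpha> {S \<in> D. S \<subseteq> neighbours D v} k) + ext.dim (row_at v ` stresses n \<alpha> D k)"
proof -
  let ?N = "neighbours D v" and ?L = "{S \<in> D. S \<subseteq> neighbours D v}"
  let ?\<alpha> = "\<alpha> k v"
  \<comment> \<open>Subtracting a multiple of row k clears column v: the points of the vertices are
    projected from the point of v.\<close>
  define \<beta> where "\<beta> i b = \<alpha> i b - \<alpha> i v / ?\<alpha> * \<alpha> k b" for i b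
  have nz: "?\<alpha> \<noteq> 0" by (rule generic_entry_nonzero[OF gen k v])
  have L: "?L \<subseteq> subsets_of_size n 2" using D by blast
  have finL: "finite ?L" and finD: "finite D"
    using finite_edge_set[OF L] finite_edge_set[OF D] by auto
  have vN: "v \<notin> ?N" by (rule not_mem_neighbours_self[OF D])
  let ?t = "\<lambda>i w c. \<Sum>b = 1..n. skew w c b * \<alpha> i b"
  \<comment> \<open>The entries of row v are forced by the equation of row k at c, where the new
    edge contributes \<open>skew (\<rho> w) c v * \<alpha> k v\<close>.\<close>
  define \<rho> :: "'b ext \<Rightarrow> 'b ext"
    where "\<rho> w S = (\<Sum>c = 1..n. if S = {v, c} then orient_sign v c * (?t k w c / ?\<alpha>) else 0)" for w S
  have \<rho>_row: "skew (\<rho> w) v c = ?t k w c / ?\<alpha>" if "c \<in> {1..n}" "c \<noteq> v" for w c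
  proof -
    have "\<rho> w {v, c} = (\<Sum>b = 1..n. if b = c then orient_sign v b * (?t k w b / ?\<alpha>) else 0)"
      unfolding \<rho>_def by (intro sum.cong) (auto simp: doubleton_eq_iff)
    then have "\<rho> w {v, c} = orient_sign v c * (?t k w c / ?\<alpha>)" using that(1) by simp
    then show ?thesis
      using orient_sign_square[of v c, where ?'a = 'b] that(2) by (simp add: skew_def mult.assoc[symmetric])
  qed
  have \<rho>_outside: "\<rho> w S = 0" if "v \<notin> S" for w S
    unfolding \<rho>_def using that by (intro sum.neutral) auto
  have t_add: "?t i (x + y) c = ?t i x c + ?t i y c" for i x y c
    by (simp only: skew_add distrib_right sum.distrib)
  have t_scale: "?t i (ext_scale a x) c = a * ?t i x c" for i a x c
    by (simp only: skew_scale mult.assoc sum_distrib_left)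
  have lin: "ext_linear \<rho>"
  proof (rule ext_linearI)
    have "\<rho> (x + y) S = \<rho> x S + \<rho> y S" for x y S
      unfolding \<rho>_def
      by (subst sum.distrib[symmetric], intro sum.cong refl)
        (simp only: t_add add_divide_distrib distrib_left split: if_split, simp)
    then show "\<rho> (x + y) = \<rho> x + \<rho> y" for x y
      by (intro HOL.ext) (simp only: plus_fun_apply)
    have "\<rho> (ext_scale a x) S = a * \<rho> x S" for a x S
      unfolding \<rho>_def
      by (subst sum_distrib_left, intro sum.cong refl) (simp only: t_scale split: if_split, simp)
    then show "\<rho> (ext_scale a x) = ext_scale a (\<rho> x)" for a x
      by (intro HOL.ext) (simp only: ext_scale_apply)
  qed
  let ?Z = "stresses n \<beta> ?L (k - 1)"
  have t_outside: "?t i w c = 0" if "w \<in> coord_space ?L" "c \<notin> ?N" for i w c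
    using that skew_not_edge[of w ?L c] by (intro sum.neutral) auto
  \<comment> \<open>Being a stress for \<beta> makes the defect in row i the multiple
    \<open>\<alpha> i v / \<alpha> k v\<close> of the defect in row k; hence one correction repairs
    all rows up to k.\<close>
  have t_\<beta>: "?t i w c = \<alpha> i v / ?\<alpha> * ?t k w c" if "w \<in> ?Z" "i \<in> {1..k}" "c \<in> {1..n}" for i w c
  proof (cases "i = k")
    case False
    then have "(\<Sum>b = 1..n. skew w c b * \<beta> i b) = 0" using that by (auto simp: stresses_def)
    then show ?thesis
      by (simp add: \<beta>_def algebra_simps sum_subtractf sum_distrib_left)
  qed (simp add: nz)
  \<comment> \<open>The projected matrix is one of the specializations of \<alpha>, so it has at
    least as many stresses.\<close>
  have "ext.dim (stresses n \<alpha> ?L (k - 1)) \<le> ext.dim ?Z"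
    using k by (intro dim_stresses_generic_le[OF gen finL]) auto
  also have "\<dots> = ext.dim {w \<in> ?Z. \<rho> w = 0} + ext.dim (\<rho> ` ?Z)"
    by (rule rank_nullity_coord_space[OF lin subspace_stresses[OF finL] stresses_subset_coord_space finL])
  \<comment> \<open>If no correction is necessary, w itself satisfies the equations of all k
    rows.\<close>
  also have "ext.dim {w \<in> ?Z. \<rho> w = 0} \<le> ext.dim (stresses n \<alpha> ?L k)"
  proof (rule dim_mono_coord_space[OF _ stresses_subset_coord_space finL], safe)
    fix w assume w: "w \<in> ?Z" "\<rho> w = 0"
    then have wL: "w \<in> coord_space ?L" by (simp add: stresses_def)
    have "?t k w c = 0" if "c \<in> {1..n}" for c
    proof (cases "c = v")
      case False
      then show ?thesis using \<rho>_row[OF that False, of w] w(2) nz by (simp add: skew_def)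
    qed (use t_outside[OF wL] vN in simp)
    then have "?t i w c = 0" if "i \<in> {1..k}" "c \<in> {1..n}" for i c
      using t_\<beta>[OF w(1) that] that(2) by simp
    then show "w \<in> stresses n \<alpha> ?L k" using wL by (simp add: stresses_def)
  qed
  \<comment> \<open>The row \<rho> w is realized by the stress w + \<rho> w of the whole
    graph.\<close>
  also have "ext.dim (\<rho> ` ?Z) \<le> ext.dim (row_at v ` stresses n \<alpha> D k)"
  proof (rule dim_mono_coord_space[OF _ _ finD])
    show "row_at v ` stresses n \<alpha> D k \<subseteq> coord_space D"
      by (auto simp: stresses_def coord_space_def row_at_def)
    show "\<rho> ` ?Z \<subseteq> row_at v ` stresses n \<alpha> D k"
    proof safe
      fix w assume w: "w \<in> ?Z"
      then have wL: "w \<in> coord_space ?L" by (simp add: stresses_def)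
      have w_v: "w S = 0" if "v \<in> S" for S
        using wL that vN by (auto simp: coord_space_def)
      have skew_v: "skew w a b = 0" if "a = v \<or> b = v" for a b
        using that w_v by (auto simp: skew_def)
      have "row_at v (w + \<rho> w) = \<rho> w"
        using w_v \<rho>_outside[of _ w] by (auto simp: row_at_def fun_eq_iff)
      moreover have "w + \<rho> w \<in> coord_space D"
      proof -
        have "\<rho> w S = 0" if "S \<notin> D" for S
          unfolding \<rho>_def
        proof (intro sum.neutral ballI)
          fix c assume "c \<in> {1..n}"
          show "(if S = {v, c} then orient_sign v c * (?t k w c / ?\<alpha>) else 0) = 0"
          proof (cases "S = {v, c}")
            case True
            then have "c \<notin> ?N" using that by (simp add: neighbours_def)
            then show ?thesis using t_outside[OF wL, of c k] by simp
          qed simp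
        qed
        then show ?thesis using wL by (simp add: coord_space_def)
      qed
      moreover have "?t i (w + \<rho> w) c = 0" if i: "i \<in> {1..k}" and c: "c \<in> {1..n}" for i c
      proof (cases "c = v")
        case False
        have "?t i (\<rho> w) c = (\<Sum>b = 1..n. if b = v then skew (\<rho> w) c v * \<alpha> i v else 0)"
        proof (rule sum.cong[OF refl])
          fix b
          show "skew (\<rho> w) c b * \<alpha> i b = (if b = v then skew (\<rho> w) c v * \<alpha> i v else 0)"
            using \<rho>_outside[of "{c, b}" w] False by (auto simp: skew_def)
        qed
        also have "\<dots> = skew (\<rho> w) c v * \<alpha> i v" using v by simp
        also have "\<dots> = - (?t k w c / ?\<alpha>) * \<alpha> i v"
          unfolding skew_swap[of _ c v] \<rho>_row[OF c False] by simp
        finally show ?thesis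
          unfolding t_add t_\<beta>[OF w i c] by simp
      next
        case True
        \<comment> \<open>The equation at v is left. It asks for the form to vanish on
          \<open>\<alpha> i\<close> and \<open>\<alpha> k\<close>, which \<open>t_\<beta>\<close>
          reduces to the value on \<open>\<alpha> k\<close> and \<open>\<alpha> k\<close>.\<close>
        have "?t i (\<rho> w) v = (\<Sum>b = 1..n. ?t k w b / ?\<alpha> * \<alpha> i b)"
        proof (rule sum.cong[OF refl])
          fix b assume b: "b \<in> {1..n}"
          show "skew (\<rho> w) v b * \<alpha> i b = ?t k w b / ?\<alpha> * \<alpha> i b"
          proof (cases "b = v")
            case True
            then show ?thesis using t_outside[OF wL vN, of k] by (simp add: skew_self)
          next
            case False
            then show ?thesis by (simp add: \<rho>_row[OF b])
          qed
        qed
        also have "\<dots> = (\<Sum>b = 1..n. \<alpha> i b * ?t k w b * inverse ?\<alpha>)"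
          by (intro sum.cong refl) (simp only: divide_inverse mult_ac)
        also have "\<dots> = skew_form n w (\<alpha> i) (\<alpha> k) * inverse ?\<alpha>"
          by (simp only: skew_form_left sum_distrib_right)
        also have "skew_form n w (\<alpha> i) (\<alpha> k) = - skew_form n w (\<alpha> k) (\<alpha> i)"
          by (rule skew_form_swap)
        also have "skew_form n w (\<alpha> k) (\<alpha> i) = (\<Sum>b = 1..n. \<alpha> k b * (\<alpha> i v / ?\<alpha> * ?t k w b))"
          unfolding skew_form_left by (intro sum.cong refl) (simp only: t_\<beta>[OF w i])
        also have "\<dots> = \<alpha> i v / ?\<alpha> * skew_form n w (\<alpha> k) (\<alpha> k)"
          by (simp only: skew_form_left sum_distrib_left mult.left_commute)
        also have "\<dots> = 0" by (simp add: skew_form_self)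
        finally have "?t i (\<rho> w) v = 0" by simp
        moreover have "?t i w v = 0" by (rule t_outside[OF wL vN])
        ultimately show ?thesis unfolding True t_add by simp
      qed
      ultimately show "\<rho> w \<in> row_at v ` stresses n \<alpha> D k"
        unfolding stresses_def by (intro image_eqI[of _ _ "w + \<rho> w"]) auto
    qed
  qed
  finally show ?thesis by simp
qed

section \<open>Summation over all orders of stresses\<close>

lemma dim_stresses_0:
  assumes "finite D"
  shows "ext.dim (stresses n \<beta> D 0) = card D"
  using dim_coord_space[OF assms] by (simp add: stresses_def)

lemma dim_stresses_full:
  assumes gen: "generic_extension emb n \<alpha>" and D: "D \<subseteq> subsets_of_size n 2"
  shows "ext.dim (stresses n \<alpha> D n) = 0"
proof -
  have "{S \<in> subsets_of_size n 2. Min S \<le> n} = subsets_of_size n 2"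
  proof -
    have "Min S \<le> n" if S: "S \<in> subsets_of_size n 2" for S
    proof -
      have "finite S" "S \<noteq> {}" using S finite_if_subset_atLeastAtMost by (auto simp: subsets_of_size_def)
      then have "Min S \<in> S" by simp
      then show ?thesis using S by (auto simp: subsets_of_size_def)
    qed
    then show ?thesis by blast
  qed
  moreover have "faces n D 2 = D" using D by (auto simp: faces_def subsets_of_size_def)
  ultimately have "stresses n \<alpha> D n \<subseteq> {0}"
    using generic_basis_solutions_trivial[OF gen, of _ D 2]
    unfolding stresses_eq_solutions_generic_basis[OF gen D order_refl] by auto
  then have "ext.dim (stresses n \<alpha> D n) \<le> card ({} :: 'b ext set)"
    by (intro ext.dim_le_card) auto
  then show ?thesis by simp
qed

lemma sum_shift_telescope:
  fixes z :: "nat \<Rightarrow> nat"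
  shows "(\<Sum>k = 1..n. z (k - 1)) + z n = z 0 + (\<Sum>k = 1..n. z k)"
  by (induction n) auto

text \<open>In the telescoping sum the end k = 0 contributes all edge weightings of the
  neighbourhood. The end k = n contributes 0, because a stress of order n is killed by a nonsingular
  matrix.\<close>

lemma sum_dim_stresses_delete:
  assumes gen: "generic_extension emb n \<alpha>" and D: "D \<subseteq> subsets_of_size n 2" and v: "v \<in> {1..n}"
  shows "(\<Sum>k = 1..n. ext.dim (stresses n \<alpha> (delete_vertex D v) k)) +
      card {S \<in> D. S \<subseteq> neighbours D v} \<le> (\<Sum>k = 1..n. ext.dim (stresses n \<alpha> D k))"
proof -
  let ?L = "{S \<in> D. S \<subseteq> neighbours D v}"
  let ?z = "\<lambda>k. ext.dim (stresses n \<alpha> ?L k)" and ?r = "\<lambda>k. ext.dim (row_at v ` stresses n \<alpha> D k)"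
  have L: "?L \<subseteq> subsets_of_size n 2" using D by blast
  have "(\<Sum>k = 1..n. ?z (k - 1)) \<le> (\<Sum>k = 1..n. ?z k + ?r k)"
    by (rule sum_mono) (rule dim_stresses_cone[OF gen D v])
  then have "?z 0 \<le> (\<Sum>k = 1..n. ?r k)"
    using sum_shift_telescope[of ?z n] dim_stresses_full[OF gen L] by (simp add: sum.distrib)
  then show ?thesis
    using dim_stresses_0[OF finite_edge_set[OF L], where \<beta> = \<alpha> and n = n]
    by (simp add: dim_stresses_delete[OF D, where \<beta> = \<alpha> and v = v] sum.distrib)
qed

lemma dim_stresses_delete_le:
  assumes "generic_extension emb n \<alpha>" "D \<subseteq> subsets_of_size n 2" "v \<in> {1..n}" "k \<le> n"
  shows "ext.dim (stresses n \<alpha> D k) \<le>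
    ext.dim (stresses n \<alpha> (delete_vertex D v) k) + (card (neighbours D v) - k)"
  using dim_row_at_le[OF assms] dim_stresses_delete[OF assms(2), where \<beta> = \<alpha> and k = k and v = v]
  by simp

text \<open>The pairs with minimum at most k form an initial segment of the lexicographic order, and
  their equations are the ones that define stresses of order k.\<close>

lemma dim_stresses_eq_card_shift:
  assumes gen: "generic_extension emb n \<alpha>" and k: "k \<le> n"
  shows "ext.dim (stresses n \<alpha> (faces n \<Delta> 2) k) =
    card {S \<in> exterior_shift \<alpha> n \<Delta>. card S = 2 \<and> k < Min S}"
proof -
  have D: "faces n \<Delta> 2 \<subseteq> subsets_of_size n 2" by (auto simp: faces_def subsets_of_size_def)
  let ?Q = "{S \<in> subsets_of_size n 2. Min S \<le> k}"
  have "R \<in> ?Q" if S: "S \<in> ?Q" and R: "R \<in> subsets_of_size n 2" and lex: "lex_before R S" for R S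
  proof -
    have fin: "finite R" "finite S" "S \<noteq> {}"
      using R S finite_if_subset_atLeastAtMost by (auto simp: subsets_of_size_def)
    obtain m where m: "m \<in> R" "\<And>j. j < m \<Longrightarrow> j \<in> R \<longleftrightarrow> j \<in> S"
      using lex unfolding lex_before_def by blast
    have "Min R \<le> Min S"
    proof (cases "Min S < m")
      case True
      then have "Min S \<in> R" using m(2) fin by simp
      then show ?thesis by (rule Min_le[OF fin(1)])
    next
      case False
      then show ?thesis using Min_le[OF fin(1) m(1)] by simp
    qed
    then show ?thesis using S R by simp
  qed
  then have "ext.dim (stresses n \<alpha> (faces n \<Delta> 2) k) =
      card {S \<in> exterior_shift \<alpha> n \<Delta>. card S = 2 \<and> S \<notin> ?Q}"
    unfolding stresses_eq_solutions_generic_basis[OF gen D k]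
    by (intro dim_solutions_lex_initial[OF gen]) auto
  also have "{S \<in> exterior_shift \<alpha> n \<Delta>. card S = 2 \<and> S \<notin> ?Q} =
      {S \<in> exterior_shift \<alpha> n \<Delta>. card S = 2 \<and> k < Min S}"
    by (auto simp: exterior_shift_def subsets_of_size_def)
  finally show ?thesis .
qed

section \<open>Simplicial vertices of chordal graphs\<close>

definition walk_through :: "'a set set \<Rightarrow> 'a set \<Rightarrow> 'a \<Rightarrow> 'a \<Rightarrow> (nat \<Rightarrow> 'a) \<Rightarrow> nat \<Rightarrow> bool" where
  "walk_through D C s t p m \<longleftrightarrow> p 0 = s \<and> p m = t \<and> (\<forall>i<m. {p i, p (Suc i)} \<in> D) \<and>
     (\<forall>i. 0 < i \<and> i < m \<longrightarrow> p i \<in> C)"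

text \<open>A repeated vertex or a chord would give a shortcut whose interior still lies in
  C.\<close>

lemma shortest_walk_induced:
  assumes "walk_through D C s t p m"
    and min: "\<And>q l. walk_through D C s t q l \<Longrightarrow> m \<le> l"
    and ij: "i < j" "j \<le> m"
  shows "p i \<noteq> p j" and "{p i, p j} \<in> D \<Longrightarrow> j = Suc i"
proof -
  have p: "p 0 = s" "p m = t" "\<And>l. l < m \<Longrightarrow> {p l, p (Suc l)} \<in> D"
    "\<And>l. 0 < l \<Longrightarrow> l < m \<Longrightarrow> p l \<in> C"
    using assms(1) by (auto simp: walk_through_def)
  show "p i \<noteq> p j"
  proof
    assume eq: "p i = p j"
    let ?q = "\<lambda>l. if l \<le> i then p l else p (l + (j - i))"
    have "walk_through D C s t ?q (m - (j - i))"
      unfolding walk_through_def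
    proof (intro conjI allI impI)
      show "?q (m - (j - i)) = t" using ij eq p(2) by (cases "j = m") auto
      fix l assume l: "l < m - (j - i)"
      consider "l < i" | "l = i" | "i < l" by linarith
      then show "{?q l, ?q (Suc l)} \<in> D"
      proof cases
        case 1
        then show ?thesis using p(3)[of l] ij by simp
      next
        case 2
        then have "l + (j - i) = j" "Suc l + (j - i) = Suc j" "j < m" using ij l by auto
        then show ?thesis using p(3)[of j] eq 2 by simp
      next
        case 3
        then show ?thesis using p(3)[of "l + (j - i)"] l by simp
      qed
    next
      fix l assume "0 < l \<and> l < m - (j - i)"
      then show "?q l \<in> C" using p(4)[of l] p(4)[of "l + (j - i)"] ij by auto
    qed (use p(1) in simp)
    then show False using min[of ?q "m - (j - i)"] ij by simp
  qed
  show "j = Suc i" if edge: "{p i, p j} \<in> D"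
  proof (rule ccontr)
    assume ne: "j \<noteq> Suc i"
    \<comment> \<open>The chord itself takes one step, so only j - i - 1 steps are saved.\<close>
    let ?d = "j - i - 1"
    let ?q = "\<lambda>l. if l \<le> i then p l else p (l + ?d)"
    have "walk_through D C s t ?q (m - ?d)"
      unfolding walk_through_def
    proof (intro conjI allI impI)
      have "\<not> m - ?d \<le> i" "m - ?d + ?d = m" using ij by auto
      then show "?q (m - ?d) = t" using p(2) by simp
      fix l assume l: "l < m - ?d"
      consider "l < i" | "l = i" | "i < l" by linarith
      then show "{?q l, ?q (Suc l)} \<in> D"
      proof cases
        case 1
        then show ?thesis using p(3)[of l] ij by simp
      next
        case 2
        then have "Suc l + ?d = j" using ij ne by auto
        then show ?thesis using edge 2 by simp
      next
        case 3
        then show ?thesis using p(3)[of "l + ?d"] l by simp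
      qed
    next
      fix l assume "0 < l \<and> l < m - ?d"
      then show "?q l \<in> C" using p(4)[of l] p(4)[of "l + ?d"] ij by auto
    qed (use p(1) in simp)
    then show False using min[of ?q "m - ?d"] ij ne by simp
  qed
qed

text \<open>A shortest walk from s to t through C is an induced path with at least 2 edges, and x is
  adjacent to its ends only. Closing the path at x gives an induced cycle of length at least
  4.\<close>

lemma chordal_no_walk_around:
  assumes ch: "chordal W D" and edges: "\<And>e. e \<in> D \<Longrightarrow> card e = 2"
    and W: "insert x (insert s (insert t C)) \<subseteq> W" and st: "s \<noteq> t" "{s, t} \<notin> D"
    and x: "{x, s} \<in> D" "{x, t} \<in> D" "x \<notin> C" "\<And>c. c \<in> C \<Longrightarrow> {x, c} \<notin> D"
  shows "\<not> walk_through D C s t p m"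
proof
  assume "walk_through D C s t p m"
  then have ex: "\<exists>m p. walk_through D C s t p m" by blast
  define M where "M = (LEAST m. \<exists>p. walk_through D C s t p m)"
  obtain q where q: "walk_through D C s t q M"
    using LeastI_ex[OF ex] unfolding M_def by blast
  have min: "M \<le> l" if "walk_through D C s t r l" for r l
    unfolding M_def by (rule Least_le) (use that in blast)
  have induced: "i < j \<Longrightarrow> j \<le> M \<Longrightarrow> q i \<noteq> q j"
    "i < j \<Longrightarrow> j \<le> M \<Longrightarrow> {q i, q j} \<in> D \<Longrightarrow> j = Suc i" for i j
    using shortest_walk_induced[OF q, of i j] min by auto
  have q': "q 0 = s" "q M = t" "\<And>l. l < M \<Longrightarrow> {q l, q (Suc l)} \<in> D"
    "\<And>l. 0 < l \<Longrightarrow> l < M \<Longrightarrow> q l \<in> C"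
    using q by (auto simp: walk_through_def)
  have "M \<noteq> 0" using q'(1,2) st(1) by (intro notI) simp
  moreover have "M \<noteq> 1" using q'(1,2) q'(3)[of 0] st(2) by (intro notI) simp
  ultimately have M2: "2 \<le> M" by simp
  \<comment> \<open>The cycle consists of the M + 1 vertices of the walk and of x.\<close>
  define k where "k = M + 2"
  define c where "c i = (if i \<le> M then q i else x)" for i
  have "x \<noteq> s" "x \<noteq> t" using edges[OF x(1)] edges[OF x(2)] by auto
  have q_cases: "q i = s \<and> i = 0 \<or> q i = t \<and> i = M \<or> q i \<in> C" if "i \<le> M" for i
    using q'(1,2) q'(4)[of i] that by (cases "i = 0"; cases "i = M") auto
  have qx: "q i \<noteq> x" if "i \<le> M" for i
    using q_cases[OF that] \<open>x \<noteq> s\<close> \<open>x \<noteq> t\<close> x(3) by auto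
  have inj: "c i \<noteq> c j" if "i < j" "j < k" for i j
    using that induced(1)[OF that(1)] qx[of i] by (auto simp: c_def k_def)
  have "inj_on c {..<k}"
  proof (rule inj_onI)
    fix i j assume "i \<in> {..<k}" "j \<in> {..<k}" "c i = c j"
    then show "i = j" using inj[of i j] inj[of j i] by (cases i j rule: linorder_cases) auto
  qed
  then have bij: "bij_betw c {..<k} (c ` {..<k})" by (simp add: bij_betw_def)
  have "c ` {..<k} \<subseteq> W"
  proof
    fix y assume "y \<in> c ` {..<k}"
    then obtain i where "y = c i" by blast
    then show "y \<in> W" using q_cases[of i] W by (cases "i \<le> M") (auto simp: c_def)
  qed
  have succ: "c (Suc i mod k) = (if i < M then q (Suc i) else if i = M then x else s)" if "i < k" for i
    using that M2 q'(1) by (auto simp: c_def k_def not_less mod_Suc)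
  have "induced_edges D (c ` {..<k}) = {{c i, c (Suc i mod k)} | i. i < k}"
  proof (intro equalityI subsetI)
    fix e assume "e \<in> induced_edges D (c ` {..<k})"
    then have e: "e \<in> D" "e \<subseteq> c ` {..<k}" by (auto simp: induced_edges_def)
    then obtain a b where ab: "e = {a, b}" "a \<noteq> b" using edges[OF e(1)] by (auto simp: card_2_iff)
    then obtain i0 j0 where "a = c i0" "b = c j0" "i0 < k" "j0 < k" using e(2) by auto
    then obtain i j where ij: "e = {c i, c j}" "i < j" "j < k"
      using ab by (metis insert_commute linorder_neqE_nat)
    show "e \<in> {{c i, c (Suc i mod k)} | i. i < k}"
    proof (cases "j \<le> M")
      case True
      then have "{q i, q j} \<in> D" using e(1) ij by (simp add: c_def)
      then have j: "j = Suc i" using induced(2)[OF ij(2) True] by blast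
      then have "c (Suc i mod k) = c j" using ij(3) by simp
      then show ?thesis using ij by (intro CollectI exI[of _ i]) simp
    next
      case False
      then have cj: "j = Suc M" "c j = x" using ij(3) by (auto simp: c_def k_def)
      have iM: "i \<le> M" using ij(2) cj(1) by simp
      then have "{x, q i} \<in> D" using e(1) ij(1) cj(2) by (simp add: c_def insert_commute)
      then have "q i \<notin> C" using x(4) by blast
      then consider "i = 0" | "i = M" using q_cases[OF iM] by blast
      then show ?thesis
      proof cases
        case 1
        have "e = {c j, c (Suc j mod k)}"
          using ij(1) 1 succ[OF ij(3)] cj q'(1) by (simp add: c_def insert_commute)
        then show ?thesis using ij(3) by blast
      next
        case 2
        have "e = {c M, c (Suc M mod k)}"
          using ij(1) 2 cj succ[of M] by (simp add: k_def)
        then show ?thesis by (intro CollectI exI[of _ M]) (simp add: k_def)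
      qed
    qed
  next
    fix e assume "e \<in> {{c i, c (Suc i mod k)} | i. i < k}"
    then obtain i where i: "e = {c i, c (Suc i mod k)}" "i < k" by blast
    have "k > 0" using M2 by (simp add: k_def)
    then have "e \<subseteq> c ` {..<k}" using i by auto
    moreover have "e \<in> D"
    proof -
      consider "i < M" | "i = M" | "i = Suc M" using i(2) k_def by linarith
      then show ?thesis
      proof cases
        case 1
        then show ?thesis using i(1) succ[OF i(2)] q'(3)[of i] by (simp add: c_def)
      next
        case 2
        then show ?thesis using i(1) succ[OF i(2)] q'(2) x(2) by (simp add: c_def insert_commute)
      next
        case 3
        then show ?thesis using i(1) succ[OF i(2)] x(1) by (simp add: c_def)
      qed
    qed
    ultimately show "e \<in> induced_edges D (c ` {..<k})" by (simp add: induced_edges_def)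
  qed
  then have "is_cycle k (c ` {..<k}) (induced_edges D (c ` {..<k}))"
    unfolding is_cycle_def using bij M2 k_def by auto
  then have "k = 3" using ch \<open>c ` {..<k} \<subseteq> W\<close> unfolding chordal_def by blast
  then show False using M2 k_def by simp
qed

section \<open>Dirac's theorem on simplicial vertices\<close>

definition simplicial :: "'a set \<Rightarrow> 'a set set \<Rightarrow> 'a \<Rightarrow> bool" where
  "simplicial W D v \<longleftrightarrow> (\<forall>a\<in>W. \<forall>b\<in>W. {v, a} \<in> D \<longrightarrow> {v, b} \<in> D \<longrightarrow> a \<noteq> b \<longrightarrow> {a, b} \<in> D)"

lemma chordal_subset: "chordal W D \<Longrightarrow> U \<subseteq> W \<Longrightarrow> chordal U D"
  unfolding chordal_def by (meson subset_trans)

text \<open>The second half, a simplicial vertex among the non-neighbours of x, is what makes the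
  induction work. C is the component of y among the non-neighbours of x, and S consists of the
  neighbours of x that are adjacent to C. All neighbours in W of a vertex of C lie in C \<union> S,
  so a vertex of C that is simplicial in C \<union> S is simplicial in W.\<close>

lemma chordal_simplicial_non_neighbour:
  assumes "finite W" "chordal W D" and edges: "\<And>e. e \<in> D \<Longrightarrow> card e = 2"
  shows "(W \<noteq> {} \<longrightarrow> (\<exists>v\<in>W. simplicial W D v)) \<and>
    (\<forall>x\<in>W. \<forall>y\<in>W. x \<noteq> y \<longrightarrow> {x, y} \<notin> D \<longrightarrow>
       (\<exists>v\<in>W. v \<noteq> x \<and> {x, v} \<notin> D \<and> simplicial W D v))"
  using assms(1,2)
proof (induction W rule: finite_psubset_induct)
  case (psubset W)
  have far: "\<exists>v\<in>W. v \<noteq> x \<and> {x, v} \<notin> D \<and> simplicial W D v"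
    if xy: "x \<in> W" "y \<in> W" "x \<noteq> y" "{x, y} \<notin> D" for x y
  proof -
    define R where "R = {u \<in> W. u \<noteq> x \<and> {x, u} \<notin> D}"
    define r where "r = {(a, b). a \<in> R \<and> b \<in> R \<and> {a, b} \<in> D}"
    define C where "C = {u. (y, u) \<in> r\<^sup>*}"
    define S where "S = {s \<in> W. {x, s} \<in> D \<and> (\<exists>c\<in>C. {s, c} \<in> D)}"
    have yR: "y \<in> R" using xy by (auto simp: R_def)
    have CR: "C \<subseteq> R"
    proof
      fix u assume "u \<in> C"
      then have "(y, u) \<in> r\<^sup>*" by (simp add: C_def)
      then show "u \<in> R" by (induction rule: rtrancl_induct) (use yR in \<open>auto simp: r_def\<close>)
    qed
    have yC: "y \<in> C" by (simp add: C_def)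
    have nbr: "b \<in> C \<union> S" if "c \<in> C" "b \<in> W" "{c, b} \<in> D" for b c
    proof (cases "b \<in> R")
      case True
      then have "(c, b) \<in> r" using that CR by (auto simp: r_def)
      then have "(y, b) \<in> r\<^sup>*" using that(1) by (simp add: C_def rtrancl.rtrancl_into_rtrancl)
      then show ?thesis by (simp add: C_def)
    next
      case False
      have "{x, c} \<notin> D" using that(1) CR by (auto simp: R_def)
      then have "b \<noteq> x" using that(3) by (auto simp: insert_commute)
      then have "{x, b} \<in> D" using False that(2) by (auto simp: R_def)
      then show ?thesis using that by (auto simp: S_def insert_commute)
    qed
    have sym: "sym (r\<^sup>*)"
      by (rule sym_rtrancl) (auto simp: sym_def r_def insert_commute)
    \<comment> \<open>Two non-adjacent members of S would be joined by a walk through C, while x is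
      adjacent to both of them and to nothing in C.\<close>
    have S_clique: "{s, t} \<in> D" if st: "s \<in> S" "t \<in> S" "s \<noteq> t" for s t
    proof (rule ccontr)
      assume nst: "{s, t} \<notin> D"
      obtain c d where c: "c \<in> C" "{s, c} \<in> D" and d: "d \<in> C" "{t, d} \<in> D"
        using st unfolding S_def by blast
      have "(c, y) \<in> r\<^sup>*" using symD[OF sym] c(1) by (auto simp: C_def)
      then have "(c, d) \<in> r\<^sup>*" using d(1) unfolding C_def by (auto intro: rtrancl_trans)
      then obtain k where "(c, d) \<in> r ^^ k" using rtrancl_imp_relpow by blast
      then obtain f where f: "f 0 = c" "f k = d" "\<And>i. i < k \<Longrightarrow> (f i, f (Suc i)) \<in> r"
        unfolding relpow_fun_conv by blast
      have fC: "f i \<in> C" if "i \<le> k" for i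
        using that
      proof (induction i)
        case (Suc i)
        then have "(y, f i) \<in> r\<^sup>*" "(f i, f (Suc i)) \<in> r" using f(3) by (auto simp: C_def)
        then show ?case by (simp add: C_def rtrancl.rtrancl_into_rtrancl)
      qed (use f(1) c(1) in simp)
      define p where "p i = (if i = 0 then s else if i \<le> Suc k then f (i - 1) else t)" for i
      have "walk_through D C s t p (k + 2)"
        unfolding walk_through_def
      proof (intro conjI allI impI)
        fix i assume "i < k + 2"
        then consider "i = 0" | "0 < i" "i \<le> k" | "i = Suc k" by linarith
        then show "{p i, p (Suc i)} \<in> D"
        proof cases
          case 1
          then show ?thesis using c f(1) by (simp add: p_def)
        next
          case 2
          then have "(f (i - 1), f (Suc (i - 1))) \<in> r" by (intro f(3)) simp
          then show ?thesis using 2 by (simp add: p_def r_def)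
        next
          case 3
          then show ?thesis using d f(2) by (simp add: p_def insert_commute)
        qed
      next
        fix i assume "0 < i \<and> i < k + 2"
        then show "p i \<in> C" using fC[of "i - 1"] by (auto simp: p_def)
      qed (simp_all add: p_def)
      moreover have "\<not> walk_through D C s t p (k + 2)"
      proof (rule chordal_no_walk_around[OF psubset.prems edges _ st(3) nst])
        show "insert x (insert s (insert t C)) \<subseteq> W"
          using xy(1) st CR by (auto simp: S_def R_def)
        show "{x, s} \<in> D" "{x, t} \<in> D" using st by (auto simp: S_def)
        show "x \<notin> C" using CR by (auto simp: R_def)
        show "{x, c} \<notin> D" if "c \<in> C" for c using that CR by (auto simp: R_def)
      qed
      ultimately show False by blast
    qed
    have lift: "\<exists>v\<in>W. v \<noteq> x \<and> {x, v} \<notin> D \<and> simplicial W D v"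
      if v: "v \<in> C" "simplicial (C \<union> S) D v" for v
    proof
      show "v \<in> W" using v(1) CR by (auto simp: R_def)
      have "simplicial W D v"
        using v(2) nbr[OF v(1)] unfolding simplicial_def by blast
      then show "v \<noteq> x \<and> {x, v} \<notin> D \<and> simplicial W D v"
        using v(1) CR by (auto simp: R_def)
    qed
    have xU: "x \<notin> C \<union> S"
      using CR edges[of "{x, x}"] by (auto simp: R_def S_def)
    have UW: "C \<union> S \<subseteq> W" using CR by (auto simp: R_def S_def)
    show ?thesis
    \<comment> \<open>If some s in S has a non-neighbour, the induction hypothesis for s yields a
      simplicial vertex not adjacent to s, hence outside the clique S. Otherwise S is joined to
      everything, and a simplicial vertex of C serves.\<close>
    proof (cases "\<exists>s\<in>S. \<exists>u\<in>C \<union> S. s \<noteq> u \<and> {s, u} \<notin> D")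
      case True
      then obtain s u where su: "s \<in> S" "u \<in> C \<union> S" "s \<noteq> u" "{s, u} \<notin> D" by blast
      have "C \<union> S \<subset> W" using UW xU xy(1) by blast
      then have "\<exists>v\<in>C \<union> S. v \<noteq> s \<and> {s, v} \<notin> D \<and> simplicial (C \<union> S) D v"
        using psubset.IH[of "C \<union> S"] chordal_subset[OF psubset.prems UW] su by blast
      then obtain v where v: "v \<in> C \<union> S" "v \<noteq> s" "{s, v} \<notin> D" "simplicial (C \<union> S) D v" by blast
      then have "v \<in> C" using S_clique[OF su(1)] by blast
      then show ?thesis using lift v(4) by blast
    next
      case False
      have CW: "C \<subseteq> W" "C \<subset> W" using UW xU xy(1) by auto
      then obtain v where v: "v \<in> C" "simplicial C D v"
        using psubset.IH[of C] chordal_subset[OF psubset.prems CW(1)] yC by blast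
      have "simplicial (C \<union> S) D v"
        unfolding simplicial_def
      proof (intro ballI impI)
        fix a b assume ab: "a \<in> C \<union> S" "b \<in> C \<union> S" "{v, a} \<in> D" "{v, b} \<in> D" "a \<noteq> b"
        show "{a, b} \<in> D"
        proof (cases "a \<in> S \<or> b \<in> S")
          case True
          then show ?thesis using False ab by (metis insert_commute)
        next
          case False
          then show ?thesis using v(2) ab unfolding simplicial_def by blast
        qed
      qed
      then show ?thesis using lift v(1) by blast
    qed
  qed
  have "\<exists>v\<in>W. simplicial W D v" if "W \<noteq> {}"
  proof (cases "\<exists>x\<in>W. \<exists>y\<in>W. x \<noteq> y \<and> {x, y} \<notin> D")
    case True
    then show ?thesis using far by blast
  next
    case False
    then have "simplicial W D v" for v unfolding simplicial_def by blast
    then show ?thesis using that by blast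
  qed
  then show ?case using far by blast
qed

lemma chordal_simplicial_vertex:
  assumes "finite W" "chordal W D" "\<And>e. e \<in> D \<Longrightarrow> card e = 2" "W \<noteq> {}"
  obtains v where "v \<in> W" "simplicial W D v"
  using chordal_simplicial_non_neighbour[OF assms(1-3)] assms(4) by blast

section \<open>Counting cliques\<close>

definition cliques :: "'a set \<Rightarrow> 'a set set \<Rightarrow> nat \<Rightarrow> 'a set set" where
  "cliques V D s = {S. S \<subseteq> V \<and> card S = s \<and> (\<forall>a\<in>S. \<forall>b\<in>S. a \<noteq> b \<longrightarrow> {a, b} \<in> D)}"

lemma finite_cliques: "finite V \<Longrightarrow> finite (cliques V D s)"
  unfolding cliques_def by (rule finite_subset[of _ "Pow V"]) auto

text \<open>The cliques through v correspond to the cliques in its neighbourhood. Only the edges at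
  v are deleted, v stays in V and {v} remains a clique with 1 vertex; hence the bound 1 \<le>
  s.\<close>

lemma card_cliques_delete:
  assumes V: "finite V" "v \<in> V" and edges: "\<And>e. e \<in> D \<Longrightarrow> card e = 2" and s: "1 \<le> s"
  shows "card (cliques V D (Suc s)) = card (cliques V (delete_vertex D v) (Suc s)) +
    card {T \<in> cliques V D s. T \<subseteq> neighbours D v}"
proof -
  let ?A = "cliques V (delete_vertex D v) (Suc s)" and ?B = "{T \<in> cliques V D s. T \<subseteq> neighbours D v}"
  have vN: "v \<notin> neighbours D v" using edges by (force simp: neighbours_def)
  have v_notin: "v \<notin> S" if S: "S \<in> ?A" for S
  proof
    assume "v \<in> S"
    have cS: "card S = Suc s" and cl: "\<And>b. b \<in> S \<Longrightarrow> v \<noteq> b \<Longrightarrow> {v, b} \<in> delete_vertex D v"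
      using S \<open>v \<in> S\<close> by (auto simp: cliques_def)
    have "\<not> S \<subseteq> {v}"
    proof
      assume "S \<subseteq> {v}"
      then have "card S \<le> card {v}" by (rule card_mono[rotated]) simp
      then show False using cS s by simp
    qed
    then obtain b where "b \<in> S" "b \<noteq> v" by blast
    then have "{v, b} \<in> delete_vertex D v" using cl by simp
    then show False by (simp add: delete_vertex_def)
  qed
  have eq: "cliques V D (Suc s) = ?A \<union> insert v ` ?B"
  proof (intro equalityI subsetI)
    fix S assume S: "S \<in> cliques V D (Suc s)"
    then have fin: "finite S" using V(1) finite_subset by (auto simp: cliques_def)
    show "S \<in> ?A \<union> insert v ` ?B"
    proof (cases "v \<in> S")
      case True
      have "S - {v} \<in> ?B"
        using S True fin by (auto simp: cliques_def neighbours_def card_Diff_singleton)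
      moreover have "S = insert v (S - {v})" using True by auto
      ultimately show ?thesis by blast
    next
      case False
      then have "S \<in> ?A" using S by (auto simp: cliques_def delete_vertex_def)
      then show ?thesis by blast
    qed
  next
    fix S assume "S \<in> ?A \<union> insert v ` ?B"
    then show "S \<in> cliques V D (Suc s)"
    proof
      assume "S \<in> ?A"
      then show ?thesis by (auto simp: cliques_def delete_vertex_def)
    next
      assume "S \<in> insert v ` ?B"
      then obtain T where T: "T \<in> ?B" "S = insert v T" by blast
      have "finite T" using T(1) V(1) finite_subset by (auto simp: cliques_def)
      moreover have "v \<notin> T" using T(1) vN by blast
      moreover have "{v, b} \<in> D" "{b, v} \<in> D" if "b \<in> T" for b
        using T(1) that by (auto simp: neighbours_def insert_commute)
      ultimately show ?thesis using T V(2) by (auto simp: cliques_def)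
    qed
  qed
  have disj: "?A \<inter> insert v ` ?B = {}" using v_notin by blast
  have inj: "inj_on (insert v) ?B"
  proof (rule inj_onI)
    fix T U assume "T \<in> ?B" "U \<in> ?B" "insert v T = insert v U"
    moreover have "v \<notin> T" "v \<notin> U" using \<open>T \<in> ?B\<close> \<open>U \<in> ?B\<close> vN by auto
    ultimately show "T = U" by (simp add: insert_ident)
  qed
  have fin: "finite ?A" "finite ?B" using finite_cliques[OF V(1)] by auto
  show ?thesis
    unfolding eq by (subst card_Un_disjoint) (use fin disj card_image[OF inj] in auto)
qed

section \<open>Binomial sums and the clique numbers of chordal graphs\<close>

text \<open>The hockey-stick identity, with summation range 1..n independent of m so that it can be
  interchanged with a sum over edges.\<close>

lemma sum_choose_diff:
  assumes "m \<le> n"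
  shows "(\<Sum>k = 1..n. if k \<le> m then (k - 1) choose t else 0) = m choose Suc t"
  using assms
proof (induction m)
  case 0
  then show ?case by (simp add: sum.neutral)
next
  case (Suc m)
  have "(\<Sum>k = 1..n. if k \<le> Suc m then (k - 1) choose t else 0) =
      (\<Sum>k = 1..n. (if k \<le> m then (k - 1) choose t else 0) + (if k = Suc m then m choose t else 0))"
    by (intro sum.cong) auto
  also have "\<dots> = (m choose Suc t) + (m choose t)"
    using Suc by (simp add: sum.distrib)
  finally show ?case by simp
qed

text \<open>The hockey-stick identity summed once more: passing from d to d + 1 raises the factor d
  - k by 1 exactly for k \<le> d.\<close>

lemma sum_choose_times_diff:
  assumes "d \<le> n"
  shows "(\<Sum>k = 1..n. ((k - 1) choose t) * (d - k)) = d choose (t + 2)"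
  using assms
proof (induction d)
  case (Suc d)
  have "(\<Sum>k = 1..n. ((k - 1) choose t) * (Suc d - k)) =
      (\<Sum>k = 1..n. ((k - 1) choose t) * (d - k) + (if k \<le> d then (k - 1) choose t else 0))"
    by (intro sum.cong) (auto simp: Suc_diff_le)
  also have "\<dots> = (d choose (t + 2)) + (d choose Suc t)"
    using Suc sum_choose_diff[of d n t] by (simp add: sum.distrib)
  finally show ?case by simp
qed simp

text \<open>A simplicial vertex is split off: the weighted bound for the loss equals the number of
  cliques with t + 2 vertices in its neighbourhood, which is itself a clique. W shrinks with each
  deletion, while n and the matrix stay fixed.\<close>

lemma weighted_stresses_chordal:
  assumes gen: "generic_extension emb n \<alpha>"
    and "W \<subseteq> {1..n}" "D \<subseteq> subsets_of_size n 2" "\<And>e. e \<in> D \<Longrightarrow> e \<subseteq> W" "chordal W D"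
  shows "(\<Sum>k = 1..n. ((k - 1) choose t) * ext.dim (stresses n \<alpha> D k)) \<le> card (cliques {1..n} D (t + 3))"
proof -
  have "finite W" using assms(2) finite_if_subset_atLeastAtMost by blast
  then show ?thesis
    using assms(2-5)
  proof (induction W arbitrary: D rule: finite_psubset_induct)
    case (psubset W)
    note D = psubset.prems(2)
    have edges: "card e = 2" if "e \<in> D" for e using that D by (auto simp: subsets_of_size_def)
    show ?case
    proof (cases "W = {}")
      case True
      then have "D = {}" using psubset.prems(3) edges by fastforce
      have "ext.dim (stresses n \<alpha> D k) \<le> ext.dim (coord_space D :: 'b ext set)" for k
        by (rule dim_mono_coord_space[OF stresses_subset_coord_space subset_refl])
          (simp add: \<open>D = {}\<close>)
      then have "ext.dim (stresses n \<alpha> D k) = 0" for k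
        using dim_coord_space[of D, where ?'k = 'b] by (simp add: \<open>D = {}\<close>)
      then show ?thesis by simp
    next
      case False
      then obtain v where v: "v \<in> W" "simplicial W D v"
        using chordal_simplicial_vertex[OF psubset.hyps(1) psubset.prems(4) edges] by blast
      then have vn: "v \<in> {1..n}" using psubset.prems(1) by blast
      let ?D = "delete_vertex D v" and ?N = "neighbours D v"
      have N: "?N \<subseteq> {1..n}" by (rule neighbours_subset[OF D])
      have dN: "card ?N \<le> n" using card_mono[OF _ N] by simp
      have "(\<Sum>k = 1..n. ((k - 1) choose t) * ext.dim (stresses n \<alpha> D k)) \<le>
          (\<Sum>k = 1..n. ((k - 1) choose t) * ext.dim (stresses n \<alpha> ?D k) + ((k - 1) choose t) * (card ?N - k))"
      proof (rule sum_mono)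
        fix k assume "k \<in> {1..n}"
        then have "ext.dim (stresses n \<alpha> D k) \<le> ext.dim (stresses n \<alpha> ?D k) + (card ?N - k)"
          by (intro dim_stresses_delete_le[OF gen D vn]) simp
        then show "((k - 1) choose t) * ext.dim (stresses n \<alpha> D k) \<le>
            ((k - 1) choose t) * ext.dim (stresses n \<alpha> ?D k) + ((k - 1) choose t) * (card ?N - k)"
          unfolding distrib_left[symmetric] by (rule mult_left_mono) simp
      qed
      also have "\<dots> = (\<Sum>k = 1..n. ((k - 1) choose t) * ext.dim (stresses n \<alpha> ?D k)) + (card ?N choose (t + 2))"
        by (simp only: sum.distrib sum_choose_times_diff[OF dN])
      also have "(\<Sum>k = 1..n. ((k - 1) choose t) * ext.dim (stresses n \<alpha> ?D k)) \<le> card (cliques {1..n} ?D (t + 3))"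
      proof (rule psubset.IH[of "W - {v}"])
        show "W - {v} \<subset> W" using v(1) by blast
        show "W - {v} \<subseteq> {1..n}" using psubset.prems(1) by blast
        show "?D \<subseteq> subsets_of_size n 2" using D by (auto simp: delete_vertex_def)
        show "e \<subseteq> W - {v}" if "e \<in> ?D" for e
          using that psubset.prems(3) by (auto simp: delete_vertex_def)
        have "induced_edges ?D U = induced_edges D U" if "U \<subseteq> W - {v}" for U
          using that by (auto simp: induced_edges_def delete_vertex_def)
        then show "chordal (W - {v}) ?D"
          using chordal_subset[OF psubset.prems(4), of "W - {v}"] unfolding chordal_def by auto
      qed
      also have "card ?N choose (t + 2) = card {T \<in> cliques {1..n} D (t + 2). T \<subseteq> ?N}"
      proof -
        have "{a, b} \<in> D" if "a \<in> ?N" "b \<in> ?N" "a \<noteq> b" for a b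
        proof -
          have "a \<in> W" "b \<in> W" using that(1,2) psubset.prems(3) by (auto simp: neighbours_def)
          then show ?thesis using v(2) that unfolding simplicial_def neighbours_def by blast
        qed
        then have "{T \<in> cliques {1..n} D (t + 2). T \<subseteq> ?N} = {T. T \<subseteq> ?N \<and> card T = t + 2}"
          using N unfolding cliques_def by blast
        then show ?thesis using n_subsets[of ?N "t + 2"] finite_subset[OF N] by simp
      qed
      also have "card (cliques {1..n} ?D (t + 3)) + card {T \<in> cliques {1..n} D (t + 2). T \<subseteq> ?N} =
          card (cliques {1..n} D (t + 3))"
        using card_cliques_delete[OF _ vn edges, where s = "t + 2"] by (simp add: eval_nat_numeral)
      finally show ?thesis by simp
    qed
  qed
qed

section \<open>Triangles compared with stresses\<close>

lemma card_triangles_delete: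
  assumes D: "D \<subseteq> subsets_of_size n 2" and v: "v \<in> {1..n}"
  shows "card (cliques {1..n} D 3) =
    card (cliques {1..n} (delete_vertex D v) 3) + card {S \<in> D. S \<subseteq> neighbours D v}"
proof -
  have edges: "card e = 2" if "e \<in> D" for e using that D by (auto simp: subsets_of_size_def)
  have "cliques {1..n} D 2 = D"
    using D by (auto simp: cliques_def subsets_of_size_def card_2_iff insert_commute doubleton_eq_iff)
  then show ?thesis
    using card_cliques_delete[OF _ v edges, where s = 2] by (simp add: eval_nat_numeral)
qed

text \<open>The sum of all z_k minus the number of triangles does not increase when a vertex is
  deleted; over the natural numbers this is written additively. In the proof, F is the set of
  vertices deleted so far.\<close>

lemma stresses_triangles_induced:
  assumes gen: "generic_extension emb n \<alpha>" and D: "D \<subseteq> subsets_of_size n 2"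
  shows "(\<Sum>k = 1..n. ext.dim (stresses n \<alpha> (induced_edges D W) k)) + card (cliques {1..n} D 3) \<le>
    (\<Sum>k = 1..n. ext.dim (stresses n \<alpha> D k)) + card (cliques {1..n} (induced_edges D W) 3)"
proof -
  let ?D = "\<lambda>F. {e \<in> D. e \<inter> F = {}}"
  have main: "(\<Sum>k = 1..n. ext.dim (stresses n \<alpha> (?D F) k)) + card (cliques {1..n} D 3) \<le>
      (\<Sum>k = 1..n. ext.dim (stresses n \<alpha> D k)) + card (cliques {1..n} (?D F) 3)"
    if "finite F" "F \<subseteq> {1..n}" for F
    using that
  proof (induction F rule: finite_induct)
    case (insert v F)
    have DF: "?D F \<subseteq> subsets_of_size n 2" using D by blast
    have v: "v \<in> {1..n}" using insert.prems by simp
    have "delete_vertex (?D F) v = ?D (insert v F)" by (auto simp: delete_vertex_def)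
    then show ?case
      using insert.IH insert.prems sum_dim_stresses_delete[OF gen DF v] card_triangles_delete[OF DF v]
      by simp
  qed simp
  have "e \<inter> ({1..n} - W) = {} \<longleftrightarrow> e \<subseteq> W" if "e \<in> D" for e
  proof -
    have "e \<subseteq> {1..n}" using that D by (auto simp: subsets_of_size_def)
    then show ?thesis by blast
  qed
  then have "?D ({1..n} - W) = induced_edges D W" unfolding induced_edges_def by auto
  then show ?thesis using main[of "{1..n} - W"] by simp
qed

text \<open>A clique is recovered from the edge formed by its two largest vertices and the remaining
  t + 1 vertices, which lie below that edge. The inner sum over k expands (Min S - 1 choose t +
  1).\<close>

lemma card_cliques_upper_bound:
  assumes T: "T \<subseteq> subsets_of_size n 2"
  shows "card (cliques {1..n} T (t + 3)) \<le> (\<Sum>k = 1..n. ((k - 1) choose t) * card {S \<in> T. k < Min S})"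
proof -
  have finT: "finite T" by (rule finite_edge_set[OF T])
  let ?\<Sigma> = "Sigma T (\<lambda>S. {R. R \<subseteq> {1..<Min S} \<and> card R = t + 1})"
  have sub: "finite {R. R \<subseteq> {1..<m} \<and> card R = t + 1}" for m :: nat
    by (rule finite_subset[of _ "Pow {1..<m}"]) auto
  have "cliques {1..n} T (t + 3) \<subseteq> (\<lambda>(S, R). S \<union> R) ` ?\<Sigma>"
  proof
    fix U assume U: "U \<in> cliques {1..n} T (t + 3)"
    then have Un: "U \<subseteq> {1..n}" and cU: "card U = t + 3"
      and cl: "\<And>a b. a \<in> U \<Longrightarrow> b \<in> U \<Longrightarrow> a \<noteq> b \<Longrightarrow> {a, b} \<in> T"
      by (auto simp: cliques_def)
    have fin: "finite U" using Un by (rule finite_if_subset_atLeastAtMost)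
    define q where "q = Max U"
    have "U \<noteq> {}" using cU by auto
    then have q: "q \<in> U" "\<And>u. u \<in> U \<Longrightarrow> u \<le> q" using fin by (simp_all add: q_def)
    define p where "p = Max (U - {q})"
    have "card (U - {q}) = t + 2" using q(1) cU fin by simp
    then have "U - {q} \<noteq> {}" by (metis card.empty add_is_0 zero_neq_numeral)
    then have p: "p \<in> U - {q}" "\<And>u. u \<in> U - {q} \<Longrightarrow> u \<le> p"
      unfolding p_def by (rule Max_in[OF finite_Diff[OF fin]], intro Max_ge) (use fin in auto)
    have pq: "p < q" using p(1) q(2)[of p] by auto
    have "Min {p, q} = p" using pq by (simp add: min_def)
    moreover have "U - {p, q} \<subseteq> {1..<p}"
    proof
      fix u assume u: "u \<in> U - {p, q}"
      then have "u \<le> p" "u \<noteq> p" "u \<in> {1..n}" using p(2)[of u] Un by auto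
      then show "u \<in> {1..<p}" by simp
    qed
    moreover have "card (U - {p, q}) = t + 1"
      using p(1) q(1) pq fin cU by (simp add: card_Diff_subset)
    moreover have "{p, q} \<in> T" using cl[of p q] p(1) q(1) pq by auto
    ultimately have "({p, q}, U - {p, q}) \<in> ?\<Sigma>" by simp
    moreover have "U = (\<lambda>(S, R). S \<union> R) ({p, q}, U - {p, q})" using p(1) q(1) by auto
    ultimately show "U \<in> (\<lambda>(S, R). S \<union> R) ` ?\<Sigma>" by (rule rev_image_eqI)
  qed
  then have "card (cliques {1..n} T (t + 3)) \<le> card ((\<lambda>(S, R). S \<union> R) ` ?\<Sigma>)"
    using finT sub by (intro card_mono finite_imageI finite_SigmaI) auto
  also have "\<dots> \<le> card ?\<Sigma>"
    using finT sub by (intro card_image_le finite_SigmaI) auto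
  also have "\<dots> = (\<Sum>S\<in>T. card {R. R \<subseteq> {1..<Min S} \<and> card R = t + 1})"
    using finT sub by (intro card_SigmaI) auto
  also have "\<dots> = (\<Sum>S\<in>T. \<Sum>k = 1..n. if k < Min S then (k - 1) choose t else 0)"
  proof (rule sum.cong[OF refl])
    fix S assume "S \<in> T"
    then have S: "S \<subseteq> {1..n}" "card S = 2" using T by (auto simp: subsets_of_size_def)
    then have "S \<noteq> {}" "finite S" using finite_if_subset_atLeastAtMost by auto
    then have m: "Min S \<in> {1..n}" using Min_in S(1) by blast
    have "card {R. R \<subseteq> {1..<Min S} \<and> card R = t + 1} = (Min S - 1) choose Suc t"
      using n_subsets[of "{1..<Min S}" "t + 1"] by simp
    also have "\<dots> = (\<Sum>k = 1..n. if k \<le> Min S - 1 then (k - 1) choose t else 0)"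
      using m by (intro sum_choose_diff[symmetric]) auto
    also have "\<dots> = (\<Sum>k = 1..n. if k < Min S then (k - 1) choose t else 0)"
      using m by (intro sum.cong) auto
    finally show "card {R. R \<subseteq> {1..<Min S} \<and> card R = t + 1} =
        (\<Sum>k = 1..n. if k < Min S then (k - 1) choose t else 0)" .
  qed
  also have "\<dots> = (\<Sum>k = 1..n. \<Sum>S\<in>T. if k < Min S then (k - 1) choose t else 0)"
    by (rule sum.swap)
  also have "\<dots> = (\<Sum>k = 1..n. ((k - 1) choose t) * card {S \<in> T. k < Min S})"
  proof (rule sum.cong[OF refl])
    fix k
    have "(\<Sum>S\<in>T. if k < Min S then (k - 1) choose t else 0) = (\<Sum>S\<in>{S \<in> T. k < Min S}. (k - 1) choose t)"
      using finT by (intro sum.mono_neutral_cong_right) auto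
    then show "(\<Sum>S\<in>T. if k < Min S then (k - 1) choose t else 0) = ((k - 1) choose t) * card {S \<in> T. k < Min S}"
      by simp
  qed
  finally show ?thesis .
qed

text \<open>An edge {p, q} with p < q and a vertex k < p form a triangle, because shiftedness
  provides {k, q} and {k, p}. The vertex k is recovered as the minimum, so distinct choices give
  distinct triangles.\<close>

lemma card_triangles_shifted_lower_bound:
  assumes T: "T \<subseteq> subsets_of_size n 2"
    and shifted: "\<And>S i j. insert j (S - {i}) \<in> T \<Longrightarrow> i \<in> S \<Longrightarrow> j \<notin> S \<Longrightarrow> i < j \<Longrightarrow> S \<subseteq> {1..n} \<Longrightarrow> S \<in> T"
  shows "(\<Sum>k = 1..n. card {S \<in> T. k < Min S}) \<le> card (cliques {1..n} T 3)"
proof -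
  have finT: "finite T" by (rule finite_edge_set[OF T])
  let ?\<Sigma> = "Sigma {1..n} (\<lambda>k. {S \<in> T. k < Min S})"
  have mem: "k \<notin> S \<and> Min (insert k S) = k \<and> finite S" if "(k, S) \<in> ?\<Sigma>" for k S
  proof -
    have S: "finite S" "S \<noteq> {}" "k < Min S"
      using that T finite_if_subset_atLeastAtMost by (auto simp: subsets_of_size_def)
    then show ?thesis by (auto simp: min_def)
  qed
  have "inj_on (\<lambda>(k, S). insert k S) ?\<Sigma>"
  proof (rule inj_onI, clarify)
    fix k S l R assume k: "k \<in> {1..n}" "S \<in> T" "k < Min S" and l: "l \<in> {1..n}" "R \<in> T" "l < Min R"
      and eq: "insert k S = insert l R"
    have kS: "k \<notin> S \<and> Min (insert k S) = k" and lR: "l \<notin> R \<and> Min (insert l R) = l"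
      using mem[of k S] mem[of l R] k l by auto
    then have "k = l" using eq by simp
    then show "k = l \<and> S = R" using eq kS lR by (simp add: insert_ident)
  qed
  then have "card ?\<Sigma> = card ((\<lambda>(k, S). insert k S) ` ?\<Sigma>)" by (rule card_image[symmetric])
  also have "\<dots> \<le> card (cliques {1..n} T 3)"
  proof (rule card_mono[OF finite_cliques])
    show "(\<lambda>(k, S). insert k S) ` ?\<Sigma> \<subseteq> cliques {1..n} T 3"
    proof clarify
      fix k S assume k: "k \<in> {1..n}" and S: "S \<in> T" "k < Min S"
      then have Sn: "S \<subseteq> {1..n}" "card S = 2" using T by (auto simp: subsets_of_size_def)
      obtain p q where pq: "S = {p, q}" "p < q"
        using Sn(2) unfolding card_2_iff by (metis insert_commute linorder_neqE_nat)
      have kp: "k < p" "k < q" using S(2) pq by (auto simp: min_def)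
      have kq: "{k, q} \<in> T"
      proof (rule shifted[of p _ k])
        have "insert p ({k, q} - {k}) = S" using pq kp by auto
        then show "insert p ({k, q} - {k}) \<in> T" using S(1) by simp
      qed (use pq kp k Sn in auto)
      have "{k, p} \<in> T"
      proof (rule shifted[of q _ k])
        have "insert q ({k, p} - {k}) = S" using pq kp by auto
        then show "insert q ({k, p} - {k}) \<in> T" using S(1) by simp
      qed (use pq kp k Sn in auto)
      then show "insert k S \<in> cliques {1..n} T 3"
        using kq S(1) pq kp k Sn by (auto simp: cliques_def insert_commute)
    qed
  qed simp
  also have "card ?\<Sigma> = (\<Sum>k = 1..n. card {S \<in> T. k < Min S})"
    using finT by (intro card_SigmaI) auto
  finally show ?thesis .
qed

section \<open>Induced cycles\<close>

lemma bij_betw_Suc_mod: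
  assumes "0 < m"
  shows "bij_betw (\<lambda>i. Suc i mod m) {..<m} {..<m}"
proof -
  have "inj_on (\<lambda>i. Suc i mod m) {..<m}"
    by (rule inj_onI) (auto simp: mod_Suc split: if_splits)
  moreover have "(\<lambda>i. Suc i mod m) ` {..<m} \<subseteq> {..<m}" using assms by auto
  ultimately show ?thesis
    unfolding bij_betw_def by (simp add: endo_inj_surj)
qed

text \<open>An edge oriented from u to v with symmetric weight y becomes the matrix with y at (u, v)
  and -y at (v, u), whichever of u and v is larger.\<close>

lemma orient_sign_edge:
  fixes y :: "nat \<Rightarrow> nat \<Rightarrow> 'k::field"
  assumes "u \<noteq> v" "y v u = y u v"
  shows "orient_sign a b * (if {a, b} = {u, v} then orient_sign u v * y u v else 0) =
    (if a = u \<and> b = v then y a b else 0) - (if a = v \<and> b = u then y a b else 0)"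
proof -
  have sq: "orient_sign u v * (orient_sign u v * y u v) = y u v"
    by (simp add: mult.assoc[symmetric] orient_sign_square[OF assms(1)])
  consider "a = u" "b = v" | "a = v" "b = u" | "{a, b} \<noteq> {u, v}"
    by (auto simp: doubleton_eq_iff)
  then show ?thesis
  proof cases
    case 1
    then show ?thesis using assms(1) sq by simp
  next
    case 2
    have *: "orient_sign v u * (orient_sign u v * y u v) = - y u v"
      unfolding orient_sign_swap[of v u] by (simp add: sq)
    have e: "{a, b} = {u, v}" and ne: "\<not> (a = u \<and> b = v)" using 2 assms(1) by blast+
    show ?thesis
      unfolding if_P[OF e] if_not_P[OF ne] if_P[OF conjI[OF 2]] diff_0
      unfolding 2 by (simp only: * assms(2))
  next
    case 3
    then have ne: "\<not> (a = u \<and> b = v)" "\<not> (a = v \<and> b = u)" by auto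
    show ?thesis
      unfolding if_not_P[OF 3] if_not_P[OF ne(1)] if_not_P[OF ne(2)] by simp
  qed
qed

text \<open>With a = \<open>\<alpha> 1\<close>, the edge oriented from b to its successor b' gets
  weight 1 / (a_b a_b'). In the equation at b the outgoing edge contributes 1 / a_b and the incoming
  edge -1 / a_b.\<close>

lemma cycle_stress:
  assumes gen: "generic_extension emb n \<alpha>" and W: "W \<subseteq> {1..n}" and cyc: "is_cycle m W L"
  shows "1 \<le> ext.dim (stresses n \<alpha> L 1)"
proof -
  obtain c where m: "3 \<le> m" and c: "bij_betw c {..<m} W" and L: "L = {{c i, c (Suc i mod m)} | i. i < m}"
    using cyc unfolding is_cycle_def by blast
  have inj: "c i = c j \<longleftrightarrow> i = j" if "i < m" "j < m" for i j
    using c that unfolding bij_betw_def inj_on_def by auto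
  have cW: "c i \<in> {1..n}" if "i < m" for i
    using c W that unfolding bij_betw_def by auto
  have n0: "1 \<in> {1..n}" using cW[of 0] m by auto
  let ?s = "\<lambda>i. Suc i mod m" and ?a = "\<alpha> 1"
  have s: "?s i < m" for i using m by simp
  have s_ne: "?s i \<noteq> i" if "i < m" for i using m that by (simp add: mod_Suc)
  have nz: "?a (c i) \<noteq> 0" if "i < m" for i
    by (rule generic_entry_nonzero[OF gen n0 cW[OF that]])
  define w where "w S = (\<Sum>i<m. if S = {c i, c (?s i)} then
      orient_sign (c i) (c (?s i)) * (1 / (?a (c i) * ?a (c (?s i)))) else 0)" for S
  have skew_w: "skew w a b = (\<Sum>i<m. (if a = c i \<and> b = c (?s i) then 1 / (?a a * ?a b) else 0) -
      (if a = c (?s i) \<and> b = c i then 1 / (?a a * ?a b) else 0))" for a b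
    unfolding skew_def w_def sum_distrib_left
  proof (rule sum.cong[OF refl])
    fix i assume "i \<in> {..<m}"
    then have i: "i < m" by simp
    have ne: "c i \<noteq> c (?s i)" using inj[OF i s[of i]] s_ne[OF i] by simp
    show "orient_sign a b * (if {a, b} = {c i, c (?s i)} then
        orient_sign (c i) (c (?s i)) * (1 / (?a (c i) * ?a (c (?s i)))) else 0) =
      (if a = c i \<and> b = c (?s i) then 1 / (?a a * ?a b) else 0) -
      (if a = c (?s i) \<and> b = c i then 1 / (?a a * ?a b) else 0)"
      by (rule orient_sign_edge[OF ne, of "\<lambda>a b. 1 / (?a a * ?a b)"]) (simp only: mult.commute)
  qed
  have "w S = 0" if S: "S \<notin> L" for S
    unfolding w_def
  proof (intro sum.neutral ballI)
    fix i assume "i \<in> {..<m}"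
    then have "S \<noteq> {c i, c (?s i)}" using S unfolding L by blast
    then show "(if S = {c i, c (?s i)} then
        orient_sign (c i) (c (?s i)) * (1 / (?a (c i) * ?a (c (?s i)))) else 0) = 0"
      by (rule if_not_P)
  qed
  then have "w \<in> coord_space L" by (simp add: coord_space_def)
  moreover have "(\<Sum>b = 1..n. skew w a b * ?a b) = 0" for a
  proof -
    have "(\<Sum>b = 1..n. skew w a b * ?a b) = (\<Sum>b = 1..n. \<Sum>i<m.
        (if b = c (?s i) then (if a = c i then 1 / ?a a else 0) else 0) -
        (if b = c i then (if a = c (?s i) then 1 / ?a a else 0) else 0))"
      unfolding skew_w sum_distrib_right
    proof (intro sum.cong[OF refl])
      fix b i assume "i \<in> {..<m}"
      then have "?a (c i) \<noteq> 0" "?a (c (?s i)) \<noteq> 0" using nz s by auto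
      then show "((if a = c i \<and> b = c (?s i) then 1 / (?a a * ?a b) else 0) -
        (if a = c (?s i) \<and> b = c i then 1 / (?a a * ?a b) else 0)) * ?a b =
        (if b = c (?s i) then (if a = c i then 1 / ?a a else 0) else 0) -
        (if b = c i then (if a = c (?s i) then 1 / ?a a else 0) else 0)"
        by (auto simp: left_diff_distrib)
    qed
    also have "\<dots> = (\<Sum>i<m. \<Sum>b = 1..n.
        (if b = c (?s i) then (if a = c i then 1 / ?a a else 0) else 0) -
        (if b = c i then (if a = c (?s i) then 1 / ?a a else 0) else 0))"
      by (rule sum.swap)
    also have "\<dots> = (\<Sum>i<m. (if a = c i then 1 / ?a a else 0) - (if a = c (?s i) then 1 / ?a a else 0))"
    proof (rule sum.cong[OF refl])
      fix i assume "i \<in> {..<m}"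
      then show "(\<Sum>b = 1..n. (if b = c (?s i) then (if a = c i then 1 / ?a a else 0) else 0) -
          (if b = c i then (if a = c (?s i) then 1 / ?a a else 0) else 0)) =
        (if a = c i then 1 / ?a a else 0) - (if a = c (?s i) then 1 / ?a a else 0)"
        using cW[of i] cW[OF s[of i]] by (simp add: sum_subtractf)
    qed
    also have "\<dots> = (\<Sum>i<m. if a = c i then 1 / ?a a else 0) - (\<Sum>i<m. if a = c (?s i) then 1 / ?a a else 0)"
      by (rule sum_subtractf)
    also have "(\<Sum>i<m. if a = c (?s i) then 1 / ?a a else 0) = (\<Sum>i<m. if a = c i then 1 / ?a a else 0)"
      using m by (intro sum.reindex_bij_betw[OF bij_betw_Suc_mod]) simp
    finally show ?thesis by simp
  qed
  ultimately have w: "w \<in> stresses n \<alpha> L 1" by (simp add: stresses_def)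
  \<comment> \<open>As m is at least 3, the cycle does not also run from \<open>c 1\<close> to
    \<open>c 0\<close>; one summand remains and nothing can cancel it.\<close>
  have "skew w (c 0) (c 1) = 1 / (?a (c 0) * ?a (c 1))"
  proof -
    have "skew w (c 0) (c 1) = (\<Sum>i<m. if i = 0 then 1 / (?a (c 0) * ?a (c 1)) else 0)"
      unfolding skew_w
    proof (rule sum.cong[OF refl])
      fix i assume "i \<in> {..<m}"
      then have i: "i < m" by simp
      have m': "0 < m" "1 < m" using m by auto
      have eqs: "c 0 = c i \<longleftrightarrow> 0 = i" "c 1 = c i \<longleftrightarrow> 1 = i" "c 0 = c (?s i) \<longleftrightarrow> 0 = ?s i" "c 1 = c (?s i) \<longleftrightarrow> 1 = ?s i"
        by (rule inj[OF m'(1) i] inj[OF m'(2) i] inj[OF m'(1) s] inj[OF m'(2) s])+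
      have s01: "0 \<noteq> ?s 1" "1 = ?s 0" using m by (auto simp: mod_Suc)
      have A: "(c 0 = c i \<and> c 1 = c (?s i)) = (i = 0)"
        unfolding eqs using s01(2) by blast
      have B: "\<not> (c 0 = c (?s i) \<and> c 1 = c i)"
        unfolding eqs
      proof (rule notI, erule conjE)
        assume s0: "0 = ?s i" and i1: "1 = i"
        show False using s01(1) s0[folded i1] by (rule notE)
      qed
      show "(if c 0 = c i \<and> c 1 = c (?s i) then 1 / (?a (c 0) * ?a (c 1)) else 0) -
          (if c 0 = c (?s i) \<and> c 1 = c i then 1 / (?a (c 0) * ?a (c 1)) else 0) =
        (if i = 0 then 1 / (?a (c 0) * ?a (c 1)) else 0)"
        unfolding A if_not_P[OF B] by simp
    qed
    then show ?thesis using m by simp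
  qed
  then have "skew w (c 0) (c 1) \<noteq> 0" using nz[of 0] nz[of 1] m by simp
  then have "w \<noteq> 0" by (auto simp: skew_def)
  then have "ext.independent {w}" by (simp only: ext.dependent_single not_False_eq_True)
  then have "ext.dim {w} = 1" by (subst ext.dim_eq_card_independent) simp_all
  moreover have "ext.dim {w} \<le> ext.dim (stresses n \<alpha> L 1)"
  proof (rule dim_mono_coord_space[OF _ stresses_subset_coord_space])
    show "{w} \<subseteq> stresses n \<alpha> L 1" using w by simp
    show "finite L" unfolding L by simp
  qed
  ultimately show ?thesis by simp
qed

lemma cycle_no_triangles:
  assumes cyc: "is_cycle m W L" and "4 \<le> m"
  shows "cliques V L 3 = {}"
proof (rule ccontr)
  assume "cliques V L 3 \<noteq> {}"
  then obtain S where S: "card S = 3" "\<And>a b. a \<in> S \<Longrightarrow> b \<in> S \<Longrightarrow> a \<noteq> b \<Longrightarrow> {a, b} \<in> L"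
    unfolding cliques_def by blast
  obtain c where c: "bij_betw c {..<m} W" and L: "L = {{c i, c (Suc i mod m)} | i. i < m}"
    using cyc unfolding is_cycle_def by blast
  obtain a b d where abd: "S = {a, b, d}" "a \<noteq> b" "b \<noteq> d" "a \<noteq> d"
    using S(1) unfolding card_3_iff by blast
  have edges: "{a, b} \<in> L" "{b, d} \<in> L" "{a, d} \<in> L" using S(2) abd by auto
  have "a \<in> c ` {..<m}" "b \<in> c ` {..<m}" "d \<in> c ` {..<m}"
    using edges \<open>4 \<le> m\<close> unfolding L by (auto simp: doubleton_eq_iff)
  then obtain i j k where ijk: "a = c i" "b = c j" "d = c k" "i < m" "j < m" "k < m" by auto
  have adj: "y = Suc x \<or> x = Suc y \<or> (x = 0 \<and> Suc y = m) \<or> (y = 0 \<and> Suc x = m)"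
    if xy: "{c x, c y} \<in> L" "x < m" "y < m" for x y
  proof -
    obtain l where l: "{c x, c y} = {c l, c (Suc l mod m)}" "l < m" using xy(1) unfolding L by blast
    have "Suc l mod m < m" using \<open>4 \<le> m\<close> by simp
    moreover have "inj_on c {..<m}" using c by (simp add: bij_betw_def)
    ultimately have "x = l \<and> y = Suc l mod m \<or> x = Suc l mod m \<and> y = l"
      using l xy(2,3) unfolding inj_on_def doubleton_eq_iff by auto
    then show ?thesis using l(2) by (auto simp: mod_Suc split: if_splits)
  qed
  have "i \<noteq> j" "j \<noteq> k" "i \<noteq> k" using abd ijk by auto
  then show False
    using adj[of i j] adj[of j k] adj[of i k] edges ijk \<open>4 \<le> m\<close> by auto
qed

section \<open>Relabelling the vertices\<close>

lemma chordal_image_imp_chordal: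
  assumes inj: "inj_on f V" and D: "D \<subseteq> Pow V" and ch: "chordal (f ` V) ((`) f ` D)"
  shows "chordal V D"
  unfolding chordal_def
proof (intro allI impI, elim conjE)
  fix W k assume W: "W \<subseteq> V" and cyc: "is_cycle k W (induced_edges D W)"
  then obtain c where k: "3 \<le> k" and c: "bij_betw c {..<k} W"
    and edges: "induced_edges D W = {{c i, c (Suc i mod k)} | i. i < k}"
    unfolding is_cycle_def by blast
  have "bij_betw f W (f ` W)" using inj_on_subset[OF inj W] by (simp add: bij_betw_def)
  then have "bij_betw (f \<circ> c) {..<k} (f ` W)" using c by (rule bij_betw_trans[rotated])
  moreover have "induced_edges ((`) f ` D) (f ` W) = {{(f \<circ> c) i, (f \<circ> c) (Suc i mod k)} | i. i < k}"
  proof -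
    have "f ` e \<subseteq> f ` W \<longleftrightarrow> e \<subseteq> W" if e: "e \<in> D" for e
    proof
      assume *: "f ` e \<subseteq> f ` W"
      show "e \<subseteq> W"
      proof
        fix x assume "x \<in> e"
        moreover have "x \<in> V" using \<open>x \<in> e\<close> e D by blast
        ultimately show "x \<in> W" using * inj_on_image_mem_iff[OF inj _ W] by blast
      qed
    qed (rule image_mono)
    then have "induced_edges ((`) f ` D) (f ` W) = (`) f ` induced_edges D W"
      unfolding induced_edges_def by auto
    also have "\<dots> = {{(f \<circ> c) i, (f \<circ> c) (Suc i mod k)} | i. i < k}"
      unfolding edges setcompr_eq_image image_image by simp
    finally show ?thesis .
  qed
  ultimately have "is_cycle k (f ` W) (induced_edges ((`) f ` D) (f ` W))"
    unfolding is_cycle_def using k by blast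
  then show "k = 3" using ch W unfolding chordal_def by (meson image_mono)
qed

lemma chordal_image_iff:
  assumes inj: "inj_on f V" and D: "D \<subseteq> Pow V"
  shows "chordal (f ` V) ((`) f ` D) \<longleftrightarrow> chordal V D"
proof
  assume ch: "chordal V D"
  let ?g = "inv_into V f"
  have g: "?g ` f ` A = A" if "A \<subseteq> V" for A
    using inv_into_image_cancel[OF inj that] .
  have "(`) ?g ` (`) f ` D = (\<lambda>A. ?g ` f ` A) ` D" by (rule image_image)
  also have "\<dots> = (\<lambda>A. A) ` D" by (rule image_cong[OF refl]) (use g D in blast)
  finally have "chordal (?g ` f ` V) ((`) ?g ` (`) f ` D)" using ch g[OF subset_refl] by simp
  moreover have "inj_on ?g (f ` V)" by (rule inj_on_inv_into) simp
  moreover have "(`) f ` D \<subseteq> Pow (f ` V)" using D by auto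
  ultimately show "chordal (f ` V) ((`) f ` D)" by (intro chordal_image_imp_chordal[of ?g])
qed (rule chordal_image_imp_chordal[OF inj D])

section \<open>Flag shifts\<close>

text \<open>Failure of chordality already shows in the number of triangles, whereas the converse
  compares cliques of every size.\<close>

lemma flag_shift_iff_chordal:
  assumes gen: "generic_extension emb n \<alpha>"
    and sub: "\<And>S T. T \<in> \<Delta> \<Longrightarrow> S \<subseteq> T \<Longrightarrow> S \<in> \<Delta>"
    and clique_complex: "\<And>s. faces n \<Delta> s = cliques {1..n} (faces n \<Delta> 2) s"
  defines "\<Gamma> \<equiv> exterior_shift \<alpha> n \<Delta>"
  shows "(\<forall>s. cliques {1..n} {S \<in> \<Gamma>. card S = 2} s \<subseteq> \<Gamma>) \<longleftrightarrow> chordal {1..n} (faces n \<Delta> 2)"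
proof
  let ?D = "faces n \<Delta> 2" and ?T = "{S \<in> \<Gamma>. card S = 2}"
  have D: "?D \<subseteq> subsets_of_size n 2" by (auto simp: faces_def subsets_of_size_def)
  have T: "?T \<subseteq> subsets_of_size n 2" by (auto simp: \<Gamma>_def exterior_shift_def subsets_of_size_def)
  have edges: "card e = 2" if "e \<in> ?D" for e using that by (simp add: faces_def)
  have z: "ext.dim (stresses n \<alpha> ?D k) = card {S \<in> ?T. k < Min S}" if "k \<in> {1..n}" for k
  proof -
    have "{S \<in> ?T. k < Min S} = {S \<in> \<Gamma>. card S = 2 \<and> k < Min S}" by blast
    then show ?thesis using dim_stresses_eq_card_shift[OF gen, of k \<Delta>] that by (simp add: \<Gamma>_def)
  qed
  have count: "card {S \<in> \<Gamma>. card S = s} = card (cliques {1..n} ?D s)" for s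
    using card_exterior_shift_size[OF gen, of \<Delta> s] clique_complex[of s] by (simp add: \<Gamma>_def)
  have sub_cliques: "{S \<in> \<Gamma>. card S = s} \<subseteq> cliques {1..n} ?T s" for s
  proof
    fix S assume S: "S \<in> {S \<in> \<Gamma>. card S = s}"
    have "{a, b} \<in> ?T" if "a \<in> S" "b \<in> S" "a \<noteq> b" for a b
      using exterior_shift_subset_closed[of \<Delta> S \<alpha> n "{a, b}", OF sub] S that by (simp add: \<Gamma>_def)
    then show "S \<in> cliques {1..n} ?T s"
      using S by (auto simp: cliques_def \<Gamma>_def exterior_shift_def)
  qed
  show "chordal {1..n} ?D" if flag: "\<forall>s. cliques {1..n} ?T s \<subseteq> \<Gamma>"
    unfolding chordal_def
  proof (intro allI impI, elim conjE)
    fix W m assume W: "W \<subseteq> {1..n}" and cyc: "is_cycle m W (induced_edges ?D W)"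
    show "m = 3"
    proof (rule ccontr)
      assume "m \<noteq> 3"
      then have m: "4 \<le> m" using cyc by (simp add: is_cycle_def)
      then have "W \<noteq> {}" using cyc by (force simp: is_cycle_def bij_betw_def)
      then have n: "1 \<in> {1..n}" using W by fastforce
      let ?L = "induced_edges ?D W"
      have "1 \<le> ext.dim (stresses n \<alpha> ?L 1)" by (rule cycle_stress[OF gen W cyc])
      also have "\<dots> \<le> (\<Sum>k = 1..n. ext.dim (stresses n \<alpha> ?L k))"
        using n by (intro member_le_sum) auto
      \<comment> \<open>In \<open>stresses_triangles_induced\<close> the cycle contributes at least
        1 through its stresses and nothing through triangles, which makes the inequality
        strict.\<close>
      finally have "card (cliques {1..n} ?D 3) < (\<Sum>k = 1..n. ext.dim (stresses n \<alpha> ?D k))"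
        using stresses_triangles_induced[OF gen D, of W] cycle_no_triangles[OF cyc m, of "{1..n}"] by simp
      also have "\<dots> = (\<Sum>k = 1..n. card {S \<in> ?T. k < Min S})"
        by (intro sum.cong refl z)
      also have "\<dots> \<le> card (cliques {1..n} ?T 3)"
      proof (rule card_triangles_shifted_lower_bound[OF T])
        fix S :: "nat set" and i j
        assume S: "insert j (S - {i}) \<in> ?T" "i \<in> S" "j \<notin> S" "i < j" "S \<subseteq> {1..n}"
        then have "S \<in> \<Gamma>"
          unfolding \<Gamma>_def by (intro exterior_shift_shifted[OF gen, of j S i]) auto
        moreover have "finite S" using S(5) by (rule finite_if_subset_atLeastAtMost)
        then have "card (insert j (S - {i})) = card S" using S(2,3) card_Suc_Diff1[of S i] by simp
        ultimately show "S \<in> ?T" using S(1) by simp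
      qed
      also have "\<dots> \<le> card {S \<in> \<Gamma>. card S = 3}"
      proof (rule card_mono)
        show "finite {S \<in> \<Gamma>. card S = 3}"
          by (rule finite_subset[of _ "Pow {1..n}"]) (auto simp: \<Gamma>_def exterior_shift_def)
        show "cliques {1..n} ?T 3 \<subseteq> {S \<in> \<Gamma>. card S = 3}"
          using flag by (auto simp: cliques_def)
      qed
      finally show False using count[of 3] by simp
    qed
  qed
  show "\<forall>s. cliques {1..n} ?T s \<subseteq> \<Gamma>" if ch: "chordal {1..n} ?D"
  proof
    fix s
    have "card (cliques {1..n} ?T s) \<le> card (cliques {1..n} ?D s)"
    proof -
      \<comment> \<open>The weighted count begins with triangles, at t = 0; the smaller sizes are
        compared directly.\<close>
      consider "s \<le> 1" | "s = 2" | t where "s = t + 3"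
        by (metis One_nat_def add.commute le_SucE le_add_diff_inverse not_less_eq_eq numeral_2_eq_2 numeral_3_eq_3)
      then show ?thesis
      proof cases
        case 1
        have "a = b" if "S \<subseteq> {1..n}" "card S = s" "a \<in> S" "b \<in> S" for a b S
          using 1 that card_le_Suc0_iff_eq[of S] finite_if_subset_atLeastAtMost[of S n] by auto
        then have "cliques {1..n} X s = {S. S \<subseteq> {1..n} \<and> card S = s}" for X
          unfolding cliques_def by blast
        then show ?thesis by simp
      next
        case 2
        have "cliques {1..n} ?T 2 \<subseteq> {S \<in> \<Gamma>. card S = 2}"
          unfolding cliques_def card_2_iff by auto
        then have "card (cliques {1..n} ?T 2) \<le> card {S \<in> \<Gamma>. card S = 2}"
          by (rule card_mono[rotated]) (rule finite_edge_set[OF T])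
        then show ?thesis using count[of 2] 2 by simp
      next
        case 3
        have "card (cliques {1..n} ?T (t + 3)) \<le> (\<Sum>k = 1..n. ((k - 1) choose t) * card {S \<in> ?T. k < Min S})"
          by (rule card_cliques_upper_bound[OF T])
        also have "\<dots> = (\<Sum>k = 1..n. ((k - 1) choose t) * ext.dim (stresses n \<alpha> ?D k))"
          by (intro sum.cong refl) (simp only: z)
        also have "\<dots> \<le> card (cliques {1..n} ?D (t + 3))"
          by (rule weighted_stresses_chordal[OF gen subset_refl D _ ch]) (simp add: faces_def)
        finally show ?thesis using 3 by simp
      qed
    qed
    then have "card (cliques {1..n} ?T s) \<le> card {S \<in> \<Gamma>. card S = s}" using count by simp
    then have "{S \<in> \<Gamma>. card S = s} = cliques {1..n} ?T s"
      by (rule card_seteq[OF finite_cliques[OF finite_atLeastAtMost] sub_cliques])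
    then show "cliques {1..n} ?T s \<subseteq> \<Gamma>" by blast
  qed
qed

text \<open>Flagness is invariant under isomorphism, and a flag complex is the independence complex
  of its non-edges. The sizes 0 and 1 belong to the condition: they require the empty set and all
  singletons to be faces, as they are in every independence complex.\<close>

lemma iso_independence_complex_iff_flag:
  fixes \<Gamma> :: "nat set set"
  assumes faces: "\<And>S. S \<in> \<Gamma> \<Longrightarrow> S \<subseteq> {1..n}" and sub: "\<And>S T. T \<in> \<Gamma> \<Longrightarrow> S \<subseteq> T \<Longrightarrow> S \<in> \<Gamma>"
  shows "(\<exists>(V' :: nat set) E'. simple_graph V' E' \<and> complex_iso {1..n} \<Gamma> V' (independence_complex V' E')) \<longleftrightarrow>
    (\<forall>s. cliques {1..n} {S \<in> \<Gamma>. card S = 2} s \<subseteq> \<Gamma>)"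
proof (intro iffI allI subsetI)
  fix s S
  assume "\<exists>(V' :: nat set) E'. simple_graph V' E' \<and> complex_iso {1..n} \<Gamma> V' (independence_complex V' E')"
  then obtain V' :: "nat set" and E' where G': "simple_graph V' E'"
    and "complex_iso {1..n} \<Gamma> V' (independence_complex V' E')" by auto
  then obtain \<phi> where \<phi>: "bij_betw \<phi> {1..n} V'"
    and iso: "(`) \<phi> ` \<Gamma> = independence_complex V' E'"
    unfolding complex_iso_def by auto
  have E': "e \<subseteq> V' \<and> card e = 2" if "e \<in> E'" for e using G' that by (simp add: simple_graph_def)
  have inj: "inj_on \<phi> {1..n}" using \<phi> by (simp add: bij_betw_def)
  assume S: "S \<in> cliques {1..n} {S \<in> \<Gamma>. card S = 2} s"
  then have Sn: "S \<subseteq> {1..n}" by (simp add: cliques_def)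
  have "\<phi> ` S \<in> independence_complex V' E'"
    unfolding independence_complex_def
  proof (intro CollectI conjI ballI notI)
    show "\<phi> ` S \<subseteq> V'" using \<phi> Sn by (auto simp: bij_betw_def)
    fix e assume e: "e \<in> E'" "e \<subseteq> \<phi> ` S"
    obtain x y where "e = {x, y}" "x \<noteq> y" using E'[OF e(1)] unfolding card_2_iff by blast
    then obtain a b where ab: "a \<in> S" "b \<in> S" "a \<noteq> b" "e = {\<phi> a, \<phi> b}" using e(2) by auto
    then have "{a, b} \<in> \<Gamma>" using S by (auto simp: cliques_def)
    then have "\<phi> ` {a, b} \<in> independence_complex V' E'" unfolding iso[symmetric] by (rule imageI)
    then show False using e(1) ab(4) by (auto simp: independence_complex_def)
  qed
  then obtain R where R: "R \<in> \<Gamma>" "\<phi> ` S = \<phi> ` R" unfolding iso[symmetric] by blast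
  then have "S = R" using inj_on_image_eq_iff[OF inj Sn faces[OF R(1)]] by simp
  then show "S \<in> \<Gamma>" using R(1) by simp
next
  assume flag: "\<forall>s. cliques {1..n} {S \<in> \<Gamma>. card S = 2} s \<subseteq> \<Gamma>"
  define E' where "E' = {e. e \<subseteq> {1..n} \<and> card e = 2 \<and> e \<notin> \<Gamma>}"
  have "independence_complex {1..n} E' = \<Gamma>"
  proof (intro equalityI subsetI)
    fix S assume S: "S \<in> independence_complex {1..n} E'"
    then have Sn: "S \<subseteq> {1..n}" by (simp add: independence_complex_def)
    have "{a, b} \<in> \<Gamma>" if "a \<in> S" "b \<in> S" "a \<noteq> b" for a b
    proof (rule ccontr)
      assume "{a, b} \<notin> \<Gamma>"
      then have "{a, b} \<in> E'" using that Sn by (auto simp: E'_def)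
      then show False using S that by (auto simp: independence_complex_def)
    qed
    then have "S \<in> cliques {1..n} {S \<in> \<Gamma>. card S = 2} (card S)"
      using Sn by (auto simp: cliques_def)
    then show "S \<in> \<Gamma>" using flag by blast
  next
    fix S assume "S \<in> \<Gamma>"
    then show "S \<in> independence_complex {1..n} E'"
      using faces sub unfolding independence_complex_def E'_def by blast
  qed
  moreover have "simple_graph {1..n} E'" by (auto simp: simple_graph_def E'_def)
  moreover have "complex_iso {1..n} \<Gamma> {1..n} \<Gamma>"
    unfolding complex_iso_def by (intro exI[of _ "\<lambda>i. i"]) (simp add: bij_betw_def)
  ultimately show "\<exists>(V' :: nat set) E'. simple_graph V' E' \<and> complex_iso {1..n} \<Gamma> V' (independence_complex V' E')"
    by metis
qed

text \<open>Independent sets are the cliques of the complement graph, and injectivity of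
  \<open>label\<close> carries this over to the vertices 1..n.\<close>

lemma label_independence_complex:
  assumes G: "simple_graph V E" and label: "bij_betw label V {1..n}"
  defines "\<Delta> \<equiv> (\<lambda>S. label ` S) ` independence_complex V E"
  shows "faces n \<Delta> 2 = (`) label ` complement_edges V E"
    and "faces n \<Delta> s = cliques {1..n} (faces n \<Delta> 2) s"
    and "S \<in> \<Delta> \<Longrightarrow> R \<subseteq> S \<Longrightarrow> R \<in> \<Delta>"
proof -
  have inj: "inj_on label V" and im: "label ` V = {1..n}" using label by (auto simp: bij_betw_def)
  have E: "e \<subseteq> V \<and> card e = 2" if "e \<in> E" for e using G that by (simp add: simple_graph_def)
  have card: "card (label ` A) = card A" if "A \<subseteq> V" for A
    by (rule card_image[OF inj_on_subset[OF inj that]])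
  show two: "faces n \<Delta> 2 = (`) label ` complement_edges V E"
  proof (intro equalityI subsetI)
    fix S assume "S \<in> faces n \<Delta> 2"
    then obtain A where A: "A \<subseteq> V" "\<forall>e\<in>E. \<not> e \<subseteq> A" "S = label ` A" "card S = 2"
      by (auto simp: faces_def \<Delta>_def independence_complex_def)
    then have "A \<in> complement_edges V E" using card[of A] by (auto simp: complement_edges_def)
    then show "S \<in> (`) label ` complement_edges V E" using A(3) by blast
  next
    fix S assume "S \<in> (`) label ` complement_edges V E"
    then obtain A where A: "A \<subseteq> V" "card A = 2" "A \<notin> E" "S = label ` A"
      by (auto simp: complement_edges_def)
    have "finite A" using A(2) by (intro card_ge_0_finite) simp
    then have "\<not> e \<subseteq> A" if "e \<in> E" for e
      using card_subset_eq[of A e] E[OF that] A(2,3) that by auto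
    then have "A \<in> independence_complex V E" using A(1) by (simp add: independence_complex_def)
    then show "S \<in> faces n \<Delta> 2" using A card[OF A(1)] im by (auto simp: faces_def \<Delta>_def)
  qed
  show "faces n \<Delta> s = cliques {1..n} (faces n \<Delta> 2) s"
  proof (intro equalityI subsetI)
    fix S assume "S \<in> faces n \<Delta> s"
    then obtain A where A: "A \<subseteq> V" "\<forall>e\<in>E. \<not> e \<subseteq> A" "S = label ` A" "card S = s" "S \<subseteq> {1..n}"
      by (auto simp: faces_def \<Delta>_def independence_complex_def)
    have "{a, b} \<in> faces n \<Delta> 2" if ab: "a \<in> S" "b \<in> S" "a \<noteq> b" for a b
    proof -
      obtain x y where xy: "a = label x" "b = label y" "x \<in> A" "y \<in> A" using ab A(3) by blast
      then have "x \<noteq> y" using ab(3) by blast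
      then have "{x, y} \<in> complement_edges V E" using xy A(1,2) by (auto simp: complement_edges_def)
      then show ?thesis unfolding two using xy by (intro image_eqI[of _ _ "{x, y}"]) auto
    qed
    then show "S \<in> cliques {1..n} (faces n \<Delta> 2) s" using A by (simp add: cliques_def)
  next
    fix S assume S: "S \<in> cliques {1..n} (faces n \<Delta> 2) s"
    then have Sn: "S \<subseteq> label ` V" by (simp add: cliques_def im)
    then obtain A where A: "A \<subseteq> V" "S = label ` A" by (rule subset_imageE)
    have "\<not> e \<subseteq> A" if e: "e \<in> E" for e
    proof
      assume eA: "e \<subseteq> A"
      obtain x y where xy: "e = {x, y}" "x \<noteq> y" using E[OF e] unfolding card_2_iff by blast
      then have "label x \<noteq> label y" using inj eA A(1) by (auto simp: inj_on_def)
      then have "{label x, label y} \<in> faces n \<Delta> 2" using S eA xy A(2) by (auto simp: cliques_def)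
      then obtain B where B: "B \<in> complement_edges V E" "label ` B = label ` {x, y}"
        unfolding two by auto
      have "B \<subseteq> V" "{x, y} \<subseteq> V" using B(1) E[OF e] xy(1) by (auto simp: complement_edges_def)
      then have "B = {x, y}" using inj_on_image_eq_iff[OF inj] B(2) by blast
      then show False using B(1) e xy(1) by (simp add: complement_edges_def)
    qed
    then have "A \<in> independence_complex V E" using A(1) by (simp add: independence_complex_def)
    then show "S \<in> faces n \<Delta> s" using S A(2) by (auto simp: faces_def \<Delta>_def cliques_def)
  qed
  show "R \<in> \<Delta>" if "S \<in> \<Delta>" "R \<subseteq> S"
  proof -
    obtain A where A: "A \<in> independence_complex V E" "S = label ` A" using \<open>S \<in> \<Delta>\<close> by (auto simp: \<Delta>_def)
    then obtain B where B: "B \<subseteq> A" "R = label ` B" using \<open>R \<subseteq> S\<close> by (auto elim: subset_imageE)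
    then have "B \<in> independence_complex V E" using A(1) unfolding independence_complex_def by blast
    then show ?thesis using B(2) by (simp add: \<Delta>_def)
  qed
qed

theorem theorem2p13:
  fixes emb :: "'f::field \<Rightarrow> 'k::field"
    and \<alpha> :: "nat \<Rightarrow> nat \<Rightarrow> 'k"
    and V :: "'a set" and E :: "'a set set"
    and n :: nat and label :: "'a \<Rightarrow> nat"
  assumes "simple_graph V E"
    and "bij_betw label V {1..n}"
    and "generic_extension emb n \<alpha>"
  shows "(\<exists>(V' :: nat set) E'. simple_graph V' E' \<and>
            complex_iso {1..n}
              (exterior_shift \<alpha> n ((\<lambda>S. label ` S) ` independence_complex V E))
              V' (independence_complex V' E'))
         \<longleftrightarrow> co_chordal V E"
proof -
  let ?\<Delta> = "(\<lambda>S. label ` S) ` independence_complex V E"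
  note \<Delta> = label_independence_complex[OF assms(1,2)]
  have inj: "inj_on label V" and im: "label ` V = {1..n}"
    using assms(2) by (auto simp: bij_betw_def)
  have "(\<exists>(V' :: nat set) E'. simple_graph V' E' \<and>
      complex_iso {1..n} (exterior_shift \<alpha> n ?\<Delta>) V' (independence_complex V' E')) \<longleftrightarrow>
      (\<forall>s. cliques {1..n} {S \<in> exterior_shift \<alpha> n ?\<Delta>. card S = 2} s \<subseteq> exterior_shift \<alpha> n ?\<Delta>)"
  proof (rule iso_independence_complex_iff_flag)
    show "S \<subseteq> {1..n}" if "S \<in> exterior_shift \<alpha> n ?\<Delta>" for S
      using that by (simp add: exterior_shift_def)
    show "S \<in> exterior_shift \<alpha> n ?\<Delta>" if "T \<in> exterior_shift \<alpha> n ?\<Delta>" "S \<subseteq> T" for S T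
      using exterior_shift_subset_closed[of ?\<Delta> T \<alpha> n S] \<Delta>(3) that by blast
  qed
  also have "\<dots> \<longleftrightarrow> chordal {1..n} (faces n ?\<Delta> 2)"
    by (rule flag_shift_iff_chordal[OF assms(3)]) (rule \<Delta>(3), assumption, assumption, rule \<Delta>(2))
  also have "\<dots> \<longleftrightarrow> co_chordal V E"
    unfolding \<Delta>(1) im[symmetric] co_chordal_def
    by (rule chordal_image_iff[OF inj]) (auto simp: complement_edges_def)
  finally show ?thesis .
qed

end
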